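(* Let $L_k=I_{d_k}+\sum_{j=1}^gA_{k,j}x_j$, $k=1,2$, be monic linear matrix pencils, where $d_k\in\mathbb N$ and $A_{k,j}\in\mathbb S_{d_k}$. Then $D_{L_1}=D_{L_2}$ if and only if every $\sigma$-minimal whole subpencil $\tilde L_1$ of $L_1$ is unitarily equivalent to any $\sigma$-minimal whole subpencil $\tilde L_2$ of $L_2$, i.e., there is a unitary matrix $U$ such that $$\tilde L_2=U^\ast\tilde L_1U.$$
   Context: Everything is over the reals; $\mathbb S_n$ is the set of real symmetric $n\times n$ matrices. For a pencil $L(x)=A_0+\sum_{j=1}^gA_jx_j$ with $A_j\in\mathbb S_d$ and $X\in\mathbb S_n^g$, $L(X)=A_0\otimes I_n+\sum_jA_j\otimes X_j$; $D_L(n)=\{X\in\mathbb S_n^g:L(X)\succeq0\}$ and $D_L=(D_L(n))_{n\in\mathbb N}$ (equality meaning equality for all $n$). If $H\subseteq\mathbb R^d$ is a subspace invariant under all $A_j$ (hence reducing, as the $A_j$ are symmetric), the pencil $\tilde L$ whose coefficients are the restrictions $A_j|_H$ is called a subpencil of $L$; it is a proper subpencil if $H\neq\mathbb R^d$, and a whole subpencil if $D_{\tilde L}=D_L$. A pencil is $\sigma$-minimal if it has no proper whole subpencil. $U^\ast\tilde L_1U$ is the pencil obtained by applying $T\mapsto U^\ast TU$ to each coefficient. *)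

theory Defs
  imports "HOL-Library.FuncSet" "Jordan_Normal_Form.VS_Connect"
begin

definition sym_mats :: "nat \<Rightarrow> real mat set" where
  "sym_mats n = {X \<in> carrier_mat n n. X\<^sup>T = X}"

definition psd :: "real mat \<Rightarrow> bool" where
  "psd M \<longleftrightarrow> M \<in> sym_mats (dim_row M) \<and>
     (\<forall>v \<in> carrier_vec (dim_row M). 0 \<le> v \<bullet> (M *\<^sub>v v))"

text \<open>The Kronecker product, with the usual ordering of the product basis:
  row \<open>i * dim_row B + k\<close> corresponds to the pair \<open>(i, k)\<close>.\<close>
definition kron :: "real mat \<Rightarrow> real mat \<Rightarrow> real mat" (infixl \<open>\<otimes>\<^sub>K\<close> 70) where
  "A \<otimes>\<^sub>K B = mat (dim_row A * dim_row B) (dim_col A * dim_col B)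
     (\<lambda>(r, c). A $$ (r div dim_row B, c div dim_col B) * B $$ (r mod dim_row B, c mod dim_col B))"

text \<open>A pencil of size \<open>d\<close> in \<open>g\<close> variables is given by its coefficient family \<open>A\<close>: the
  constant coefficient is \<open>A 0\<close> and the coefficient of the variable with number \<open>j\<close>
  is \<open>A j\<close>, for \<open>1 \<le> j \<le> g\<close>. Values of \<open>A\<close> beyond \<open>g\<close> are irrelevant.\<close>
type_synonym pencil = "nat \<Rightarrow> real mat"

definition is_pencil :: "nat \<Rightarrow> nat \<Rightarrow> pencil \<Rightarrow> bool" where
  "is_pencil g d A \<longleftrightarrow> (\<forall>j\<in>{0..g}. A j \<in> sym_mats d)"

definition monic_pencil :: "nat \<Rightarrow> nat \<Rightarrow> pencil \<Rightarrow> bool" where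
  "monic_pencil g d A \<longleftrightarrow> is_pencil g d A \<and> A 0 = 1\<^sub>m d"

definition pencil_eval :: "nat \<Rightarrow> nat \<Rightarrow> pencil \<Rightarrow> nat \<Rightarrow> (nat \<Rightarrow> real mat) \<Rightarrow> real mat" where
  "pencil_eval g d A n X =
     A 0 \<otimes>\<^sub>K 1\<^sub>m n + finsum (module_mat TYPE(real) (d * n) (d * n)) (\<lambda>j. A j \<otimes>\<^sub>K X j) {1..g}"

text \<open>The family of all \<open>D\<^sub>L(n)\<close>; equality of two such families is equality at every \<open>n\<close>.\<close>
definition free_spectrahedron :: "nat \<Rightarrow> nat \<Rightarrow> pencil \<Rightarrow> nat \<Rightarrow> (nat \<Rightarrow> real mat) set" where
  "free_spectrahedron g d A n =
     {X \<in> {1..g} \<rightarrow>\<^sub>E sym_mats n. psd (pencil_eval g d A n X)}"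

text \<open>The restrictions of the \<open>A j\<close> to the invariant subspace \<open>H\<close> are written as matrices of
  size \<open>m = dim H\<close> with respect to an orthonormal basis of \<open>H\<close>, the columns of \<open>V\<close>:
  \<open>A j * V = V * B j\<close> says that \<open>B j\<close> is the matrix of the restriction of \<open>A j\<close> to \<open>H\<close> in
  this basis. Every choice of orthonormal basis is admitted, so a subpencil on \<open>H\<close> is
  determined up to orthogonal conjugation. The subspace \<open>H = {0}\<close> is not excluded; it yields
  the pencil of size \<open>0\<close>, whose free spectrahedron consists of all symmetric tuples.\<close>
definition subpencil_on ::
  "nat \<Rightarrow> nat \<Rightarrow> pencil \<Rightarrow> real vec set \<Rightarrow> nat \<Rightarrow> pencil \<Rightarrow> bool" where
  "subpencil_on g d A H m B \<longleftrightarrow>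
     subspace class_ring H (module_vec TYPE(real) d) \<and>
     (\<forall>j\<in>{0..g}. \<forall>h\<in>H. A j *\<^sub>v h \<in> H) \<and>
     (\<exists>V \<in> carrier_mat d m. V\<^sup>T * V = 1\<^sub>m m \<and> vec_space.col_space d V = H \<and>
        (\<forall>j\<in>{0..g}. B j \<in> carrier_mat m m \<and> A j * V = V * B j))"

definition whole_subpencil :: "nat \<Rightarrow> nat \<Rightarrow> pencil \<Rightarrow> nat \<Rightarrow> pencil \<Rightarrow> bool" where
  "whole_subpencil g d A m B \<longleftrightarrow>
     (\<exists>H. subpencil_on g d A H m B) \<and> free_spectrahedron g m B = free_spectrahedron g d A"

definition proper_whole_subpencil :: "nat \<Rightarrow> nat \<Rightarrow> pencil \<Rightarrow> nat \<Rightarrow> pencil \<Rightarrow> bool" where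
  "proper_whole_subpencil g d A m B \<longleftrightarrow>
     (\<exists>H. subpencil_on g d A H m B \<and> H \<noteq> carrier_vec d) \<and>
     free_spectrahedron g m B = free_spectrahedron g d A"

definition sigma_minimal :: "nat \<Rightarrow> nat \<Rightarrow> pencil \<Rightarrow> bool" where
  "sigma_minimal g d A \<longleftrightarrow> \<not> (\<exists>m B. proper_whole_subpencil g d A m B)"

definition unitary_mat :: "nat \<Rightarrow> real mat \<Rightarrow> bool" where
  "unitary_mat m U \<longleftrightarrow> U \<in> carrier_mat m m \<and> U\<^sup>T * U = 1\<^sub>m m \<and> U * U\<^sup>T = 1\<^sub>m m"

definition unitarily_equivalent ::
  "nat \<Rightarrow> nat \<Rightarrow> pencil \<Rightarrow> nat \<Rightarrow> pencil \<Rightarrow> bool" where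
  "unitarily_equivalent g m1 B1 m2 B2 \<longleftrightarrow>
     m1 = m2 \<and> (\<exists>U. unitary_mat m1 U \<and> (\<forall>j\<in>{0..g}. B2 j = U\<^sup>T * B1 j * U))"

end

theory Submission
  imports Defs
begin

text \<open>
  Write \<open>A \<le> B\<close> for tuples of symmetric matrices if \<open>D\<^sub>A\<close> is contained in \<open>D\<^sub>B\<close>. A separation argument
  in the cone of positive semidefinite Choi matrices shows that \<open>A \<le> B\<close> holds iff
  \<open>B j = \<Sum>V. V\<^sup>T * A j * V\<close> for finitely many \<open>V\<close> with \<open>\<Sum>V. V\<^sup>T * V \<le> 1\<close>.

  Let \<open>A\<close> be a tuple of least size among those with a given free spectrahedron and let \<open>B\<close> be any
  other one. Among the completely positive contractions fixing \<open>A\<close>, take one, say \<open>E\<close>, for which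
  \<open>tr E (\<Sum>j. (A j)\<^sup>2)\<close> is maximal. Preceding \<open>E\<close> by a round trip from \<open>A\<close> through \<open>B\<close> cannot increase this
  value, so the Kadison--Schwarz inequalities of the round trip are equalities on the range of the
  Kraus operators of \<open>E\<close>. By leastness that range is everything, and therefore the Kraus operators
  \<open>W\<close> from \<open>B\<close> back to \<open>A\<close> satisfy \<open>B j * W = W * A j\<close>. A maximal partial isometry with this property
  is injective, again by leastness, so \<open>A\<close> is a whole subpencil of \<open>B\<close>. If \<open>B\<close> is \<open>\<sigma>\<close>-minimal, then \<open>B\<close>
  is unitarily equivalent to \<open>A\<close>.
\<close>

section \<open>Conic duality for quadratic forms\<close>

text \<open>Leastness ranges over all symmetric tuples and not only over subpencils. The argument
  compresses a tuple to the kernel of a matrix, which need not be invariant; the result has the same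
  free spectrahedron but need not be a subpencil, so \<sigma>-minimality alone could not rule it
  out. Contractive maps occur instead of unital ones because adding a zero summand to a tuple does
  not change its free spectrahedron. Squares enter the objective because the Kadison--Schwarz
  inequality compares the image of a square with the square of the image, and its defect is a sum of
  squared norms of commutator-like terms: a vanishing defect is an intertwining relation. The
  maximiser takes the place of an idempotent completely positive map obtained by a limit process. It
  exists although lists of Kraus operators have no bounded length: Choi matrices of a fixed size and
  bounded trace form a compact set, and the duality theorem that performs the separation also yields
  the maximiser.\<close>

definition qform :: "'i set \<Rightarrow> ('i \<Rightarrow> 'i \<Rightarrow> real) \<Rightarrow> ('i \<Rightarrow> real) \<Rightarrow> real" where
  "qform I F v = (\<Sum>p\<in>I. \<Sum>q\<in>I. F p q * (v p * v q))"

text \<open>Matrices are functions on an index set of any type here, so that a Choi matrix can be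
  indexed by pairs without flattening pairs into numbers.\<close>

definition psd_on :: "'i set \<Rightarrow> ('i \<Rightarrow> 'i \<Rightarrow> real) \<Rightarrow> bool" where
  "psd_on I Q \<longleftrightarrow> (\<forall>p\<in>I. \<forall>q\<in>I. Q p q = Q q p) \<and> (\<forall>v. 0 \<le> qform I Q v)"

lemma linear_coeff_zero:
  fixes a b :: real
  assumes "\<And>t. 0 \<le> a * t + b * t\<^sup>2"
  shows "a = 0"
proof -
  \<comment> \<open>Replacing b by the positive bound c makes \<open>- a / (2 * c)\<close> the
    minimiser of the majorising parabola.\<close>
  define c where "c = \<bar>b\<bar> + 1"
  have c: "c > 0" "b \<le> c" by (auto simp: c_def)
  have "0 \<le> a * (- a / (2 * c)) + b * (- a / (2 * c))\<^sup>2" by (rule assms)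
  also have "\<dots> \<le> a * (- a / (2 * c)) + c * (- a / (2 * c))\<^sup>2"
    using c by (intro add_left_mono mult_right_mono) auto
  also have "\<dots> = - (a\<^sup>2 / (4 * c))"
    using c by (simp add: power2_eq_square field_split_simps)
  finally have "a\<^sup>2 / (4 * c) \<le> 0" by simp
  then show ?thesis using c by (simp add: divide_le_0_iff)
qed

text \<open>First-order condition at a minimum that can be left in one direction only. The
  restriction t \<le> 1 admits the perturbation that scales a positive semidefinite matrix by 1 -
  t.\<close>

lemma linear_coeff_nonneg:
  fixes a b :: real
  assumes "\<And>t. 0 < t \<Longrightarrow> t \<le> 1 \<Longrightarrow> 0 \<le> a * t + b * t\<^sup>2"
  shows "0 \<le> a"
proof (rule ccontr)
  assume a: "\<not> 0 \<le> a"
  define c where "c = \<bar>b\<bar> + 1"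
  have c: "c > 0" "b \<le> c" by (auto simp: c_def)
  define t where "t = min 1 (- a / (2 * c))"
  have t: "0 < t" "t \<le> 1" using a c unfolding t_def by (auto simp: divide_neg_pos)
  have "t \<le> - a / (2 * c)" by (simp add: t_def)
  then have "c * t \<le> c * (- a / (2 * c))" using c by (intro mult_left_mono) auto
  then have "c * t \<le> - a / 2" using c by simp
  moreover have "b * t \<le> c * t" using t c by (intro mult_right_mono) auto
  ultimately have "a + b * t < 0" using a by simp
  then have "(a + b * t) * t < 0" using t by (simp add: mult_neg_pos)
  then show False using assms[OF t] by (simp add: algebra_simps power2_eq_square)
qed

lemma qform_cong: "(\<And>p. p \<in> I \<Longrightarrow> v p = w p) \<Longrightarrow> qform I F v = qform I F w"
  unfolding qform_def by (intro sum.cong refl) simp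

lemma qform_insert:
  assumes "finite I" "x \<notin> I" "\<forall>p\<in>insert x I. \<forall>q\<in>insert x I. Q p q = Q q p"
  shows "qform (insert x I) Q v = Q x x * (v x)\<^sup>2 + 2 * v x * (\<Sum>p\<in>I. Q p x * v p) + qform I Q v"
proof -
  have "qform (insert x I) Q v = Q x x * (v x)\<^sup>2 + (\<Sum>p\<in>I. Q x p * (v x * v p))
     + (\<Sum>p\<in>I. Q p x * (v p * v x)) + qform I Q v"
    using assms(1,2) unfolding qform_def by (simp add: sum.distrib power2_eq_square)
  moreover have "(\<Sum>p\<in>I. Q x p * (v x * v p)) = (\<Sum>p\<in>I. Q p x * (v p * v x))"
  proof (intro sum.cong refl)
    fix p assume "p \<in> I"
    then have "Q x p = Q p x" using assms(3) by blast
    then show "Q x p * (v x * v p) = Q p x * (v p * v x)" by (simp only: mult.commute)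
  qed
  moreover have "(\<Sum>p\<in>I. Q p x * (v p * v x)) = v x * (\<Sum>p\<in>I. Q p x * v p)"
    by (simp add: sum_distrib_left algebra_simps)
  ultimately show ?thesis by simp
qed

text \<open>One Cholesky step splits off the square of the column of a pivot \<open>x\<close>.\<close>
lemma psd_on_factor:
  assumes "finite I" "psd_on I Q"
  shows "\<exists>V. \<forall>p\<in>I. \<forall>q\<in>I. Q p q = (\<Sum>i\<in>I. V i p * V i q)"
  using assms
proof (induction I arbitrary: Q rule: finite_induct)
  case empty
  then show ?case by simp
next
  case (insert x I)
  have sym: "\<forall>p\<in>insert x I. \<forall>q\<in>insert x I. Q p q = Q q p"
    and nonneg: "\<And>v. 0 \<le> qform (insert x I) Q v"
    using insert.prems unfolding psd_on_def by blast+
  have pos: "0 \<le> Q x x * (v x)\<^sup>2 + 2 * v x * (\<Sum>p\<in>I. Q p x * v p) + qform I Q v" for v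
    using nonneg[of v] unfolding qform_insert[OF insert.hyps sym, of v] .
  \<comment> \<open>If the pivot \<open>Q x x\<close> is 0, division by zero gives c = 0, which is
    the right value because \<open>zero\<close> makes the whole column vanish.\<close>
  define c where "c = (\<lambda>p. Q p x / sqrt (Q x x))"
  have Qxx: "0 \<le> Q x x"
  proof -
    let ?v = "\<lambda>p. if p = x then 1 else (0::real)"
    have "(\<Sum>p\<in>I. Q p x * ?v p) = 0" "qform I Q ?v = 0"
      unfolding qform_def using insert.hyps by (auto intro!: sum.neutral)
    then show ?thesis using pos[of ?v] by simp
  qed
  \<comment> \<open>The test vector with entry t at x and 1 at p makes the form affine in t; an
    affine function bounded below has slope 0.\<close>
  have zero: "Q p x = 0" if "Q x x = 0" "p \<in> I" for p
  proof -
    have "0 \<le> (2 * Q p x) * t + 0 * t\<^sup>2 + Q p p" for t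
    proof -
      let ?v = "\<lambda>q. if q = x then t else if q = p then 1 else 0"
      have "(\<Sum>q\<in>I. Q q x * ?v q) = (\<Sum>q\<in>I. if q = p then Q p x else 0)"
        using insert.hyps by (intro sum.cong) auto
      also have "\<dots> = Q p x" using insert.hyps that by simp
      finally have 1: "(\<Sum>q\<in>I. Q q x * ?v q) = Q p x" .
      have "qform I Q ?v = (\<Sum>r\<in>I. \<Sum>q\<in>I. if q = p then if r = p then Q p p else 0 else 0)"
        unfolding qform_def using insert.hyps by (intro sum.cong refl) auto
      also have "\<dots> = Q p p" using insert.hyps that by simp
      finally show ?thesis using pos[of ?v] 1 that insert.hyps by (simp add: algebra_simps)
    qed
    then have nn: "0 \<le> 2 * Q p x * t + Q p p" for t by simp
    show ?thesis
    proof (rule ccontr)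
      assume "Q p x \<noteq> 0"
      then show False using nn[of "- (Q p p + 1) / (2 * Q p x)"] by (simp add: field_simps)
    qed
  qed
  have cc: "c p * c q * Q x x = Q p x * Q q x" if "p \<in> insert x I" "q \<in> insert x I" for p q
    using Qxx zero that unfolding c_def by (cases "Q x x = 0") auto
  define Q' where "Q' = (\<lambda>p q. Q p q - c p * c q)"
  have "psd_on I Q'"
    unfolding psd_on_def
  proof (intro conjI ballI allI)
    show "Q' p q = Q' q p" if "p \<in> I" "q \<in> I" for p q
      using sym that unfolding Q'_def by (metis insertI2 mult.commute)
    fix v
    define s where "s = (\<Sum>p\<in>I. Q p x * v p)"
    \<comment> \<open>The entry at x is the minimiser of the form for fixed v, so the value at w is
      that of the Schur complement \<open>Q'\<close> at v.\<close>
    define w where "w = v(x := if Q x x = 0 then 0 else - s / Q x x)"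
    have sw: "(\<Sum>p\<in>I. Q p x * w p) = s" unfolding s_def w_def
      using insert.hyps by (intro sum.cong) auto
    have "qform I Q w = qform I Q v" using insert.hyps by (intro qform_cong) (auto simp: w_def)
    then have 1: "0 \<le> Q x x * (w x)\<^sup>2 + 2 * w x * s + qform I Q v" using pos[of w] sw by simp
    have "qform I Q' v = qform I Q v - (\<Sum>p\<in>I. c p * v p) * (\<Sum>p\<in>I. c p * v p)"
      unfolding qform_def Q'_def by (simp add: sum_product sum_subtractf[symmetric] algebra_simps)
    also have "(\<Sum>p\<in>I. c p * v p) = s / sqrt (Q x x)"
      unfolding s_def c_def by (simp add: sum_divide_distrib)
    also have "\<dots> * \<dots> = s\<^sup>2 / Q x x" using Qxx by (simp add: power2_eq_square)
    finally have 2: "qform I Q' v = qform I Q v - s\<^sup>2 / Q x x" .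
    show "0 \<le> qform I Q' v"
    proof (cases "Q x x = 0")
      case True
      then show ?thesis using 1 2 by (simp add: w_def)
    next
      case False
      have "Q x x * (- s / Q x x)\<^sup>2 + 2 * (- s / Q x x) * s = - (s\<^sup>2 / Q x x)"
        using False by (simp add: field_simps power2_eq_square)
      then show ?thesis using 1 2 False by (simp add: w_def)
    qed
  qed
  from insert.IH[OF this] obtain V where V: "\<forall>p\<in>I. \<forall>q\<in>I. Q' p q = (\<Sum>i\<in>I. V i p * V i q)" by blast
  \<comment> \<open>Row x of the new factor is the pivot column c; the other rows get the entry 0 at
    x.\<close>
  define V' where "V' = (\<lambda>i p. if i = x then c p else if p = x then 0 else V i p)"
  have "Q p q = (\<Sum>i\<in>insert x I. V' i p * V' i q)" if pq: "p \<in> insert x I" "q \<in> insert x I" for p q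
  proof -
    have "(\<Sum>i\<in>insert x I. V' i p * V' i q) = c p * c q + (\<Sum>i\<in>I. V' i p * V' i q)"
      using insert.hyps by (simp add: V'_def)
    also have "(\<Sum>i\<in>I. V' i p * V' i q) = (if p = x \<or> q = x then 0 else \<Sum>i\<in>I. V i p * V i q)"
      using insert.hyps by (auto simp: V'_def intro!: sum.neutral sum.cong)
    finally have *: "(\<Sum>i\<in>insert x I. V' i p * V' i q) =
      c p * c q + (if p = x \<or> q = x then 0 else \<Sum>i\<in>I. V i p * V i q)" .
    have cx: "c x * c r = Q r x" if "r \<in> insert x I" for r
      using Qxx zero[of r] that unfolding c_def by (cases "Q x x = 0") auto
    consider "p = x" | "q = x" | "p \<in> I" "q \<in> I" "p \<noteq> x" "q \<noteq> x" using pq by auto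
    then show ?thesis
    proof cases
      case 1
      moreover have "Q x q = Q q x" using sym pq by blast
      ultimately show ?thesis using * cx[of q] pq by simp
    next
      case 2
      then show ?thesis using * cx[of p] pq by (simp add: mult.commute)
    next
      case 3
      then have "Q' p q = (\<Sum>i\<in>I. V i p * V i q)" using V by blast
      then show ?thesis using * 3 by (simp add: Q'_def)
    qed
  qed
  then show ?case by blast
qed

text \<open>Bolzano--Weierstrass by refining the subsequence one coordinate at a time, each time
  through a monotone subsequence of a bounded real sequence.\<close>

lemma bounded_family_convergent_subseq:
  fixes f :: "nat \<Rightarrow> 'i \<Rightarrow> real"
  assumes "finite I" "\<And>p n. p \<in> I \<Longrightarrow> \<bar>f n p\<bar> \<le> c"
  shows "\<exists>r l. strict_mono r \<and> (\<forall>p\<in>I. (\<lambda>n. f (r n) p) \<longlonglongrightarrow> l p)"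
  using assms
proof (induction I rule: finite_induct)
  case empty
  show ?case by (intro exI[of _ id]) (simp add: strict_mono_def)
next
  case (insert x I)
  then obtain r l where r: "strict_mono r" "\<forall>p\<in>I. (\<lambda>n. f (r n) p) \<longlonglongrightarrow> l p" by auto
  obtain s where s1: "strict_mono s" "monoseq (\<lambda>n. f (r (s n)) x)"
    using seq_monosub[of "\<lambda>n. f (r n) x"] by auto
  have "Bseq (\<lambda>n. f (r (s n)) x)"
    using insert.prems[of x] by (intro BseqI'[of _ c]) auto
  then obtain a where s: "strict_mono s" "((\<lambda>n. f (r n) x) \<circ> s) \<longlonglongrightarrow> a"
    using Bseq_monoseq_convergent[OF _ s1(2)] s1(1) by (auto simp: convergent_def o_def)
  show ?case
  proof (intro exI[of _ "r \<circ> s"] exI[of _ "l(x := a)"] conjI ballI)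
    show "strict_mono (r \<circ> s)" using r(1) s(1) by (rule strict_mono_o)
    fix p assume "p \<in> insert x I"
    then show "(\<lambda>n. f ((r \<circ> s) n) p) \<longlonglongrightarrow> (l(x := a)) p"
      using s(2) LIMSEQ_subseq_LIMSEQ[OF _ s(1), of "\<lambda>n. f (r n) p"] r(2) insert.hyps
      by (auto simp: o_def)
  qed
qed

text \<open>A point of the cone is both a positive semidefinite matrix, which is suited to limits,
  and a family of vectors, which is what a compression consists of. The vectors do not depend on F,
  and the index set I bounds their number.\<close>

lemma psd_on_factor_qform:
  assumes "finite I" "psd_on I Q"
  shows "\<exists>V. \<forall>F. (\<Sum>p\<in>I. \<Sum>q\<in>I. F p q * Q p q) = (\<Sum>i\<in>I. qform I F (V i))"
proof -
  obtain V where V: "\<forall>p\<in>I. \<forall>q\<in>I. Q p q = (\<Sum>i\<in>I. V i p * V i q)"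
    using psd_on_factor[OF assms] by blast
  have "(\<Sum>p\<in>I. \<Sum>q\<in>I. F p q * Q p q) = (\<Sum>i\<in>I. qform I F (V i))" for F
  proof -
    have "(\<Sum>p\<in>I. \<Sum>q\<in>I. F p q * Q p q) = (\<Sum>p\<in>I. \<Sum>q\<in>I. \<Sum>i\<in>I. F p q * (V i p * V i q))"
      using V by (intro sum.cong refl) (simp add: sum_distrib_left)
    also have "\<dots> = (\<Sum>p\<in>I. \<Sum>i\<in>I. \<Sum>q\<in>I. F p q * (V i p * V i q))"
      by (intro sum.cong refl sum.swap)
    also have "\<dots> = (\<Sum>i\<in>I. qform I F (V i))"
      unfolding qform_def by (rule sum.swap)
    finally show ?thesis .
  qed
  then show ?thesis by blast
qed

lemma psd_on_add_scaled:
  assumes "psd_on I P" "psd_on I Q" "0 \<le> s" "0 \<le> t"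
  shows "psd_on I (\<lambda>p q. s * P p q + t * Q p q)"
proof -
  have "qform I (\<lambda>p q. s * P p q + t * Q p q) v = s * qform I P v + t * qform I Q v" for v
    unfolding qform_def by (simp add: sum_distrib_left sum.distrib algebra_simps)
  then show ?thesis using assms unfolding psd_on_def
    by (metis (no_types, lifting) add_nonneg_nonneg mult_nonneg_nonneg)
qed

lemma psd_on_rank_one: "psd_on I (\<lambda>p q. v p * v q)"
proof -
  have "qform I (\<lambda>p q. v p * v q) w = (\<Sum>p\<in>I. v p * w p) * (\<Sum>p\<in>I. v p * w p)" for w
    unfolding qform_def by (simp add: sum_product algebra_simps)
  then show ?thesis by (simp add: psd_on_def)
qed

text \<open>Arithmetic-geometric mean applied to a factorisation of Q. Hence a bound on traces
  already gives compactness.\<close>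

lemma abs_entry_le_trace:
  assumes "finite I" "psd_on I Q" "p \<in> I" "q \<in> I"
  shows "\<bar>Q p q\<bar> \<le> (\<Sum>r\<in>I. Q r r)"
proof -
  obtain V where V: "\<forall>p\<in>I. \<forall>q\<in>I. Q p q = (\<Sum>i\<in>I. V i p * V i q)"
    using psd_on_factor[OF assms(1,2)] by blast
  have diag: "0 \<le> Q r r" if "r \<in> I" for r
  proof -
    have "Q r r = (\<Sum>i\<in>I. V i r * V i r)" using V that by blast
    then show ?thesis by (simp add: sum_nonneg)
  qed
  have le: "Q r r \<le> (\<Sum>r\<in>I. Q r r)" if "r \<in> I" for r
    using assms(1) that diag by (intro member_le_sum) auto
  have "\<bar>Q p q\<bar> \<le> (\<Sum>i\<in>I. \<bar>V i p * V i q\<bar>)"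
  proof -
    have "Q p q = (\<Sum>i\<in>I. V i p * V i q)" using V assms(3,4) by blast
    then show ?thesis by (simp only: sum_abs)
  qed
  also have "\<dots> \<le> (\<Sum>i\<in>I. (V i p * V i p + V i q * V i q) / 2)"
  proof (rule sum_mono)
    fix i
    have "0 \<le> (\<bar>V i p\<bar> - \<bar>V i q\<bar>)\<^sup>2" by simp
    then show "\<bar>V i p * V i q\<bar> \<le> (V i p * V i p + V i q * V i q) / 2"
      by (simp add: power2_eq_square algebra_simps abs_mult)
  qed
  also have "\<dots> = (Q p p + Q q q) / 2"
    using V assms(3,4) by (simp add: sum.distrib sum_divide_distrib[symmetric])
  also have "\<dots> \<le> (\<Sum>r\<in>I. Q r r)" using le[OF assms(3)] le[OF assms(4)] by simp
  finally show ?thesis .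
qed

text \<open>Strong duality: the point of the cone of all \<open>k \<mapsto> \<Sum>i. q\<^sub>k (v\<^sub>i)\<close> closest to \<open>b\<close> exists because
  \<open>slater\<close> bounds the traces along a minimising sequence; the residual then serves as the
  multiplier \<open>y\<close> in \<open>dual\<close> and has to vanish.\<close>
lemma psd_farkas:
  fixes F :: "'k \<Rightarrow> 'i \<Rightarrow> 'i \<Rightarrow> real" and b z :: "'k \<Rightarrow> real"
  assumes finI: "finite I" and finK: "finite K"
    and slater: "\<And>v. (\<Sum>p\<in>I. (v p)\<^sup>2) \<le> (\<Sum>k\<in>K. z k * qform I (F k) v)"
    and dual: "\<And>y. (\<And>v. 0 \<le> (\<Sum>k\<in>K. y k * qform I (F k) v)) \<Longrightarrow> 0 \<le> (\<Sum>k\<in>K. y k * b k)"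
  shows "\<exists>V. \<forall>k\<in>K. (\<Sum>i\<in>I. qform I (F k) (V i)) = b k"
proof -
  define l where "l = (\<lambda>k Q. \<Sum>p\<in>I. \<Sum>q\<in>I. F k p q * Q p q)"
  define f where "f = (\<lambda>Q. \<Sum>k\<in>K. (l k Q - b k)\<^sup>2)"
  define S where "S = f ` {Q. psd_on I Q}"
  have f0: "0 \<le> f Q" for Q by (simp add: f_def sum_nonneg)
  have bdd: "bdd_below S" unfolding S_def by (rule bdd_belowI[of _ 0]) (use f0 in auto)
  have "psd_on I (\<lambda>p q. 0)" by (simp add: psd_on_def qform_def)
  then have ne: "S \<noteq> {}" by (auto simp: S_def)
  have "\<exists>Q. psd_on I Q \<and> f Q < Inf S + 1 / Suc n" for n
  proof -
    have "\<exists>x\<in>S. x < Inf S + 1 / Suc n" using cInf_lessD[OF ne, of "Inf S + 1 / Suc n"] by simp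
    then show ?thesis by (auto simp: S_def)
  qed
  then obtain Qs where Qs: "\<And>n. psd_on I (Qs n)" "\<And>n. f (Qs n) < Inf S + 1 / Suc n" by metis
  \<comment> \<open>Along the minimising sequence the squared residual is at most
    \<open>Inf S + 1\<close>, and \<bar>t\<bar> is at most 1 plus the square of t; this gives
    \<open>\<bar>b k\<bar> + 2 + Inf S\<close> as a bound for the functional number k.\<close>
  define c where "c = (\<Sum>k\<in>K. \<bar>z k\<bar> * (\<bar>b k\<bar> + 2 + Inf S))"
  have "\<bar>Qs n p q\<bar> \<le> c" if "p \<in> I" "q \<in> I" for n p q
  proof -
    obtain V where V: "\<And>F. (\<Sum>p\<in>I. \<Sum>q\<in>I. F p q * Qs n p q) = (\<Sum>i\<in>I. qform I F (V i))"
      using psd_on_factor_qform[OF finI Qs(1)] by blast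
    have diag: "(\<Sum>p\<in>I. \<Sum>q\<in>I. (if q = p then 1 else 0) * G p q) = (\<Sum>p\<in>I. G p p)"
      for G :: "'i \<Rightarrow> 'i \<Rightarrow> real"
    proof (rule sum.cong[OF refl])
      fix p assume "p \<in> I"
      have "(\<Sum>q\<in>I. (if q = p then 1 else 0) * G p q) = (\<Sum>q\<in>I. if q = p then G p p else 0)"
        by (rule sum.cong) auto
      then show "(\<Sum>q\<in>I. (if q = p then 1 else 0) * G p q) = G p p"
        using finI \<open>p \<in> I\<close> by simp
    qed
    have tr: "(\<Sum>p\<in>I. Qs n p p) = (\<Sum>i\<in>I. \<Sum>p\<in>I. (V i p)\<^sup>2)"
      using V[of "\<lambda>p q. if q = p then 1 else 0"] unfolding qform_def diag power2_eq_square .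
    have "(\<Sum>p\<in>I. Qs n p p) \<le> (\<Sum>i\<in>I. \<Sum>k\<in>K. z k * qform I (F k) (V i))"
      unfolding tr by (intro sum_mono slater)
    also have "\<dots> = (\<Sum>k\<in>K. z k * l k (Qs n))"
      unfolding l_def V sum_distrib_left by (rule sum.swap)
    also have "\<dots> \<le> c" unfolding c_def
    proof (rule sum_mono)
      fix k assume "k \<in> K"
      then have "(l k (Qs n) - b k)\<^sup>2 \<le> f (Qs n)"
        unfolding f_def using finK by (intro member_le_sum) auto
      also have "f (Qs n) \<le> Inf S + 1"
        using less_imp_le[OF Qs(2)[of n]] by (rule order_trans) simp
      finally have "(l k (Qs n) - b k)\<^sup>2 \<le> Inf S + 1" .
      moreover have "\<bar>l k (Qs n) - b k\<bar> \<le> 1 + (l k (Qs n) - b k)\<^sup>2"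
        using zero_le_power2[of "\<bar>l k (Qs n) - b k\<bar> - 1"]
        by (simp add: power2_eq_square algebra_simps abs_if split: if_splits)
      ultimately have "\<bar>l k (Qs n)\<bar> \<le> \<bar>b k\<bar> + 2 + Inf S" by linarith
      then have "\<bar>z k * l k (Qs n)\<bar> \<le> \<bar>z k\<bar> * (\<bar>b k\<bar> + 2 + Inf S)"
        unfolding abs_mult by (intro mult_left_mono) auto
      then show "z k * l k (Qs n) \<le> \<bar>z k\<bar> * (\<bar>b k\<bar> + 2 + Inf S)" by linarith
    qed
    finally show ?thesis using abs_entry_le_trace[OF finI Qs(1) that, of n] by linarith
  qed
  then have "\<exists>r Q. strict_mono r \<and> (\<forall>p\<in>I \<times> I. (\<lambda>n. Qs (r n) (fst p) (snd p)) \<longlonglongrightarrow> Q p)"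
    using bounded_family_convergent_subseq[of "I \<times> I" "\<lambda>n p. Qs n (fst p) (snd p)" c] finI by auto
  then obtain r Q' where r: "strict_mono r"
    and lim': "\<forall>p\<in>I \<times> I. (\<lambda>n. Qs (r n) (fst p) (snd p)) \<longlonglongrightarrow> Q' p" by blast
  define Q where "Q = (\<lambda>p q. Q' (p, q))"
  have lim: "(\<lambda>n. Qs (r n) p q) \<longlonglongrightarrow> Q p q" if "p \<in> I" "q \<in> I" for p q
    using lim' that unfolding Q_def by force
  have psdQ: "psd_on I Q" unfolding psd_on_def
  proof (intro conjI ballI allI)
    fix p q assume pq: "p \<in> I" "q \<in> I"
    then have "(\<lambda>n. Qs (r n) p q) = (\<lambda>n. Qs (r n) q p)"
      using Qs(1) unfolding psd_on_def by blast
    then show "Q p q = Q q p" using lim[OF pq] lim[OF pq(2,1)] LIMSEQ_unique by metis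
  next
    fix v
    have "(\<lambda>n. qform I (Qs (r n)) v) \<longlonglongrightarrow> qform I Q v"
      unfolding qform_def by (intro tendsto_intros lim)
    then show "0 \<le> qform I Q v"
      by (rule LIMSEQ_le_const) (use Qs(1) in \<open>auto simp: psd_on_def\<close>)
  qed
  have "(\<lambda>n. f (Qs (r n))) \<longlonglongrightarrow> f Q"
    unfolding f_def l_def by (intro tendsto_intros lim)
  moreover have "(\<lambda>n. Inf S + 1 / Suc n) \<longlonglongrightarrow> Inf S + 0"
    using LIMSEQ_inverse_real_of_nat by (intro tendsto_add tendsto_const) (simp add: inverse_eq_divide)
  moreover have "f (Qs (r n)) \<le> Inf S + 1 / Suc n" for n
  proof -
    have "1 / real (Suc (r n)) \<le> 1 / real (Suc n)"
      using seq_suble[OF r, of n] by (intro divide_left_mono) auto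
    then show ?thesis using Qs(2)[of "r n"] by linarith
  qed
  ultimately have "f Q \<le> Inf S" by (auto intro: LIMSEQ_le)
  then have min: "f Q \<le> f P" if "psd_on I P" for P
    using cInf_lower[OF _ bdd, of "f P"] that by (fastforce simp: S_def)
  define y where "y = (\<lambda>k. l k Q - b k)"
  have fy: "f P - f Q = (\<Sum>k\<in>K. 2 * y k * (l k P - l k Q) + (l k P - l k Q)\<^sup>2)" for P
    unfolding f_def y_def by (simp add: sum_subtractf[symmetric] power2_eq_square algebra_simps)
  \<comment> \<open>Moving from the closest point Q in the direction of the rank one matrix of v
    stays in the cone, so the derivative of f is nonnegative.\<close>
  have "0 \<le> (\<Sum>k\<in>K. y k * qform I (F k) v)" for v
  proof -
    have "0 \<le> (2 * (\<Sum>k\<in>K. y k * qform I (F k) v)) * t + (\<Sum>k\<in>K. (qform I (F k) v)\<^sup>2) * t\<^sup>2"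
      if "0 < t" for t
    proof -
      let ?P = "\<lambda>p q. 1 * Q p q + t * (v p * v q)"
      have "psd_on I ?P" using psdQ that by (intro psd_on_add_scaled psd_on_rank_one) auto
      moreover have "l k ?P - l k Q = t * qform I (F k) v" for k
        unfolding l_def qform_def
        by (simp add: sum_distrib_left sum_subtractf[symmetric] algebra_simps)
      ultimately have "0 \<le> (\<Sum>k\<in>K. 2 * y k * (t * qform I (F k) v) + (t * qform I (F k) v)\<^sup>2)"
        using min[of ?P] fy[of ?P] by simp
      also have "\<dots> = (2 * (\<Sum>k\<in>K. y k * qform I (F k) v)) * t + (\<Sum>k\<in>K. (qform I (F k) v)\<^sup>2) * t\<^sup>2"
        by (simp add: sum.distrib sum_distrib_left sum_distrib_right power_mult_distrib algebra_simps)
      finally show ?thesis .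
    qed
    then have "0 \<le> 2 * (\<Sum>k\<in>K. y k * qform I (F k) v)" by (rule linear_coeff_nonneg)
    then show ?thesis by simp
  qed
  then have 1: "0 \<le> (\<Sum>k\<in>K. y k * b k)" by (rule dual)
  \<comment> \<open>Moving from Q towards the apex of the cone gives the opposite sign for the
    pairing of y with Q itself.\<close>
  have "0 \<le> (2 * - (\<Sum>k\<in>K. y k * l k Q)) * t + (\<Sum>k\<in>K. (l k Q)\<^sup>2) * t\<^sup>2"
    if t: "0 < t" "t \<le> 1" for t
  proof -
    let ?P = "\<lambda>p q. (1 - t) * Q p q + 0 * Q p q"
    have "psd_on I ?P" using psdQ t by (intro psd_on_add_scaled) auto
    moreover have "l k ?P - l k Q = - t * l k Q" for k
      unfolding l_def by (simp add: sum_distrib_left sum_subtractf[symmetric] algebra_simps)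
    ultimately have "0 \<le> (\<Sum>k\<in>K. 2 * y k * (- t * l k Q) + (- t * l k Q)\<^sup>2)"
      using min[of ?P] fy[of ?P] by simp
    also have "\<dots> = (2 * - (\<Sum>k\<in>K. y k * l k Q)) * t + (\<Sum>k\<in>K. (l k Q)\<^sup>2) * t\<^sup>2"
      by (simp add: sum.distrib sum_distrib_left sum_distrib_right sum_subtractf power_mult_distrib algebra_simps)
    finally show ?thesis .
  qed
  then have "0 \<le> 2 * - (\<Sum>k\<in>K. y k * l k Q)" by (rule linear_coeff_nonneg)
  \<comment> \<open>The squared distance is the pairing of the residual with itself: the part from Q
    is at most 0 by the move to the apex, the part from b is nonnegative by
    \<open>dual\<close>.\<close>
  moreover have "f Q = (\<Sum>k\<in>K. y k * l k Q) - (\<Sum>k\<in>K. y k * b k)"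
    unfolding f_def y_def by (simp add: sum_subtractf[symmetric] power2_eq_square algebra_simps)
  ultimately have "f Q = 0" using 1 f0[of Q] by linarith
  then have "l k Q = b k" if "k \<in> K" for k
    using that finK unfolding f_def by (simp add: sum_nonneg_eq_0_iff)
  then show ?thesis
    using psd_on_factor_qform[OF finI psdQ] unfolding l_def by metis
qed

section \<open>The trace inner product on matrices\<close>

text \<open>Premises about dimensions instead of carrier sets let the simplifier discharge them by
  computation; carrier premises would leave the inner dimensions to be guessed.\<close>

lemma mat_assoc:
  "dim_col A = dim_row B \<Longrightarrow> dim_col B = dim_row C \<Longrightarrow> A * B * C = A * (B * (C :: real mat))"
  by (rule assoc_mult_mat) (auto intro: carrier_matI)

lemma mat_transpose_mult:
  "dim_col A = dim_row B \<Longrightarrow> (A * B)\<^sup>T = B\<^sup>T * (A :: real mat)\<^sup>T"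
  by (rule transpose_mult) (auto intro: carrier_matI)

lemma mat_distribs:
  fixes A B C :: "real mat"
  shows "dim_row A = dim_row B \<Longrightarrow> dim_col A = dim_col B \<Longrightarrow> dim_row C = dim_col B \<Longrightarrow> (A + B) * C = A * C + B * C"
    and "dim_row A = dim_row B \<Longrightarrow> dim_col A = dim_col B \<Longrightarrow> dim_row C = dim_col B \<Longrightarrow> (A - B) * C = A * C - B * C"
    and "dim_row A = dim_row B \<Longrightarrow> dim_col A = dim_col B \<Longrightarrow> dim_col C = dim_row B \<Longrightarrow> C * (A + B) = C * A + C * B"
    and "dim_row A = dim_row B \<Longrightarrow> dim_col A = dim_col B \<Longrightarrow> dim_col C = dim_row B \<Longrightarrow> C * (A - B) = C * A - C * B"
  by (rule add_mult_distrib_mat minus_mult_distrib_mat mult_add_distrib_mat mult_minus_distrib_mat;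
      auto intro: carrier_matI)+

lemma mat_smult:
  fixes A B :: "real mat"
  shows "dim_col A = dim_row B \<Longrightarrow> (c \<cdot>\<^sub>m A) * B = c \<cdot>\<^sub>m (A * B)"
    and "dim_col A = dim_row B \<Longrightarrow> A * (c \<cdot>\<^sub>m B) = c \<cdot>\<^sub>m (A * B)"
  by (rule mult_smult_assoc_mat mult_smult_distrib; auto intro: carrier_matI)+

lemma mat_transpose_linear:
  fixes A B :: "real mat"
  shows "dim_row A = dim_row B \<Longrightarrow> dim_col A = dim_col B \<Longrightarrow> (A + B)\<^sup>T = A\<^sup>T + B\<^sup>T"
    and "dim_row A = dim_row B \<Longrightarrow> dim_col A = dim_col B \<Longrightarrow> (A - B)\<^sup>T = A\<^sup>T - B\<^sup>T"
    and "(c \<cdot>\<^sub>m A)\<^sup>T = c \<cdot>\<^sub>m A\<^sup>T"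
  by (auto intro!: eq_matI)

lemma mult_mat_entry:
  "A \<in> carrier_mat p r \<Longrightarrow> B \<in> carrier_mat r c \<Longrightarrow> i < p \<Longrightarrow> k < c \<Longrightarrow>
    (A * B) $$ (i, k) = (\<Sum>l<r. A $$ (i, l) * (B :: real mat) $$ (l, k))"
  by (auto simp: scalar_prod_def atLeast0LessThan intro!: sum.cong)

lemma mat_diff_eq_0D:
  fixes U V :: "real mat"
  assumes "U - V = 0\<^sub>m r c" "dim_row U = dim_row V" "dim_col U = dim_col V"
  shows "U = V"
proof (rule eq_matI)
  fix i j assume ij: "i < dim_row V" "j < dim_col V"
  have "dim_row V = r" "dim_col V = c"
    using arg_cong[OF assms(1), of dim_row] arg_cong[OF assms(1), of dim_col] by auto
  then have "(U - V) $$ (i, j) = 0" using ij assms(1) by simp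
  then show "U $$ (i, j) = V $$ (i, j)" using ij by simp
qed (use assms in auto)

text \<open>The Frobenius inner product, the trace of \<open>U\<^sup>T * W\<close>. The ranges of
  summation come from the first argument, so the rules for the second one need more dimension
  premises.\<close>

definition ip :: "real mat \<Rightarrow> real mat \<Rightarrow> real" where
  "ip U W = (\<Sum>i<dim_row U. \<Sum>k<dim_col U. U $$ (i, k) * W $$ (i, k))"

lemma ip_commute: "dim_row U = dim_row W \<Longrightarrow> dim_col U = dim_col W \<Longrightarrow> ip U W = ip W U"
  by (simp add: ip_def mult.commute)

lemma ip_add_left: "dim_row U = dim_row V \<Longrightarrow> dim_col U = dim_col V \<Longrightarrow> ip (U + V) W = ip U W + ip V W"
  by (simp add: ip_def sum.distrib algebra_simps)

lemma ip_diff_left: "dim_row U = dim_row V \<Longrightarrow> dim_col U = dim_col V \<Longrightarrow> ip (U - V) W = ip U W - ip V W"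
  by (simp add: ip_def sum_subtractf algebra_simps)

lemma ip_smult_left: "ip (c \<cdot>\<^sub>m U) W = c * ip U W"
  by (simp add: ip_def sum_distrib_left algebra_simps)

lemma ip_add_right:
  "dim_row U = dim_row W \<Longrightarrow> dim_col U = dim_col W \<Longrightarrow> dim_row V = dim_row W \<Longrightarrow> dim_col V = dim_col W \<Longrightarrow>
    ip U (V + W) = ip U V + ip U W"
  by (simp add: ip_def sum.distrib algebra_simps)

lemma ip_diff_right:
  "dim_row U = dim_row W \<Longrightarrow> dim_col U = dim_col W \<Longrightarrow> dim_row V = dim_row W \<Longrightarrow> dim_col V = dim_col W \<Longrightarrow>
    ip U (V - W) = ip U V - ip U W"
  by (simp add: ip_def sum_subtractf algebra_simps)

lemma ip_smult_right:
  "dim_row U = dim_row W \<Longrightarrow> dim_col U = dim_col W \<Longrightarrow> ip U (c \<cdot>\<^sub>m W) = c * ip U W"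
  by (simp add: ip_def sum_distrib_left algebra_simps)

lemma ip_zero_left: "ip (0\<^sub>m r c) W = 0"
  by (simp add: ip_def)

lemma ip_zero_right: "dim_row U = r \<Longrightarrow> dim_col U = c \<Longrightarrow> ip U (0\<^sub>m r c) = 0"
  by (simp add: ip_def)

lemma ip_nonneg: "0 \<le> ip U U"
  by (simp add: ip_def sum_nonneg)

lemma ip_eq_0D: "ip U U = 0 \<Longrightarrow> U = 0\<^sub>m (dim_row U) (dim_col U)"
  by (intro eq_matI) (auto simp: ip_def sum_nonneg_eq_0_iff sum_nonneg)

lemma ip_mult_left:
  assumes "dim_row U = dim_col A" "dim_row W = dim_row A" "dim_col W = dim_col U"
  shows "ip (A * U) W = ip U (A\<^sup>T * W)"
proof -
  let ?p = "dim_row A" let ?r = "dim_col A" let ?c = "dim_col U"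
  have A: "A \<in> carrier_mat ?p ?r" "A\<^sup>T \<in> carrier_mat ?r ?p" and U: "U \<in> carrier_mat ?r ?c"
    and W: "W \<in> carrier_mat ?p ?c"
    using assms by (auto intro: carrier_matI)
  have "ip (A * U) W = (\<Sum>i<?p. \<Sum>k<?c. \<Sum>l<?r. A $$ (i, l) * U $$ (l, k) * W $$ (i, k))"
    unfolding ip_def by (simp add: mult_mat_entry[OF A(1) U] sum_distrib_right del: index_mult_mat(1))
  also have "\<dots> = (\<Sum>i<?p. \<Sum>l<?r. \<Sum>k<?c. A $$ (i, l) * U $$ (l, k) * W $$ (i, k))"
    by (intro sum.cong refl sum.swap)
  also have "\<dots> = (\<Sum>l<?r. \<Sum>i<?p. \<Sum>k<?c. A $$ (i, l) * U $$ (l, k) * W $$ (i, k))"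
    by (rule sum.swap)
  also have "\<dots> = (\<Sum>l<?r. \<Sum>k<?c. \<Sum>i<?p. A $$ (i, l) * U $$ (l, k) * W $$ (i, k))"
    by (intro sum.cong refl sum.swap)
  also have "\<dots> = ip U (A\<^sup>T * W)"
    unfolding ip_def using assms
    by (auto simp: mult_mat_entry[OF A(2) W] sum_distrib_left algebra_simps intro!: sum.cong
        simp del: index_mult_mat(1))
  finally show ?thesis .
qed

lemma ip_transpose: "dim_row U = dim_row W \<Longrightarrow> dim_col U = dim_col W \<Longrightarrow> ip U\<^sup>T W\<^sup>T = ip U W"
  unfolding ip_def by (subst sum.swap) simp

lemma ip_mult_right:
  assumes "dim_row X = dim_col U" "dim_col W = dim_col X" "dim_row W = dim_row U"
  shows "ip (U * X) W = ip U (W * X\<^sup>T)"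
proof -
  have "ip (U * X) W = ip (X\<^sup>T * U\<^sup>T) W\<^sup>T"
    using assms by (subst ip_transpose[symmetric]) (simp_all add: mat_transpose_mult)
  also have "\<dots> = ip U\<^sup>T (X * W\<^sup>T)" using assms by (subst ip_mult_left) simp_all
  also have "\<dots> = ip U (W * X\<^sup>T)"
    using assms by (subst ip_transpose[symmetric]) (simp_all add: mat_transpose_mult)
  finally show ?thesis .
qed

lemma ip_one: "ip (1\<^sub>m n) (1\<^sub>m n) = real n"
  by (simp add: ip_def if_distrib cong: if_cong)

lemma mat_eq_by_ip:
  assumes "dim_row U = dim_row V" "dim_col U = dim_col V"
    and "\<And>W. W \<in> carrier_mat (dim_row U) (dim_col U) \<Longrightarrow> ip W U = ip W V"
  shows "U = V"
proof -
  have UV: "U - V \<in> carrier_mat (dim_row U) (dim_col U)" using assms by (auto intro: carrier_matI)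
  have "ip (U - V) (U - V) = ip (U - V) U - ip (U - V) V"
    using assms by (subst ip_diff_right) simp_all
  also have "\<dots> = 0" using assms(3)[OF UV] by simp
  finally have "U - V = 0\<^sub>m (dim_row U) (dim_col U)" using ip_eq_0D[of "U - V"] assms by simp
  then show ?thesis using assms(1,2) by (rule mat_diff_eq_0D)
qed

text \<open>For the projection \<open>R * R\<^sup>T\<close> the squared norm of its complement is d
  - s. It is nonnegative, and it vanishes only if the complement does.\<close>

lemma isometry_square:
  fixes R :: "real mat"
  assumes R: "R \<in> carrier_mat d s" and iso: "R\<^sup>T * R = 1\<^sub>m s"
  shows "s \<le> d" and "s = d \<Longrightarrow> R * R\<^sup>T = 1\<^sub>m d"
proof -
  have RR: "R\<^sup>T * (R * B) = B" if "dim_row B = s" for B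
    using that iso R mat_assoc[of "R\<^sup>T" R B] by simp
  have 1: "ip (1\<^sub>m d) (R * R\<^sup>T) = real s"
  proof -
    have "ip (1\<^sub>m d) (R * R\<^sup>T) = ip (R * R\<^sup>T) (1\<^sub>m d)" using R by (intro ip_commute) auto
    also have "\<dots> = ip (R\<^sup>T) (R\<^sup>T)" using R by (subst ip_mult_left) auto
    also have "\<dots> = ip R R" using R by (intro ip_transpose) auto
    also have "\<dots> = ip (R * 1\<^sub>m s) R" using R by simp
    also have "\<dots> = ip (1\<^sub>m s) (1\<^sub>m s)" using R iso by (subst ip_mult_left) auto
    finally show ?thesis by (simp add: ip_one)
  qed
  have 2: "ip (R * R\<^sup>T) (R * R\<^sup>T) = real s"
  proof -
    have "ip (R * R\<^sup>T) (R * R\<^sup>T) = ip (R\<^sup>T) (R\<^sup>T * (R * R\<^sup>T))" using R by (subst ip_mult_left) auto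
    also have "\<dots> = ip (R\<^sup>T * 1\<^sub>m d) (R\<^sup>T)" using R RR by simp
    also have "\<dots> = ip (1\<^sub>m d) (R * R\<^sup>T)" using R by (subst ip_mult_left) auto
    finally show ?thesis using 1 by simp
  qed
  have "ip (1\<^sub>m d - R * R\<^sup>T) (1\<^sub>m d - R * R\<^sup>T)
      = ip (1\<^sub>m d) (1\<^sub>m d) - ip (1\<^sub>m d) (R * R\<^sup>T) - (ip (R * R\<^sup>T) (1\<^sub>m d) - ip (R * R\<^sup>T) (R * R\<^sup>T))"
    using R by (subst ip_diff_left) (simp_all add: ip_diff_right)
  also have "ip (R * R\<^sup>T) (1\<^sub>m d) = ip (1\<^sub>m d) (R * R\<^sup>T)" using R by (intro ip_commute) auto
  finally have 3: "ip (1\<^sub>m d - R * R\<^sup>T) (1\<^sub>m d - R * R\<^sup>T) = real d - real s"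
    using 1 2 by (simp add: ip_one)
  then show "s \<le> d" using ip_nonneg[of "1\<^sub>m d - R * R\<^sup>T"] by simp
  assume "s = d"
  then have "1\<^sub>m d - R * R\<^sup>T = 0\<^sub>m d d" using 3 ip_eq_0D[of "1\<^sub>m d - R * R\<^sup>T"] R by simp
  then have "1\<^sub>m d = R * R\<^sup>T" by (rule mat_diff_eq_0D) (use R in auto)
  then show "R * R\<^sup>T = 1\<^sub>m d" by simp
qed

text \<open>An orthonormal system in the kernel with the largest possible number of columns must
  reproduce every X annihilated by D. The case s = 0 is included and describes a trivial
  kernel.\<close>

lemma kernel_orthonormal_basis:
  fixes D :: "real mat"
  assumes D: "D \<in> carrier_mat p d"
  shows "\<exists>s R. R \<in> carrier_mat d s \<and> R\<^sup>T * R = 1\<^sub>m s \<and> D * R = 0\<^sub>m p s \<and>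
    (\<forall>n. \<forall>X\<in>carrier_mat d n. D * X = 0\<^sub>m p n \<longrightarrow> R * (R\<^sup>T * X) = X)"
proof -
  define P where "P = (\<lambda>s. \<exists>R. R \<in> carrier_mat d s \<and> R\<^sup>T * R = 1\<^sub>m s \<and> D * R = 0\<^sub>m p s)"
  have "P 0"
    unfolding P_def using D by (intro exI[of _ "0\<^sub>m d 0"]) auto
  moreover have bound: "\<forall>s. P s \<longrightarrow> s \<le> d" unfolding P_def using isometry_square(1) by blast
  ultimately have P: "P (Greatest P)" and max: "\<And>s. P s \<Longrightarrow> s \<le> Greatest P"
    using GreatestI_nat[of P 0 d] Greatest_le_nat[of P _ d] by auto
  define s where "s = Greatest P"
  obtain R where R: "R \<in> carrier_mat d s" and iso: "R\<^sup>T * R = 1\<^sub>m s" and DR: "D * R = 0\<^sub>m p s"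
    using P unfolding P_def s_def by blast
  have RR: "R\<^sup>T * (R * B) = B" if "dim_row B = s" for B
    using that iso R mat_assoc[of "R\<^sup>T" R B] by simp
  have "R * (R\<^sup>T * X) = X" if X: "X \<in> carrier_mat d n" and DX: "D * X = 0\<^sub>m p n" for n X
  proof (rule ccontr)
    assume neq: "R * (R\<^sup>T * X) \<noteq> X"
    \<comment> \<open>The residual lies in the kernel and is orthogonal to the columns of R; a
      nonzero column of it, normalised, enlarges R.\<close>
    define Y where "Y = X - R * (R\<^sup>T * X)"
    have Y: "Y \<in> carrier_mat d n" using X R by (auto simp: Y_def)
    have "D * (R * (R\<^sup>T * X)) = 0\<^sub>m p n"
      using D R X DR mat_assoc[of D R "R\<^sup>T * X"] by simp
    then have DY: "D * Y = 0\<^sub>m p n" unfolding Y_def using D R X DX by (subst mat_distribs) auto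
    have RY: "R\<^sup>T * Y = 0\<^sub>m s n" unfolding Y_def using R X by (subst mat_distribs) (auto simp: RR)
    have "\<exists>i k. i < d \<and> k < n \<and> Y $$ (i, k) \<noteq> 0"
    proof (rule ccontr)
      assume z: "\<nexists>i k. i < d \<and> k < n \<and> Y $$ (i, k) \<noteq> 0"
      then have "Y = 0\<^sub>m d n" using Y by (intro eq_matI) auto
      then have "X = R * (R\<^sup>T * X)" unfolding Y_def by (rule mat_diff_eq_0D) (use R X in auto)
      then show False using neq by simp
    qed
    then obtain i0 k where i0: "i0 < d" "k < n" "Y $$ (i0, k) \<noteq> 0" by blast
    define a where "a = (\<Sum>i<d. Y $$ (i, k) * Y $$ (i, k))"
    have a: "a > 0"
      unfolding a_def using i0 by (intro sum_pos2[of _ i0]) (auto simp: zero_less_mult_iff)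
    define y where "y = (\<lambda>i. Y $$ (i, k) / sqrt a)"
    have yy: "(\<Sum>i<d. y i * y i) = 1"
      using a unfolding y_def by (simp add: sum_divide_distrib[symmetric] a_def[symmetric])
    have Ry: "(\<Sum>i<d. R $$ (i, l) * y i) = 0" if "l < s" for l
    proof -
      have "(R\<^sup>T * Y) $$ (l, k) = (\<Sum>i<d. R $$ (i, l) * Y $$ (i, k))"
        using that i0 R by (subst mult_mat_entry[of _ s d _ n]) (auto simp: Y)
      then have "(\<Sum>i<d. R $$ (i, l) * Y $$ (i, k)) = 0" using RY that i0 by simp
      then show ?thesis unfolding y_def by (simp add: sum_divide_distrib[symmetric])
    qed
    have Dy: "(\<Sum>i<d. D $$ (l, i) * y i) = 0" if "l < p" for l
    proof -
      have "(D * Y) $$ (l, k) = (\<Sum>i<d. D $$ (l, i) * Y $$ (i, k))"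
        using that i0 D Y by (intro mult_mat_entry)
      then have "(\<Sum>i<d. D $$ (l, i) * Y $$ (i, k)) = 0" using DY that i0 by simp
      then show ?thesis unfolding y_def by (simp add: sum_divide_distrib[symmetric])
    qed
    define R' where "R' = mat d (Suc s) (\<lambda>(i, l). if l < s then R $$ (i, l) else y i)"
    have R': "R' \<in> carrier_mat d (Suc s)" "R'\<^sup>T \<in> carrier_mat (Suc s) d" by (auto simp: R'_def)
    have RRe: "(\<Sum>i<d. R $$ (i, l) * R $$ (i, m)) = (if l = m then 1 else 0)" if "l < s" "m < s" for l m
    proof -
      have "(R\<^sup>T * R) $$ (l, m) = (\<Sum>i<d. R $$ (i, l) * R $$ (i, m))"
        using that R by (subst mult_mat_entry[of _ s d _ s]) auto
      then show ?thesis using iso that by simp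
    qed
    have "R'\<^sup>T * R' = 1\<^sub>m (Suc s)"
    proof (rule eq_matI)
      fix l m assume "l < dim_row (1\<^sub>m (Suc s) :: real mat)" "m < dim_col (1\<^sub>m (Suc s) :: real mat)"
      then have lm: "l < Suc s" "m < Suc s" by auto
      have "(R'\<^sup>T * R') $$ (l, m) = (\<Sum>i<d. R' $$ (i, l) * R' $$ (i, m))"
        using lm R' by (subst mult_mat_entry[of _ "Suc s" d _ "Suc s"]) auto
      also have "\<dots> = (if l = m then 1 else 0)"
        using lm RRe Ry yy by (auto simp: R'_def less_Suc_eq mult.commute)
      finally show "(R'\<^sup>T * R') $$ (l, m) = (1\<^sub>m (Suc s) :: real mat) $$ (l, m)" using lm by simp
    qed (use R' in auto)
    moreover have "D * R' = 0\<^sub>m p (Suc s)"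
    proof (rule eq_matI)
      fix l m assume "l < dim_row (0\<^sub>m p (Suc s) :: real mat)" "m < dim_col (0\<^sub>m p (Suc s) :: real mat)"
      then have lm: "l < p" "m < Suc s" by auto
      have "(D * R') $$ (l, m) = (\<Sum>i<d. D $$ (l, i) * R' $$ (i, m))"
        using lm D R' by (intro mult_mat_entry)
      also have "\<dots> = (if m < s then (D * R) $$ (l, m) else 0)"
        using lm Dy mult_mat_entry[OF D R, of l m] by (auto simp: R'_def)
      also have "\<dots> = 0" using lm DR by simp
      finally show "(D * R') $$ (l, m) = (0\<^sub>m p (Suc s) :: real mat) $$ (l, m)" using lm by simp
    qed (use D R' in auto)
    ultimately have "P (Suc s)" using R'(1) unfolding P_def by blast
    then show False using max[of "Suc s"] by (simp add: s_def)
  qed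
  then show ?thesis using R iso DR by blast
qed

section \<open>Compressions of tuples of symmetric matrices\<close>

definition sym_tuple :: "nat \<Rightarrow> nat \<Rightarrow> pencil \<Rightarrow> bool" where
  "sym_tuple g d A \<longleftrightarrow> (\<forall>j\<in>{1..g}. A j \<in> sym_mats d)"

text \<open>Positivity of the monic pencil at X, on vectors reshaped as d by n matrices: there the
  Kronecker product of A and a symmetric X acts as W \<mapsto> A W X. The constant term is built in
  as the identity, since the entry of a tuple at 0 is arbitrary.\<close>

definition lmi :: "nat \<Rightarrow> nat \<Rightarrow> pencil \<Rightarrow> nat \<Rightarrow> (nat \<Rightarrow> real mat) \<Rightarrow> bool" where
  "lmi g d A n X \<longleftrightarrow>
    (\<forall>W\<in>carrier_mat d n. 0 \<le> ip W W + (\<Sum>j=1..g. ip W (A j * (W * X j))))"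

definition dominates :: "nat \<Rightarrow> nat \<Rightarrow> pencil \<Rightarrow> nat \<Rightarrow> pencil \<Rightarrow> bool" where
  "dominates g d A m B \<longleftrightarrow> (\<forall>n X. sym_tuple g n X \<longrightarrow> lmi g d A n X \<longrightarrow> lmi g m B n X)"

text \<open>\<open>B j = \<Sum>V. V\<^sup>T * A j * V\<close> with \<open>\<Sum>V. V\<^sup>T * V \<le> 1\<close>, written weakly to avoid sums of matrices.\<close>
definition compression :: "nat \<Rightarrow> nat \<Rightarrow> pencil \<Rightarrow> nat \<Rightarrow> pencil \<Rightarrow> real mat list \<Rightarrow> bool" where
  "compression g d A m B Vs \<longleftrightarrow> set Vs \<subseteq> carrier_mat d m \<and>
    (\<forall>n. \<forall>W\<in>carrier_mat m n. (\<Sum>V\<leftarrow>Vs. ip (V * W) (V * W)) \<le> ip W W) \<and>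
    (\<forall>j\<in>{1..g}. \<forall>n. \<forall>U\<in>carrier_mat m n. \<forall>W\<in>carrier_mat m n.
      (\<Sum>V\<leftarrow>Vs. ip (V * U) (A j * (V * W))) = ip U (B j * W))"

lemma sym_tupleD:
  assumes "sym_tuple g d A" "j \<in> {1..g}"
  shows "A j \<in> carrier_mat d d" "(A j)\<^sup>T = A j" "dim_row (A j) = d" "dim_col (A j) = d"
  using assms by (auto simp: sym_tuple_def sym_mats_def)

lemma sum_list_sum_swap: "(\<Sum>x\<leftarrow>xs. \<Sum>j\<in>J. f x j) = (\<Sum>j\<in>J. \<Sum>x\<leftarrow>xs. (f x j :: real))"
  by (induction xs) (auto simp: sum.distrib)

text \<open>Summing the inequality for A over the matrices \<open>V * W\<close> gives the one for B.
  The contraction property has the right direction because it enlarges the constant term.\<close>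

lemma compression_dominates:
  assumes A: "sym_tuple g d A" and c: "compression g d A m B Vs"
  shows "dominates g d A m B"
  unfolding dominates_def lmi_def
proof (intro allI impI ballI)
  fix n X and W :: "real mat"
  assume X: "sym_tuple g n X" and W: "W \<in> carrier_mat m n"
    and pos: "\<forall>W\<in>carrier_mat d n. 0 \<le> ip W W + (\<Sum>j = 1..g. ip W (A j * (W * X j)))"
  have "0 \<le> (\<Sum>V\<leftarrow>Vs. ip (V * W) (V * W) + (\<Sum>j = 1..g. ip (V * W) (A j * (V * W * X j))))"
    using c W pos by (intro sum_list_nonneg) (auto simp: compression_def)
  also have "\<dots> = (\<Sum>V\<leftarrow>Vs. ip (V * W) (V * W))
      + (\<Sum>j = 1..g. \<Sum>V\<leftarrow>Vs. ip (V * W) (A j * (V * W * X j)))"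
    by (simp add: sum_list_addf sum_list_sum_swap)
  also have "(\<Sum>j = 1..g. \<Sum>V\<leftarrow>Vs. ip (V * W) (A j * (V * W * X j)))
      = (\<Sum>j = 1..g. ip W (B j * (W * X j)))"
  proof (rule sum.cong[OF refl])
    fix j assume j: "j \<in> {1..g}"
    have WX: "W * X j \<in> carrier_mat m n" using sym_tupleD(1)[OF X j] W by auto
    have "V * W * X j = V * (W * X j)" if "V \<in> set Vs" for V
      using that c W sym_tupleD[OF X j] unfolding compression_def by (intro mat_assoc) auto
    then have "(\<Sum>V\<leftarrow>Vs. ip (V * W) (A j * (V * W * X j)))
        = (\<Sum>V\<leftarrow>Vs. ip (V * W) (A j * (V * (W * X j))))"
      by (intro arg_cong[of _ _ sum_list] map_cong) auto
    also have "\<dots> = ip W (B j * (W * X j))" using c j W WX unfolding compression_def by blast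
    finally show "(\<Sum>V\<leftarrow>Vs. ip (V * W) (A j * (V * W * X j))) = ip W (B j * (W * X j))" .
  qed
  also have "(\<Sum>V\<leftarrow>Vs. ip (V * W) (V * W)) \<le> ip W W" using c W unfolding compression_def by blast
  finally show "0 \<le> ip W W + (\<Sum>j = 1..g. ip W (B j * (W * X j)))" by simp
qed

section \<open>The dual problem for compressions\<close>

lemma ip_mult_expand:
  assumes "U \<in> carrier_mat m n" "G \<in> carrier_mat m m" "W \<in> carrier_mat m n"
  shows "ip U (G * W) = (\<Sum>a<m. \<Sum>b<m. G $$ (a, b) * (\<Sum>k<n. U $$ (a, k) * W $$ (b, k)))"
proof -
  have "ip U (G * W) = (\<Sum>a<m. \<Sum>k<n. \<Sum>b<m. U $$ (a, k) * (G $$ (a, b) * W $$ (b, k)))"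
    using assms unfolding ip_def
    by (simp add: mult_mat_entry[OF assms(2,3)] sum_distrib_left del: index_mult_mat(1))
  also have "\<dots> = (\<Sum>a<m. \<Sum>b<m. \<Sum>k<n. U $$ (a, k) * (G $$ (a, b) * W $$ (b, k)))"
    by (intro sum.cong refl sum.swap)
  finally show ?thesis by (simp add: sum_distrib_left mult.left_commute)
qed

text \<open>Passes from equations between entries, which conic duality delivers, to the weak form
  used in \<open>compression\<close>.\<close>

lemma sum_ip_mult_eq:
  assumes "\<And>i. i \<in> I \<Longrightarrow> G i \<in> carrier_mat m m" "B \<in> carrier_mat m m"
    and "\<And>a b. a < m \<Longrightarrow> b < m \<Longrightarrow> (\<Sum>i\<in>I. G i $$ (a, b)) = B $$ (a, b)"
    and U: "U \<in> carrier_mat m n" and W: "W \<in> carrier_mat m n"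
  shows "(\<Sum>i\<in>I. ip U (G i * W)) = ip U (B * W)"
proof -
  have "(\<Sum>i\<in>I. ip U (G i * W))
      = (\<Sum>i\<in>I. \<Sum>a<m. \<Sum>b<m. G i $$ (a, b) * (\<Sum>k<n. U $$ (a, k) * W $$ (b, k)))"
    using assms(1) by (intro sum.cong refl ip_mult_expand[OF U _ W])
  also have "\<dots> = (\<Sum>a<m. \<Sum>i\<in>I. \<Sum>b<m. G i $$ (a, b) * (\<Sum>k<n. U $$ (a, k) * W $$ (b, k)))"
    by (rule sum.swap)
  also have "\<dots> = (\<Sum>a<m. \<Sum>b<m. \<Sum>i\<in>I. G i $$ (a, b) * (\<Sum>k<n. U $$ (a, k) * W $$ (b, k)))"
    by (intro sum.cong refl sum.swap)
  also have "\<dots> = (\<Sum>a<m. \<Sum>b<m. B $$ (a, b) * (\<Sum>k<n. U $$ (a, k) * W $$ (b, k)))"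
    using assms(3) by (intro sum.cong refl) (simp add: sum_distrib_right[symmetric])
  finally show ?thesis using ip_mult_expand[OF U assms(2) W] by simp
qed

lemma ip_entries: "U \<in> carrier_mat m n \<Longrightarrow> ip U W = (\<Sum>a<m. \<Sum>b<n. U $$ (a, b) * W $$ (a, b))"
  by (simp add: ip_def)

lemma sandwich_entry:
  fixes T A :: "real mat"
  assumes "T \<in> carrier_mat d m" "A \<in> carrier_mat d d" "a < m" "b < m"
  shows "(T\<^sup>T * (A * T)) $$ (a, b) = (\<Sum>i<d. \<Sum>l<d. A $$ (i, l) * (T $$ (i, a) * T $$ (l, b)))"
proof -
  have "(T\<^sup>T * (A * T)) $$ (a, b) = (\<Sum>i<d. T\<^sup>T $$ (a, i) * (A * T) $$ (i, b))"
    using assms by (intro mult_mat_entry[of _ m]) auto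
  also have "\<dots> = (\<Sum>i<d. \<Sum>l<d. A $$ (i, l) * (T $$ (i, a) * T $$ (l, b)))"
    using assms by (intro sum.cong refl)
      (simp add: mult_mat_entry[OF assms(2,1)] sum_distrib_left algebra_simps del: index_mult_mat(1))
  finally show ?thesis .
qed

text \<open>With v read as an N by m matrix T, the right-hand side is the entry (a, b) of
  \<open>T\<^sup>T * G * T\<close>; so every entry of the equation for B is one linear constraint on
  the Choi matrix.\<close>

lemma qform_block:
  fixes G :: "nat \<Rightarrow> nat \<Rightarrow> real" and a b m N :: nat
  assumes "a < m" "b < m"
  shows "qform ({..<N} \<times> {..<m}) (\<lambda>p q. if snd p = a \<and> snd q = b then G (fst p) (fst q) else 0) v
    = (\<Sum>i<N. \<Sum>l<N. G i l * (v (i, a) * v (l, b)))"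
proof -
  have "qform ({..<N} \<times> {..<m}) (\<lambda>p q. if snd p = a \<and> snd q = b then G (fst p) (fst q) else 0) v
      = (\<Sum>i<N. \<Sum>a'<m. \<Sum>l<N. \<Sum>b'<m. if b' = b then if a' = a then G i l * (v (i, a) * v (l, b)) else 0 else 0)"
    unfolding qform_def sum.cartesian_product'
    by (intro sum.cong refl) auto
  also have "\<dots> = (\<Sum>i<N. \<Sum>l<N. G i l * (v (i, a) * v (l, b)))"
  proof -
    have delta: "(\<Sum>b'<m. if b' = b then c else 0) = c" for c :: real
      using assms by simp
    have delta': "(\<Sum>a'<m. \<Sum>l<N. if a' = a then c l else 0) = (\<Sum>l<N. c l)" for c :: "nat \<Rightarrow> real"
      using assms by (subst sum.swap) simp
    show ?thesis unfolding delta delta' ..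
  qed
  finally show ?thesis .
qed


text \<open>The multipliers supplied by conic duality form matrices that need not be symmetric. They
  are paired with symmetric matrices only, so they may be symmetrised.\<close>

lemma ip_symmetrise:
  fixes G Y :: "real mat"
  assumes "G \<in> carrier_mat m m" "G\<^sup>T = G" "Y \<in> carrier_mat m m"
  shows "ip G ((1 / 2) \<cdot>\<^sub>m (Y + Y\<^sup>T)) = ip G Y"
proof -
  have "ip G Y\<^sup>T = ip G\<^sup>T Y\<^sup>T" using assms by simp
  also have "\<dots> = ip G Y" using assms by (intro ip_transpose) auto
  finally show ?thesis using assms by (simp add: ip_smult_right ip_add_right)
qed

lemma ip_sandwich:
  assumes "T \<in> carrier_mat d m" "A \<in> carrier_mat d d" "A\<^sup>T = A" "Y \<in> carrier_mat m m"
  shows "ip (T\<^sup>T * (A * T)) Y = ip T (A * (T * Y))"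
proof -
  have "ip (T\<^sup>T * (A * T)) Y = ip (A * T) (T * Y)"
    using assms by (subst ip_mult_left) auto
  then show ?thesis using assms by (subst (asm) ip_mult_left[of T A]) auto
qed

text \<open>Rows \<open>0, \<dots>, d - 1\<close> of the vector variable form an operator \<open>T\<close> of the compression; the extra
  row \<open>d\<close> is the slack that turns \<open>\<Sum>V. V\<^sup>T * V \<le> 1\<close> into an equation. The index \<open>None\<close> stands for
  the objective \<open>M\<close>.\<close>
lemma compression_duality:
  fixes M :: "real mat" and s :: real
  assumes A: "sym_tuple g d A" and B: "sym_tuple g m B" and M: "M \<in> carrier_mat d d"
    and dual: "\<And>Y c. \<lbrakk>\<And>j. Y j \<in> sym_mats m;
        \<And>U. U \<in> carrier_mat 1 m \<Longrightarrow> 0 \<le> ip U (U * Y 0);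
        \<And>T. T \<in> carrier_mat d m \<Longrightarrow>
          0 \<le> ip T (T * Y 0) + (\<Sum>j=1..g. ip T (A j * (T * Y j))) + c * ip T (M * T)\<rbrakk>
      \<Longrightarrow> 0 \<le> ip (1\<^sub>m m) (Y 0) + (\<Sum>j=1..g. ip (B j) (Y j)) + c * s"
  shows "\<exists>Vs. compression g d A m B Vs \<and> (\<Sum>V\<leftarrow>Vs. ip V (M * V)) = s"
proof -
  define I where "I = {..<Suc d} \<times> {..<m}"
  define J where "J = {0..g} \<times> {..<m} \<times> {..<m}"
  define K where "K = insert None (Some ` J)"
  have finI: "finite I" and finK: "finite K" by (auto simp: I_def K_def J_def)
  \<comment> \<open>For j = 0 the slack row takes part, as its square fills the gap to the identity;
    for the other j the matrix \<open>A j\<close> is extended by zero in that row.\<close>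
  define coef where "coef = (\<lambda>j i l. if j = 0 then if i = l then 1 else 0
    else if i < d \<and> l < d then A j $$ (i, l) else 0 :: real)"
  define F where "F = (\<lambda>k (p :: nat \<times> nat) (q :: nat \<times> nat). case k of
      None \<Rightarrow> if snd p = snd q \<and> fst p < d \<and> fst q < d then M $$ (fst p, fst q) else 0
    | Some (j, a, b) \<Rightarrow> if snd p = a \<and> snd q = b then coef j (fst p) (fst q) else 0)"
  define rhs where "rhs = (\<lambda>k. case k of None \<Rightarrow> s
    | Some (j, a, b) \<Rightarrow> (if j = 0 then 1\<^sub>m m else B j) $$ (a, b))"
  define top where "top = (\<lambda>v :: nat \<times> nat \<Rightarrow> real. mat d m v)"
  \<comment> \<open>A single slack row is enough: the squares of many vectors are summed, and these
    sums of rank one matrices reach every rank.\<close>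
  define bot where "bot = (\<lambda>v :: nat \<times> nat \<Rightarrow> real. mat 1 m (\<lambda>(i, a). v (d, a)))"
  have top: "top v \<in> carrier_mat d m" and bot: "bot v \<in> carrier_mat 1 m" for v
    by (auto simp: top_def bot_def)
  define G where "G = (\<lambda>j v. if j = 0 then (top v)\<^sup>T * top v + (bot v)\<^sup>T * bot v
    else (top v)\<^sup>T * (A j * top v))"
  have G: "G j v \<in> carrier_mat m m" if "j \<in> {0..g}" for j v
    using top[of v] bot[of v] that sym_tupleD(1)[OF A, of j] unfolding G_def by auto
  have Gsym: "(G j v)\<^sup>T = G j v" if "j \<in> {0..g}" for j v
    using top[of v] bot[of v] that sym_tupleD[OF A, of j] unfolding G_def
    by (auto simp: mat_transpose_linear mat_transpose_mult mat_assoc)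
  have G0: "G 0 v $$ (a, b) = (\<Sum>i<Suc d. v (i, a) * v (i, b))" if "a < m" "b < m" for a b v
  proof -
    have "G 0 v $$ (a, b) = ((top v)\<^sup>T * top v) $$ (a, b) + ((bot v)\<^sup>T * bot v) $$ (a, b)"
      using that top[of v] bot[of v] by (simp add: G_def)
    also have "\<dots> = (\<Sum>i<d. (top v)\<^sup>T $$ (a, i) * top v $$ (i, b))
        + (\<Sum>i<1. (bot v)\<^sup>T $$ (a, i) * bot v $$ (i, b))"
      using that top[of v] bot[of v]
        mult_mat_entry[of "(top v)\<^sup>T" m d "top v" m] mult_mat_entry[of "(bot v)\<^sup>T" m 1 "bot v" m]
      by simp
    also have "\<dots> = (\<Sum>i<Suc d. v (i, a) * v (i, b))"
      using that by (simp add: top_def bot_def)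
    finally show ?thesis .
  qed
  have qF: "qform I (F (Some (j, a, b))) v = G j v $$ (a, b)"
    if "j \<in> {0..g}" "a < m" "b < m" for j a b v
  proof -
    have "qform I (F (Some (j, a, b))) v = (\<Sum>i<Suc d. \<Sum>l<Suc d. coef j i l * (v (i, a) * v (l, b)))"
      unfolding I_def F_def option.case prod.case using that(2,3) by (rule qform_block)
    also have "\<dots> = G j v $$ (a, b)"
    proof (cases "j = 0")
      case True
      have "(\<Sum>i<Suc d. \<Sum>l<Suc d. coef j i l * (v (i, a) * v (l, b)))
          = (\<Sum>i<Suc d. \<Sum>l<Suc d. if l = i then v (i, a) * v (i, b) else 0)"
        using True by (intro sum.cong refl) (auto simp: coef_def)
      also have "\<dots> = (\<Sum>i<Suc d. v (i, a) * v (i, b))"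
        by (intro sum.cong refl) (simp only: sum.delta finite_lessThan if_True)
      finally show ?thesis using True G0 that by simp
    next
      case False
      then have j: "j \<in> {1..g}" using that by auto
      have "(\<Sum>i<Suc d. \<Sum>l<Suc d. coef j i l * (v (i, a) * v (l, b)))
          = (\<Sum>i<d. \<Sum>l<d. A j $$ (i, l) * (v (i, a) * v (l, b)))"
        using False by (simp add: coef_def)
      also have "\<dots> = ((top v)\<^sup>T * (A j * top v)) $$ (a, b)"
        using that by (subst sandwich_entry[OF top sym_tupleD(1)[OF A j]]) (auto simp: top_def)
      finally show ?thesis using False by (simp add: G_def)
    qed
    finally show ?thesis .
  qed
  have qM: "qform I (F None) v = ip (top v) (M * top v)" for v
  proof -
    have "qform I (F None) v = (\<Sum>i<Suc d. \<Sum>a<m. \<Sum>l<Suc d. \<Sum>b<m.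
        if b = a then (if i < d \<and> l < d then M $$ (i, l) * (v (i, a) * v (l, a)) else 0) else 0)"
      unfolding qform_def I_def F_def sum.cartesian_product' by (intro sum.cong refl) auto
    also have "\<dots> = (\<Sum>i<d. \<Sum>a<m. \<Sum>l<d. M $$ (i, l) * (v (i, a) * v (l, a)))"
      by simp
    also have "\<dots> = (\<Sum>i<d. \<Sum>l<d. \<Sum>a<m. M $$ (i, l) * (v (i, a) * v (l, a)))"
      by (intro sum.cong refl sum.swap)
    also have "\<dots> = ip (top v) (M * top v)"
      by (subst ip_mult_expand[OF top M top]) (simp add: sum_distrib_left top_def)
    finally show ?thesis .
  qed
  have sumK: "(\<Sum>k\<in>K. h k) = h None + (\<Sum>j\<in>{0..g}. \<Sum>a<m. \<Sum>b<m. h (Some (j, a, b)))" for h :: "_ \<Rightarrow> real"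
    unfolding K_def J_def by (subst sum.insert) (auto simp: sum.reindex sum.cartesian_product')
  have split0: "(\<Sum>j\<in>{0..g}. h j) = h 0 + (\<Sum>j=1..g. h j)" for h :: "nat \<Rightarrow> real"
    by (simp add: sum.atLeast_Suc_atMost)
  have ipG0: "ip (G 0 v) Y = ip (top v) (top v * Y) + ip (bot v) (bot v * Y)"
    if "Y \<in> carrier_mat m m" for v Y
    using that top[of v] bot[of v] unfolding G_def
    by (simp add: ip_add_left ip_mult_left)
  have ipGj: "ip (G j v) Y = ip (top v) (A j * (top v * Y))"
    if "Y \<in> carrier_mat m m" "j \<in> {1..g}" for j v Y
    using ip_sandwich[OF top sym_tupleD(1,2)[OF A that(2)] that(1), of v] that(2) by (simp add: G_def)
  have "\<exists>V. \<forall>k\<in>K. (\<Sum>i\<in>I. qform I (F k) (V i)) = rhs k"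
  \<comment> \<open>The coefficients z add up the diagonal constraints for j = 0, that is, they take
    the trace of \<open>G 0 v\<close>, which is the squared length of v.\<close>
  proof (rule psd_farkas[OF finI finK, where z = "\<lambda>k. case k of None \<Rightarrow> 0
      | Some (j, a, b) \<Rightarrow> if j = 0 \<and> b = a then 1 else 0"])
    fix v :: "nat \<times> nat \<Rightarrow> real"
    let ?z = "\<lambda>k. case k of None \<Rightarrow> 0 | Some (j, a, b) \<Rightarrow> if j = 0 \<and> b = a then 1 else (0 :: real)"
    have "(\<Sum>k\<in>K. ?z k * qform I (F k) v)
        = (\<Sum>j\<in>{0..g}. \<Sum>a<m. \<Sum>b<m. (if j = 0 \<and> b = a then 1 else 0) * G j v $$ (a, b))"
      unfolding sumK by (simp add: qF)
    also have "\<dots> = (\<Sum>j\<in>{0..g}. \<Sum>a<m. \<Sum>b<m. if b = a then (if j = 0 then G 0 v $$ (a, a) else 0) else 0)"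
      by (intro sum.cong refl) auto
    also have "\<dots> = (\<Sum>a<m. G 0 v $$ (a, a))" by (simp add: split0)
    also have "\<dots> = (\<Sum>a<m. \<Sum>i<Suc d. (v (i, a))\<^sup>2)"
      by (intro sum.cong refl) (simp add: G0 power2_eq_square)
    also have "\<dots> = (\<Sum>p\<in>I. (v p)\<^sup>2)"
      unfolding I_def sum.cartesian_product' by (rule sum.swap)
    finally show "(\<Sum>p\<in>I. (v p)\<^sup>2) \<le> (\<Sum>k\<in>K. ?z k * qform I (F k) v)" by simp
  next
    fix y :: "(nat \<times> nat \<times> nat) option \<Rightarrow> real"
    assume pos: "\<And>v. 0 \<le> (\<Sum>k\<in>K. y k * qform I (F k) v)"
    define Y' where "Y' = (\<lambda>j. mat m m (\<lambda>(a, b). y (Some (j, a, b))))"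
    define Y where "Y = (\<lambda>j. (1 / 2) \<cdot>\<^sub>m (Y' j + (Y' j)\<^sup>T))"
    have Y': "Y' j \<in> carrier_mat m m" for j by (simp add: Y'_def)
    have Y: "Y j \<in> carrier_mat m m" for j by (auto simp: Y_def Y'_def)
    have Ysym: "Y j \<in> sym_mats m" for j
      using Y[of j] Y'[of j] comm_add_mat[of "Y' j" m m "(Y' j)\<^sup>T"]
      by (simp add: sym_mats_def Y_def mat_transpose_linear)
    have ipY: "ip H (Y j) = (\<Sum>a<m. \<Sum>b<m. y (Some (j, a, b)) * H $$ (a, b))"
      if "H \<in> carrier_mat m m" "H\<^sup>T = H" for H j
      unfolding Y_def ip_symmetrise[OF that Y'] by (simp add: ip_entries[OF that(1)] Y'_def mult.commute)
    have sumq: "(\<Sum>k\<in>K. y k * qform I (F k) v) = ip (top v) (top v * Y 0) + ip (bot v) (bot v * Y 0)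
        + (\<Sum>j=1..g. ip (top v) (A j * (top v * Y j))) + y None * ip (top v) (M * top v)" for v
    proof -
      have "(\<Sum>k\<in>K. y k * qform I (F k) v) = y None * ip (top v) (M * top v) + (\<Sum>j\<in>{0..g}. ip (G j v) (Y j))"
        unfolding sumK qM by (simp add: qF ipY[OF G Gsym])
      also have "(\<Sum>j\<in>{0..g}. ip (G j v) (Y j)) = ip (top v) (top v * Y 0) + ip (bot v) (bot v * Y 0)
          + (\<Sum>j=1..g. ip (top v) (A j * (top v * Y j)))"
        unfolding split0 by (simp add: ipG0[OF Y] ipGj[OF Y])
      finally show ?thesis by simp
    qed
    have "(\<Sum>k\<in>K. y k * rhs k) = y None * s
        + (\<Sum>j\<in>{0..g}. ip (if j = 0 then 1\<^sub>m m else B j) (Y j))"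
      unfolding sumK by (auto simp: rhs_def ipY sym_tupleD[OF B] intro!: sum.cong)
    also have "\<dots> = ip (1\<^sub>m m) (Y 0) + (\<Sum>j=1..g. ip (B j) (Y j)) + y None * s"
      unfolding split0 by simp
    also have "0 \<le> \<dots>"
    proof (rule dual[OF Ysym])
      fix U :: "real mat" assume U: "U \<in> carrier_mat 1 m"
      \<comment> \<open>A vector supported in the slack row sees \<open>Y 0\<close> only, which
        makes \<open>Y 0\<close> positive semidefinite; one that vanishes there gives the inequality
        for T.\<close>
      define v where "v = (\<lambda>(i, a). if i = d then U $$ (0, a) else 0)"
      have "top v = 0\<^sub>m d m" "bot v = U" using U by (auto simp: v_def top_def bot_def)
      then show "0 \<le> ip U (U * Y 0)"
        using pos[of v] M Y sym_tupleD(1)[OF A] unfolding sumq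
        by (simp add: ip_zero_left)
    next
      fix T :: "real mat" assume T: "T \<in> carrier_mat d m"
      define v where "v = (\<lambda>(i, a). if i < d then T $$ (i, a) else 0)"
      have "top v = T" "bot v = 0\<^sub>m 1 m" using T by (auto simp: v_def top_def bot_def)
      then show "0 \<le> ip T (T * Y 0) + (\<Sum>j=1..g. ip T (A j * (T * Y j))) + y None * ip T (M * T)"
        using pos[of v] unfolding sumq by (simp add: ip_zero_left)
    qed
    finally show "0 \<le> (\<Sum>k\<in>K. y k * rhs k)" .
  qed
  then obtain V where V: "\<And>k. k \<in> K \<Longrightarrow> (\<Sum>i\<in>I. qform I (F k) (V i)) = rhs k" by blast
  obtain ps where ps: "set ps = I" "distinct ps" using finite_distinct_list[OF finI] by blast
  define Vs where "Vs = map (\<lambda>i. top (V i)) ps"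
  have sumVs: "(\<Sum>T\<leftarrow>Vs. h T) = (\<Sum>i\<in>I. h (top (V i)))" for h :: "real mat \<Rightarrow> real"
    unfolding Vs_def using ps by (simp add: sum_list_distinct_conv_sum_set o_def)
  have VG: "(\<Sum>i\<in>I. G j (V i) $$ (a, b)) = (if j = 0 then 1\<^sub>m m else B j) $$ (a, b)"
    if "j \<in> {0..g}" "a < m" "b < m" for j a b
  proof -
    have "Some (j, a, b) \<in> K" using that by (auto simp: K_def J_def)
    from V[OF this] show ?thesis using that by (simp add: qF rhs_def)
  qed
  have "compression g d A m B Vs"
    unfolding compression_def
  proof (intro conjI allI ballI)
    show "set Vs \<subseteq> carrier_mat d m" using top by (auto simp: Vs_def)
  next
    fix n and W :: "real mat" assume W: "W \<in> carrier_mat m n"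
    have "(\<Sum>T\<leftarrow>Vs. ip (T * W) (T * W)) \<le> (\<Sum>i\<in>I. ip W (G 0 (V i) * W))"
      unfolding sumVs
    proof (rule sum_mono)
      fix i
      note t = top[of "V i"] bot[of "V i"]
      have "ip W (G 0 (V i) * W) = ip (top (V i) * W) (top (V i) * W) + ip (bot (V i) * W) (bot (V i) * W)"
        using t W unfolding G_def by (simp add: mat_distribs ip_add_right ip_mult_left mat_assoc)
      then show "ip (top (V i) * W) (top (V i) * W) \<le> ip W (G 0 (V i) * W)"
        using ip_nonneg[of "bot (V i) * W"] by simp
    qed
    also have "\<dots> = ip W (1\<^sub>m m * W)"
      using G[of 0] VG[of 0] W by (intro sum_ip_mult_eq[of _ _ m _ _ n]) auto
    finally show "(\<Sum>T\<leftarrow>Vs. ip (T * W) (T * W)) \<le> ip W W" using W by simp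
  next
    fix j n and U W :: "real mat"
    assume j: "j \<in> {1..g}" and U: "U \<in> carrier_mat m n" and W: "W \<in> carrier_mat m n"
    have "(\<Sum>T\<leftarrow>Vs. ip (T * U) (A j * (T * W))) = (\<Sum>i\<in>I. ip U (G j (V i) * W))"
      unfolding sumVs
    proof (rule sum.cong[OF refl])
      fix i
      show "ip (top (V i) * U) (A j * (top (V i) * W)) = ip U (G j (V i) * W)"
        using j U W top[of "V i"] sym_tupleD[OF A j] unfolding G_def
        by (simp add: ip_mult_left mat_assoc)
    qed
    also have "\<dots> = ip U (B j * W)"
      using j G[of j] VG[of j] U W sym_tupleD[OF B j] by (intro sum_ip_mult_eq[of _ _ m _ _ n]) auto
    finally show "(\<Sum>T\<leftarrow>Vs. ip (T * U) (A j * (T * W))) = ip U (B j * W)" .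
  qed
  moreover have "(\<Sum>T\<leftarrow>Vs. ip T (M * T)) = s"
    unfolding sumVs qM[symmetric] using V[of None] by (simp add: K_def rhs_def)
  ultimately show ?thesis by blast
qed

section \<open>From containment of free spectrahedra to a compression\<close>

lemma sym_matsD:
  assumes "Y \<in> sym_mats m"
  shows "Y \<in> carrier_mat m m" "Y\<^sup>T = Y" "dim_row Y = m" "dim_col Y = m"
  using assms by (auto simp: sym_mats_def)

lemma psd_mat_factor:
  assumes Y: "Y \<in> sym_mats m" and pos: "\<And>U. U \<in> carrier_mat 1 m \<Longrightarrow> 0 \<le> ip U (U * Y)"
  shows "\<exists>C\<in>carrier_mat m m. Y = C * C\<^sup>T"
proof -
  have "psd_on {..<m} (\<lambda>a b. Y $$ (a, b))"
    unfolding psd_on_def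
  proof (intro conjI ballI allI)
    fix a b assume "a \<in> {..<m}" "b \<in> {..<m}"
    then show "Y $$ (a, b) = Y $$ (b, a)"
      using sym_matsD[OF Y] by (metis index_transpose_mat(1) lessThan_iff)
  next
    fix v :: "nat \<Rightarrow> real"
    define U where "U = mat 1 m (\<lambda>(i, a). v a)"
    have U: "U \<in> carrier_mat 1 m" by (simp add: U_def)
    have "ip U (U * Y) = (\<Sum>a<m. \<Sum>b<m. U $$ (0, a) * (U $$ (0, b) * Y $$ (b, a)))"
      unfolding ip_entries[OF U] using U sym_matsD[OF Y]
      by (simp add: mult_mat_entry[OF U sym_matsD(1)[OF Y]] sum_distrib_left del: index_mult_mat(1))
    also have "\<dots> = (\<Sum>b<m. \<Sum>a<m. U $$ (0, a) * (U $$ (0, b) * Y $$ (b, a)))"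
      by (rule sum.swap)
    also have "\<dots> = qform {..<m} (\<lambda>a b. Y $$ (a, b)) v"
      unfolding qform_def U_def by (intro sum.cong refl) simp
    finally show "0 \<le> qform {..<m} (\<lambda>a b. Y $$ (a, b)) v" using pos[OF U] by simp
  qed
  then obtain V where V: "\<forall>a\<in>{..<m}. \<forall>b\<in>{..<m}. Y $$ (a, b) = (\<Sum>i<m. V i a * V i b)"
    using psd_on_factor[of "{..<m}" "\<lambda>a b. Y $$ (a, b)"] by blast
  define C where "C = mat m m (\<lambda>(a, i). V i a)"
  have C: "C \<in> carrier_mat m m" by (simp add: C_def)
  have "Y = C * C\<^sup>T"
  proof (rule eq_matI)
    fix a b assume "a < dim_row (C * C\<^sup>T)" "b < dim_col (C * C\<^sup>T)"
    then have ab: "a < m" "b < m" using C by auto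
    then have "(C * C\<^sup>T) $$ (a, b) = (\<Sum>i<m. C $$ (a, i) * C\<^sup>T $$ (i, b))"
      using C by (intro mult_mat_entry) auto
    also have "\<dots> = Y $$ (a, b)" using ab V by (simp add: C_def)
    finally show "Y $$ (a, b) = (C * C\<^sup>T) $$ (a, b)" by simp
  qed (use C sym_matsD[OF Y] in auto)
  then show ?thesis using C by blast
qed

text \<open>A null vector of \<open>C\<^sup>T\<close>, written as a row U, would give U * P = 0 and
  contradict the lower bound e on P.\<close>

lemma factor_pos_def_invertible:
  fixes C P :: "real mat"
  assumes C: "C \<in> carrier_mat m m" and P: "P = C * C\<^sup>T" and e: "0 < e"
    and pos: "\<And>U. U \<in> carrier_mat 1 m \<Longrightarrow> e * ip U U \<le> ip U (U * P)"
  shows "\<exists>D\<in>carrier_mat m m. D * C = 1\<^sub>m m \<and> C * D = 1\<^sub>m m"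
proof -
  have "det C \<noteq> 0"
  proof
    assume "det C = 0"
    then have "det (C\<^sup>T) = 0" using det_transpose[OF C] by simp
    then obtain v where v: "v \<in> carrier_vec m" "v \<noteq> 0\<^sub>v m" "C\<^sup>T *\<^sub>v v = 0\<^sub>v m"
      using det_0_iff_vec_prod_zero[of "C\<^sup>T" m] C by auto
    define U where "U = mat 1 m (\<lambda>(i, a). v $ a)"
    have U: "U \<in> carrier_mat 1 m" by (simp add: U_def)
    have "U * C = 0\<^sub>m 1 m"
    proof (rule eq_matI)
      fix i k assume "i < dim_row (0\<^sub>m 1 m :: real mat)" "k < dim_col (0\<^sub>m 1 m :: real mat)"
      then have ik: "i = 0" "k < m" by auto
      have "(U * C) $$ (i, k) = (\<Sum>l<m. U $$ (0, l) * C $$ (l, k))"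
        using ik U C by (subst mult_mat_entry[of _ 1 m _ m]) auto
      also have "\<dots> = (C\<^sup>T *\<^sub>v v) $ k"
        using ik C v(1) by (auto simp: U_def scalar_prod_def atLeast0LessThan mult.commute intro!: sum.cong)
      finally show "(U * C) $$ (i, k) = (0\<^sub>m 1 m :: real mat) $$ (i, k)" using ik v(3) by simp
    qed (use U C in auto)
    then have "U * P = 0\<^sub>m 1 m"
      using U C mat_assoc[of U C "C\<^sup>T"] by (simp add: P)
    then have "ip U (U * P) = 0" using U by (simp add: ip_zero_right)
    then have "e * ip U U \<le> 0" using pos[OF U] by simp
    then have "ip U U = 0" using e ip_nonneg[of U] by (simp add: mult_le_0_iff)
    then have z: "U = 0\<^sub>m 1 m" using ip_eq_0D[of U] U by simp
    have "v = 0\<^sub>v m"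
    proof (rule eq_vecI)
      fix i assume "i < dim_vec (0\<^sub>v m :: real vec)"
      then have "i < m" by simp
      then have "v $ i = U $$ (0, i)" by (simp add: U_def)
      then show "v $ i = (0\<^sub>v m :: real vec) $ i" using \<open>i < m\<close> z by simp
    qed (use v in auto)
    then show False using v(2) by simp
  qed
  then have "C \<in> Units (ring_mat TYPE(real) m ())" using det_non_zero_imp_unit[OF C, where b = "()"] by simp
  then show ?thesis unfolding Units_def by (auto simp: ring_mat_def)
qed

text \<open>Multipliers that violate the dual condition would produce a point of the spectrahedron
  of A outside that of B: a congruence by the inverse factor of \<open>Y 0\<close> turns the
  inequality in T into the pencil inequality at a tuple X of size m. The objective is 0, as only
  existence is wanted.\<close>

lemma dominates_imp_compression:
  assumes A: "sym_tuple g d A" and B: "sym_tuple g m B" and dom: "dominates g d A m B"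
  shows "\<exists>Vs. compression g d A m B Vs"
proof -
  have "\<exists>Vs. compression g d A m B Vs \<and> (\<Sum>V\<leftarrow>Vs. ip V (0\<^sub>m d d * V)) = 0"
  proof (rule compression_duality[OF A B])
    fix Y :: "nat \<Rightarrow> real mat" and c
    assume Y: "\<And>j. Y j \<in> sym_mats m"
      and Y0: "\<And>U. U \<in> carrier_mat 1 m \<Longrightarrow> 0 \<le> ip U (U * Y 0)"
      and pos: "\<And>T. T \<in> carrier_mat d m \<Longrightarrow>
          0 \<le> ip T (T * Y 0) + (\<Sum>j=1..g. ip T (A j * (T * Y j))) + c * ip T (0\<^sub>m d d * T)"
    have pos': "0 \<le> ip T (T * Y 0) + (\<Sum>j=1..g. ip T (A j * (T * Y j)))"
      if T: "T \<in> carrier_mat d m" for T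
    proof -
      have "ip T (0\<^sub>m d d * T) = 0" using T by (simp add: ip_zero_right)
      then show ?thesis using pos[OF T] by simp
    qed
    note Yc = sym_matsD[OF Y]
    have eps: "0 \<le> ip (1\<^sub>m m) (Y 0) + (\<Sum>j=1..g. ip (B j) (Y j)) + e * real m" if e: "0 < e" for e
    proof -
      \<comment> \<open>\<open>Y 0\<close> may be singular; the shift by e makes its factor C
        invertible and is removed at the end by letting e become small.\<close>
      define P where "P = Y 0 + e \<cdot>\<^sub>m 1\<^sub>m m"
      have Psym: "P \<in> sym_mats m" using Yc[of 0] by (auto simp: P_def sym_mats_def mat_transpose_linear)
      have ipP: "ip T (T * P) = ip T (T * Y 0) + e * ip T T" if "dim_col T = m" for T
        using that Yc[of 0] unfolding P_def
        by (simp add: mat_distribs ip_add_right mat_smult ip_smult_right)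
      have "0 \<le> ip U (U * P)" if "U \<in> carrier_mat 1 m" for U
        using Y0[OF that] ipP[of U] that e ip_nonneg[of U] by simp
      then obtain C where C: "C \<in> carrier_mat m m" and PC: "P = C * C\<^sup>T"
        using psd_mat_factor[OF Psym] by blast
      have "e * ip U U \<le> ip U (U * P)" if "U \<in> carrier_mat 1 m" for U
        using Y0[OF that] ipP[of U] that by simp
      then obtain D where D: "D \<in> carrier_mat m m" and DC: "D * C = 1\<^sub>m m" "C * D = 1\<^sub>m m"
        using factor_pos_def_invertible[OF C PC e] by blast
      \<comment> \<open>D is the inverse of C, so the substitution \<open>T = W * D\<close> carries
        the form with P and \<open>Y j\<close> into the pencil inequality with 1 and
        \<open>X j\<close>.\<close>
      define X where "X = (\<lambda>j. D * (Y j * D\<^sup>T))"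
      have "Y j * D\<^sup>T \<in> carrier_mat m m" for j
        using D Yc(1)[of j] by (intro mult_carrier_mat[of _ m m]) auto
      then have "D * (Y j * D\<^sup>T) \<in> carrier_mat m m" for j using D mult_carrier_mat by blast
      moreover have "(D * (Y j * D\<^sup>T))\<^sup>T = D * (Y j * D\<^sup>T)" for j
        using D Yc[of j] by (simp add: mat_transpose_mult mat_assoc)
      ultimately have X: "sym_tuple g m X"
        unfolding sym_tuple_def X_def sym_mats_def by blast
      have "lmi g d A m X"
        unfolding lmi_def
      proof
        fix W :: "real mat" assume W: "W \<in> carrier_mat d m"
        define T where "T = W * D"
        have T: "T \<in> carrier_mat d m" using W D by (simp add: T_def)
        have "T * C = W" using W D C DC by (simp add: T_def mat_assoc)
        then have "ip W W = ip T (T * P)"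
          using T C W ip_mult_right[of C T "T * C"] mat_assoc[of T C "C\<^sup>T"] by (simp add: PC)
        moreover have "ip W (A j * (W * X j)) = ip T (A j * (T * Y j))" if "j \<in> {1..g}" for j
          using W D T Yc[of j] sym_tupleD[OF A that] ip_mult_right[of D W "A j * (T * Y j)"]
          by (simp add: X_def T_def mat_assoc)
        ultimately have "ip W W + (\<Sum>j=1..g. ip W (A j * (W * X j)))
            = ip T (T * Y 0) + (\<Sum>j=1..g. ip T (A j * (T * Y j))) + e * ip T T"
          using ipP[of T] T by simp
        then show "0 \<le> ip W W + (\<Sum>j=1..g. ip W (A j * (W * X j)))"
          using pos'[OF T] e ip_nonneg[of T] by simp
      qed
      then have "lmi g m B m X" using dom X unfolding dominates_def by blast
      \<comment> \<open>Testing at C undoes the congruence and leaves the pairings of 1 with P and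
        of \<open>B j\<close> with \<open>Y j\<close>.\<close>
      then have "0 \<le> ip C C + (\<Sum>j=1..g. ip C (B j * (C * X j)))" using C unfolding lmi_def by blast
      moreover have "ip C C = ip (1\<^sub>m m) (Y 0) + e * real m"
        using C ip_mult_right[of C "1\<^sub>m m" C] ipP[of "1\<^sub>m m"] Psym Yc[of 0] by (simp add: PC ip_one sym_matsD)
      moreover have "ip C (B j * (C * X j)) = ip (B j) (Y j)" if j: "j \<in> {1..g}" for j
      proof -
        have CX: "C * X j = Y j * D\<^sup>T"
          using C D DC Yc[of j] mat_assoc[of C D "Y j * D\<^sup>T"] by (simp add: X_def)
        have "ip C (B j * (C * X j)) = ip C (B j * Y j * D\<^sup>T)"
          using C D Yc[of j] sym_tupleD[OF B j] by (simp add: CX mat_assoc)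
        also have "\<dots> = ip (1\<^sub>m m) (B j * Y j)"
          using C D DC Yc[of j] sym_tupleD[OF B j] ip_mult_right[of D C "B j * Y j"] by simp
        also have "\<dots> = ip (B j) (Y j)"
          using Yc[of j] sym_tupleD[OF B j] ip_mult_left[of "1\<^sub>m m" "B j" "Y j"] by simp
        finally show ?thesis .
      qed
      ultimately show ?thesis by simp
    qed
    let ?L = "ip (1\<^sub>m m) (Y 0) + (\<Sum>j=1..g. ip (B j) (Y j))"
    have "0 \<le> ?L"
    proof (rule ccontr)
      assume neg: "\<not> 0 \<le> ?L"
      \<comment> \<open>m may be 0; the summand 1 keeps the divisor positive. With the e chosen
        below, \<open>e * real m\<close> is at most half of the assumed deficit.\<close>
      define k where "k = real m + 1"
      have k: "k > 0" "real m = k - 1" by (auto simp: k_def)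
      define e where "e = - ?L / (2 * k)"
      have "e * k = - ?L / 2" using k by (simp add: e_def)
      moreover have "e > 0" unfolding e_def using neg k by (intro divide_pos_pos) auto
      ultimately show False using eps[of e] neg unfolding k(2) by (simp add: right_diff_distrib)
    qed
    then show "0 \<le> ip (1\<^sub>m m) (Y 0) + (\<Sum>j=1..g. ip (B j) (Y j)) + c * 0" by simp
  qed simp
  then show ?thesis by blast
qed

section \<open>Existence of maximal compressions\<close>

lemma ip_quadratic_le:
  assumes "M \<in> carrier_mat d d" "V \<in> carrier_mat d m"
  shows "ip V (M * V) \<le> (\<Sum>i<d. \<Sum>l<d. \<bar>M $$ (i, l)\<bar>) * ip V V"
proof -
  have row: "(\<Sum>k<m. (V $$ (i, k))\<^sup>2) \<le> ip V V" if "i < d" for i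
    unfolding ip_entries[OF assms(2)] power2_eq_square
    using that by (intro member_le_sum) (auto intro: sum_nonneg)
  have "ip V (M * V) = (\<Sum>i<d. \<Sum>l<d. M $$ (i, l) * (\<Sum>k<m. V $$ (i, k) * V $$ (l, k)))"
    using assms by (intro ip_mult_expand) auto
  also have "\<dots> \<le> (\<Sum>i<d. \<Sum>l<d. \<bar>M $$ (i, l)\<bar> * ip V V)"
  proof (intro sum_mono)
    fix i l assume il: "i \<in> {..<d}" "l \<in> {..<d}"
    have "\<bar>\<Sum>k<m. V $$ (i, k) * V $$ (l, k)\<bar> \<le> (\<Sum>k<m. \<bar>V $$ (i, k) * V $$ (l, k)\<bar>)"
      by (rule sum_abs)
    also have "\<dots> \<le> (\<Sum>k<m. ((V $$ (i, k))\<^sup>2 + (V $$ (l, k))\<^sup>2) / 2)"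
    proof (rule sum_mono)
      fix k
      have "0 \<le> (\<bar>V $$ (i, k)\<bar> - \<bar>V $$ (l, k)\<bar>)\<^sup>2" by simp
      then show "\<bar>V $$ (i, k) * V $$ (l, k)\<bar> \<le> ((V $$ (i, k))\<^sup>2 + (V $$ (l, k))\<^sup>2) / 2"
        by (simp add: power2_eq_square algebra_simps abs_mult)
    qed
    also have "\<dots> = ((\<Sum>k<m. (V $$ (i, k))\<^sup>2) + (\<Sum>k<m. (V $$ (l, k))\<^sup>2)) / 2"
      by (simp add: sum.distrib sum_divide_distrib[symmetric])
    also have "\<dots> \<le> ip V V" using row[of i] row[of l] il by simp
    finally have "\<bar>M $$ (i, l) * (\<Sum>k<m. V $$ (i, k) * V $$ (l, k))\<bar> \<le> \<bar>M $$ (i, l)\<bar> * ip V V"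
      unfolding abs_mult by (intro mult_left_mono) auto
    then show "M $$ (i, l) * (\<Sum>k<m. V $$ (i, k) * V $$ (l, k)) \<le> \<bar>M $$ (i, l)\<bar> * ip V V" by linarith
  qed
  finally show ?thesis by (simp add: sum_distrib_right)
qed

lemma compression_carrier: "compression g d A m B Vs \<Longrightarrow> V \<in> set Vs \<Longrightarrow> V \<in> carrier_mat d m"
  by (auto simp: compression_def)

lemma compression_trace_le:
  assumes "compression g d A m B Vs"
  shows "(\<Sum>V\<leftarrow>Vs. ip V V) \<le> real m"
proof -
  have "(\<Sum>V\<leftarrow>Vs. ip V V) = (\<Sum>V\<leftarrow>Vs. ip (V * 1\<^sub>m m) (V * 1\<^sub>m m))"
    by (intro arg_cong[of _ _ sum_list] map_cong refl)
      (simp add: right_mult_one_mat[OF compression_carrier[OF assms]])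
  also have "\<dots> \<le> ip (1\<^sub>m m) (1\<^sub>m m)"
    using assms one_carrier_mat[of m, where ?'a = real] unfolding compression_def by blast
  finally show ?thesis by (simp add: ip_one)
qed

text \<open>The supremum of the objective satisfies the dual feasibility condition, so
  \<open>compression_duality\<close> produces a compression with exactly this value; no limit of
  lists of Kraus operators is taken.\<close>

lemma compression_max:
  assumes A: "sym_tuple g d A" and B: "sym_tuple g m B" and M: "M \<in> carrier_mat d d"
    and ex: "compression g d A m B Us"
  shows "\<exists>Vs. compression g d A m B Vs \<and> (\<forall>Ws. compression g d A m B Ws \<longrightarrow>
    (\<Sum>W\<leftarrow>Ws. ip W (M * W)) \<le> (\<Sum>V\<leftarrow>Vs. ip V (M * V)))"
proof -
  define obj where "obj = (\<lambda>Vs. \<Sum>V\<leftarrow>Vs. ip V (M * V))"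
  define S where "S = obj ` {Vs. compression g d A m B Vs}"
  define c0 where "c0 = (\<Sum>i<d. \<Sum>l<d. \<bar>M $$ (i, l)\<bar>)"
  have "obj Vs \<le> c0 * real m" if "compression g d A m B Vs" for Vs
  proof -
    have "obj Vs \<le> (\<Sum>V\<leftarrow>Vs. c0 * ip V V)"
      unfolding obj_def c0_def using compression_carrier[OF that] M
      by (intro sum_list_mono ip_quadratic_le) auto
    also have "\<dots> = c0 * (\<Sum>V\<leftarrow>Vs. ip V V)" by (simp add: sum_list_const_mult)
    also have "\<dots> \<le> c0 * real m"
      using compression_trace_le[OF that] by (intro mult_left_mono) (auto simp: c0_def intro: sum_nonneg)
    finally show ?thesis .
  qed
  then have bdd: "bdd_above S" by (auto simp: S_def intro!: bdd_aboveI)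
  have ne: "S \<noteq> {}" using ex by (auto simp: S_def)
  have "\<exists>Vs. compression g d A m B Vs \<and> (\<Sum>V\<leftarrow>Vs. ip V (M * V)) = Sup S"
  proof (rule compression_duality[OF A B M])
    fix Y :: "nat \<Rightarrow> real mat" and c
    assume Y: "\<And>j. Y j \<in> sym_mats m"
      and Y0: "\<And>U. U \<in> carrier_mat 1 m \<Longrightarrow> 0 \<le> ip U (U * Y 0)"
      and pos: "\<And>T. T \<in> carrier_mat d m \<Longrightarrow>
          0 \<le> ip T (T * Y 0) + (\<Sum>j=1..g. ip T (A j * (T * Y j))) + c * ip T (M * T)"
    note Yc = sym_matsD[OF Y]
    obtain C where C: "C \<in> carrier_mat m m" "Y 0 = C * C\<^sup>T" using psd_mat_factor[OF Y Y0] by blast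
    let ?L = "ip (1\<^sub>m m) (Y 0) + (\<Sum>j=1..g. ip (B j) (Y j))"
    \<comment> \<open>Weak duality: the inequality \<open>pos\<close> is summed over the Kraus
      operators of an arbitrary compression, and the contraction property is tested at a square root
      factor C of \<open>Y 0\<close>.\<close>
    have main: "0 \<le> ?L + c * obj Vs" if Vs: "compression g d A m B Vs" for Vs
    proof -
      note Vc = compression_carrier[OF Vs]
      have "0 \<le> (\<Sum>V\<leftarrow>Vs. ip V (V * Y 0) + (\<Sum>j=1..g. ip V (A j * (V * Y j))) + c * ip V (M * V))"
        using Vc pos by (intro sum_list_nonneg) auto
      also have "\<dots> = (\<Sum>V\<leftarrow>Vs. ip V (V * Y 0)) + (\<Sum>j=1..g. \<Sum>V\<leftarrow>Vs. ip V (A j * (V * Y j))) + c * obj Vs"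
        by (simp add: sum_list_addf sum_list_sum_swap sum_list_const_mult obj_def)
      also have "(\<Sum>V\<leftarrow>Vs. ip V (V * Y 0)) = (\<Sum>V\<leftarrow>Vs. ip (V * C) (V * C))"
      proof (intro arg_cong[of _ _ sum_list] map_cong refl)
        fix V assume "V \<in> set Vs"
        then show "ip V (V * Y 0) = ip (V * C) (V * C)"
          using Vc[of V] C ip_mult_right[of C V "V * C"] by (simp add: mat_assoc)
      qed
      also have "\<dots> \<le> ip C C" using Vs C unfolding compression_def by blast
      also have "ip C C = ip (1\<^sub>m m) (Y 0)"
        using C ip_mult_right[of C "1\<^sub>m m" C] by simp
      also have "(\<Sum>j=1..g. \<Sum>V\<leftarrow>Vs. ip V (A j * (V * Y j))) = (\<Sum>j=1..g. ip (B j) (Y j))"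
      proof (rule sum.cong[OF refl])
        fix j assume j: "j \<in> {1..g}"
        have "(\<Sum>V\<leftarrow>Vs. ip V (A j * (V * Y j))) = (\<Sum>V\<leftarrow>Vs. ip (V * 1\<^sub>m m) (A j * (V * Y j)))"
          by (intro arg_cong[of _ _ sum_list] map_cong refl) (simp add: right_mult_one_mat[OF Vc])
        also have "\<dots> = ip (1\<^sub>m m) (B j * Y j)"
          using Vs j Yc(1)[of j] unfolding compression_def by (meson one_carrier_mat)
        also have "\<dots> = ip (B j) (Y j)"
          using Yc[of j] sym_tupleD[OF B j] ip_mult_left[of "1\<^sub>m m" "B j" "Y j"] by simp
        finally show "(\<Sum>V\<leftarrow>Vs. ip V (A j * (V * Y j))) = ip (B j) (Y j)" .
      qed
      finally show ?thesis by simp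
    qed
    show "0 \<le> ?L + c * Sup S"
    \<comment> \<open>For c \<ge> 0, raising the objective of one compression to the supremum only
      helps. For negative c, \<open>main\<close> is an upper bound for all objectives and hence for
      their supremum.\<close>
    proof (cases "0 \<le> c")
      case True
      have "obj Us \<le> Sup S" using ex bdd by (intro cSup_upper) (auto simp: S_def)
      then have "c * obj Us \<le> c * Sup S" using True by (rule mult_left_mono)
      then show ?thesis using main[OF ex] by simp
    next
      case False
      have "Sup S \<le> ?L / (- c)"
      proof (rule cSup_least[OF ne])
        fix x assume "x \<in> S"
        then obtain Vs where "compression g d A m B Vs" "x = obj Vs" by (auto simp: S_def)
        then show "x \<le> ?L / (- c)" using main[of Vs] False
            by (subst pos_le_divide_eq) (auto simp: algebra_simps)
      qed
      then have "Sup S * (- c) \<le> ?L" using False by (subst (asm) pos_le_divide_eq) auto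
      then show ?thesis by (simp add: algebra_simps)
    qed
  qed
  then obtain Vs where Vs: "compression g d A m B Vs" "obj Vs = Sup S" by (auto simp: obj_def)
  have "obj Ws \<le> obj Vs" if "compression g d A m B Ws" for Ws
    unfolding Vs(2) using that bdd by (intro cSup_upper) (auto simp: S_def)
  then show ?thesis using Vs(1) unfolding obj_def by blast
qed

section \<open>Tuples of least size\<close>

lemma compression_contractive:
  "compression g d A m B Vs \<Longrightarrow> W \<in> carrier_mat m n \<Longrightarrow> (\<Sum>V\<leftarrow>Vs. ip (V * W) (V * W)) \<le> ip W W"
  unfolding compression_def by blast

definition least_tuple :: "nat \<Rightarrow> nat \<Rightarrow> pencil \<Rightarrow> bool" where
  "least_tuple g n A \<longleftrightarrow> sym_tuple g n A \<and>
    (\<forall>s C. sym_tuple g s C \<longrightarrow> dominates g s C n A \<longrightarrow> dominates g n A s C \<longrightarrow> n \<le> s)"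

lemma isometry_compression:
  assumes A: "sym_tuple g n A" and R: "R \<in> carrier_mat n s" and iso: "R\<^sup>T * R = 1\<^sub>m s"
  shows "compression g n A s (\<lambda>j. R\<^sup>T * (A j * R)) [R]"
  unfolding compression_def
proof (intro conjI allI ballI)
  show "set [R] \<subseteq> carrier_mat n s" using R by simp
next
  fix k and W :: "real mat" assume W: "W \<in> carrier_mat s k"
  have "R\<^sup>T * (R * W) = W" using mat_assoc[of "R\<^sup>T" R W] R W iso by simp
  then show "(\<Sum>V\<leftarrow>[R]. ip (V * W) (V * W)) \<le> ip W W"
    using R W by (simp add: ip_mult_left)
next
  fix j k and U W :: "real mat"
  assume "j \<in> {1..g}" "U \<in> carrier_mat s k" "W \<in> carrier_mat s k"
  then show "(\<Sum>V\<leftarrow>[R]. ip (V * U) (A j * (V * W))) = ip U (R\<^sup>T * (A j * R) * W)"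
    using sym_tupleD[OF A, of j] R by (simp add: ip_mult_left mat_assoc)
qed

text \<open>If R reproduces the ranges of all V, then each V factors through R, and inserting
  \<open>R * R\<^sup>T\<close> around \<open>A j\<close> changes nothing. The range of R need not be
  invariant under A.\<close>

lemma compression_through_range:
  assumes A: "sym_tuple g n A" and c: "compression g n A m B Vs"
    and R: "R \<in> carrier_mat n s" and RV: "\<And>V. V \<in> set Vs \<Longrightarrow> R * (R\<^sup>T * V) = V"
  shows "compression g s (\<lambda>j. R\<^sup>T * (A j * R)) m B (map (\<lambda>V. R\<^sup>T * V) Vs)"
proof -
  have V: "V \<in> carrier_mat n m" if "V \<in> set Vs" for V using c that by (rule compression_carrier)
  have RVW: "R * (R\<^sup>T * (V * W)) = V * W" if "V \<in> set Vs" "dim_row W = m" for V W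
    using V[OF that(1)] R RV[OF that(1)] that(2)
      mat_assoc[of R "R\<^sup>T * V" W] mat_assoc[of "R\<^sup>T" V W] by simp
  show ?thesis
    unfolding compression_def
  proof (intro conjI allI ballI)
    show "set (map (\<lambda>V. R\<^sup>T * V) Vs) \<subseteq> carrier_mat s m" using V R by auto
  next
    fix k and W :: "real mat" assume W: "W \<in> carrier_mat m k"
    have "(\<Sum>V\<leftarrow>map (\<lambda>V. R\<^sup>T * V) Vs. ip (V * W) (V * W)) = (\<Sum>V\<leftarrow>Vs. ip (V * W) (V * W))"
      unfolding map_map o_def
    proof (intro arg_cong[of _ _ sum_list] map_cong refl)
      fix V assume "V \<in> set Vs"
      then show "ip (R\<^sup>T * V * W) (R\<^sup>T * V * W) = ip (V * W) (V * W)"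
        using V[of V] R W RVW[of V W] by (simp add: mat_assoc ip_mult_left[of _ "R\<^sup>T"])
    qed
    then show "(\<Sum>V\<leftarrow>map (\<lambda>V. R\<^sup>T * V) Vs. ip (V * W) (V * W)) \<le> ip W W"
      using c W unfolding compression_def by simp
  next
    fix j k and U W :: "real mat"
    assume j: "j \<in> {1..g}" and U: "U \<in> carrier_mat m k" and W: "W \<in> carrier_mat m k"
    have "(\<Sum>V\<leftarrow>map (\<lambda>V. R\<^sup>T * V) Vs. ip (V * U) (R\<^sup>T * (A j * R) * (V * W)))
        = (\<Sum>V\<leftarrow>Vs. ip (V * U) (A j * (V * W)))"
      unfolding map_map o_def
    proof (intro arg_cong[of _ _ sum_list] map_cong refl)
      fix V assume "V \<in> set Vs"
      then show "ip (R\<^sup>T * V * U) (R\<^sup>T * (A j * R) * (R\<^sup>T * V * W)) = ip (V * U) (A j * (V * W))"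
        using V[of V] R W U RVW[of V W] RVW[of V U] sym_tupleD[OF A j]
          ip_mult_left[of "R\<^sup>T * (V * U)" R "A j * (V * W)"]
        by (simp add: mat_assoc)
    qed
    then show "(\<Sum>V\<leftarrow>map (\<lambda>V. R\<^sup>T * V) Vs. ip (V * U) (R\<^sup>T * (A j * R) * (V * W))) = ip U (B j * W)"
      using c j U W unfolding compression_def by simp
  qed
qed

text \<open>Compressing to the kernel of \<open>D\<close> would produce an equivalent smaller tuple.\<close>
lemma least_tuple_annihilator:
  assumes least: "least_tuple g n A" and c: "compression g n A n A Vs"
    and D: "D \<in> carrier_mat p n" and DV: "\<And>V. V \<in> set Vs \<Longrightarrow> D * V = 0\<^sub>m p n"
  shows "D = 0\<^sub>m p n"
proof -
  have A: "sym_tuple g n A" using least by (simp add: least_tuple_def)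
  obtain s R where R: "R \<in> carrier_mat n s" and iso: "R\<^sup>T * R = 1\<^sub>m s" and DR: "D * R = 0\<^sub>m p s"
    and proj: "\<And>k X. X \<in> carrier_mat n k \<Longrightarrow> D * X = 0\<^sub>m p k \<Longrightarrow> R * (R\<^sup>T * X) = X"
    using kernel_orthonormal_basis[OF D] by blast
  let ?C = "\<lambda>j. R\<^sup>T * (A j * R)"
  have C: "sym_tuple g s ?C"
    unfolding sym_tuple_def
  proof
    fix j assume j: "j \<in> {1..g}"
    have "A j * R \<in> carrier_mat n s" using sym_tupleD[OF A j] R by auto
    then have "?C j \<in> carrier_mat s s" using R by auto
    moreover have "(?C j)\<^sup>T = ?C j"
      using sym_tupleD[OF A j] R by (simp add: mat_transpose_mult mat_assoc)
    ultimately show "?C j \<in> sym_mats s" by (simp add: sym_mats_def)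
  qed
  have "dominates g n A s ?C"
    using compression_dominates[OF A isometry_compression[OF A R iso]] .
  moreover have "dominates g s ?C n A"
    using compression_dominates[OF C compression_through_range[OF A c R]]
      proj compression_carrier[OF c] DV by blast
  ultimately have "n \<le> s" using least C unfolding least_tuple_def by blast
  then have "s = n" using isometry_square(1)[OF R iso] by simp
  \<comment> \<open>By leastness the kernel of D is the whole space, so D * R = 0 can be multiplied
    by \<open>R\<^sup>T\<close>.\<close>
  then have "R * R\<^sup>T = 1\<^sub>m n" using isometry_square(2)[OF R iso] by simp
  then have "D = D * R * R\<^sup>T" using D R by (simp add: mat_assoc)
  then show ?thesis using D R DR by simp
qed

lemma sum_list_concat_map:
  "(\<Sum>x\<leftarrow>concat (map h ys). f x) = (\<Sum>y\<leftarrow>ys. \<Sum>x\<leftarrow>h y. (f x :: real))"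
  by (induction ys) auto

definition products :: "real mat list \<Rightarrow> real mat list \<Rightarrow> real mat list" where
  "products Vs Ws = concat (map (\<lambda>W. map (\<lambda>V. V * W) Vs) Ws)"

lemma sum_list_products: "(\<Sum>X\<leftarrow>products Vs Ws. f X) = (\<Sum>W\<leftarrow>Ws. \<Sum>V\<leftarrow>Vs. (f (V * W) :: real))"
  by (simp add: products_def sum_list_concat_map o_def)

lemma sum_list_cong: "(\<And>x. x \<in> set xs \<Longrightarrow> f x = (h x :: real)) \<Longrightarrow> (\<Sum>x\<leftarrow>xs. f x) = (\<Sum>x\<leftarrow>xs. h x)"
  by (rule arg_cong[of _ _ sum_list]) (rule map_cong[OF refl])

lemma compression_compose:
  assumes c1: "compression g d A m B Vs" and c2: "compression g m B n C Ws"
  shows "compression g d A n C (products Vs Ws)"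
  unfolding compression_def
proof (intro conjI allI ballI)
  note V = compression_carrier[OF c1] and W = compression_carrier[OF c2]
  show "set (products Vs Ws) \<subseteq> carrier_mat d n" 
    by (auto simp: products_def intro: mult_carrier_mat[OF V W])
  have VWX: "V * W * X = V * (W * X)" if "V \<in> set Vs" "W \<in> set Ws" "dim_row X = n" for V W X
    using V[OF that(1)] W[OF that(2)] that(3) by (intro mat_assoc) auto
  fix k and X :: "real mat" assume X: "X \<in> carrier_mat n k"
  have WX: "W * X \<in> carrier_mat m k" if "W \<in> set Ws" for W using W[OF that] X by auto
  have "(\<Sum>V\<leftarrow>products Vs Ws. ip (V * X) (V * X))
      = (\<Sum>W\<leftarrow>Ws. \<Sum>V\<leftarrow>Vs. ip (V * (W * X)) (V * (W * X)))"
    unfolding sum_list_products using X by (intro sum_list_cong) (simp add: VWX)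
  also have "\<dots> \<le> (\<Sum>W\<leftarrow>Ws. ip (W * X) (W * X))"
    using c1 WX unfolding compression_def by (intro sum_list_mono) blast
  also have "\<dots> \<le> ip X X" using c2 X unfolding compression_def by blast
  finally show "(\<Sum>V\<leftarrow>products Vs Ws. ip (V * X) (V * X)) \<le> ip X X" .
  fix j and U :: "real mat" assume j: "j \<in> {1..g}" and U: "U \<in> carrier_mat n k"
  have WU: "W * U \<in> carrier_mat m k" if "W \<in> set Ws" for W using W[OF that] U by auto
  have "(\<Sum>V\<leftarrow>products Vs Ws. ip (V * U) (A j * (V * X)))
      = (\<Sum>W\<leftarrow>Ws. \<Sum>V\<leftarrow>Vs. ip (V * (W * U)) (A j * (V * (W * X))))"
    unfolding sum_list_products using X U by (intro sum_list_cong) (simp add: VWX)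
  also have "\<dots> = (\<Sum>W\<leftarrow>Ws. ip (W * U) (B j * (W * X)))"
    using c1 WX WU j unfolding compression_def by (intro sum_list_cong) blast
  also have "\<dots> = ip U (C j * X)" using c2 X U j unfolding compression_def by blast
  finally show "(\<Sum>V\<leftarrow>products Vs Ws. ip (V * U) (A j * (V * X))) = ip U (C j * X)" .
qed

text \<open>The Kadison--Schwarz inequality, with its defect.\<close>
lemma compression_schwarz:
  assumes A: "sym_tuple g d A" and B: "sym_tuple g m B" and c: "compression g d A m B Vs"
    and j: "j \<in> {1..g}" and Z: "Z \<in> carrier_mat m n"
  shows "ip (B j * Z) (B j * Z)
      + (\<Sum>V\<leftarrow>Vs. ip (A j * (V * Z) - V * (B j * Z)) (A j * (V * Z) - V * (B j * Z)))
    \<le> (\<Sum>V\<leftarrow>Vs. ip (A j * (V * Z)) (A j * (V * Z)))"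
proof -
  note V = compression_carrier[OF c] and Aj = sym_tupleD[OF A j] and Bj = sym_tupleD[OF B j]
  have BZ: "B j * Z \<in> carrier_mat m n" using Bj Z by auto
  have "(\<Sum>V\<leftarrow>Vs. ip (A j * (V * Z) - V * (B j * Z)) (A j * (V * Z) - V * (B j * Z)))
      = (\<Sum>V\<leftarrow>Vs. ip (A j * (V * Z)) (A j * (V * Z)) - 2 * ip (V * (B j * Z)) (A j * (V * Z))
        + ip (V * (B j * Z)) (V * (B j * Z)))"
  proof (rule sum_list_cong)
    fix W assume "W \<in> set Vs"
    then have W: "W \<in> carrier_mat d m" by (rule V)
    show "ip (A j * (W * Z) - W * (B j * Z)) (A j * (W * Z) - W * (B j * Z))
      = ip (A j * (W * Z)) (A j * (W * Z)) - 2 * ip (W * (B j * Z)) (A j * (W * Z))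
        + ip (W * (B j * Z)) (W * (B j * Z))"
      using W Aj Bj Z ip_commute[of "A j * (W * Z)" "W * (B j * Z)"]
      by (simp add: ip_diff_left ip_diff_right)
  qed
  also have "\<dots> = (\<Sum>V\<leftarrow>Vs. ip (A j * (V * Z)) (A j * (V * Z)))
      - 2 * (\<Sum>V\<leftarrow>Vs. ip (V * (B j * Z)) (A j * (V * Z)))
      + (\<Sum>V\<leftarrow>Vs. ip (V * (B j * Z)) (V * (B j * Z)))"
    by (simp add: sum_list_addf sum_list_subtractf sum_list_const_mult)
  \<comment> \<open>The mixed term is evaluated exactly by the equation for B; only the last square
    needs the contraction property.\<close>
  also have "(\<Sum>V\<leftarrow>Vs. ip (V * (B j * Z)) (A j * (V * Z))) = ip (B j * Z) (B j * Z)"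
    using c j Z BZ unfolding compression_def by blast
  finally show ?thesis using compression_contractive[OF c BZ] by simp
qed

lemma identity_compression:
  assumes "sym_tuple g n A"
  shows "compression g n A n A [1\<^sub>m n]"
  using assms by (auto simp: compression_def)

text \<open>A compression from a least tuple to itself that maximises \<open>\<Sum>j. tr (V\<^sup>T * (A j)\<^sup>2 * V)\<close> leaves no
  room for a defect in the Kadison--Schwarz inequality of a round trip through \<open>B\<close>.\<close>
lemma least_tuple_intertwiner:
  assumes least: "least_tuple g n A" and B: "sym_tuple g d B"
    and c1: "compression g n A d B Vs" and c2: "compression g d B n A Ws"
    and W: "W \<in> set Ws" and j: "j \<in> {1..g}"
  shows "B j * W = W * A j"
proof -
  have A: "sym_tuple g n A" using least by (simp add: least_tuple_def)
  define M where "M = mat n n (\<lambda>(i, l). \<Sum>j=1..g. (A j * A j) $$ (i, l))"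
  have M: "M \<in> carrier_mat n n" by (simp add: M_def)
  have ipM: "ip X (M * X) = (\<Sum>j=1..g. ip (A j * X) (A j * X))" if X: "X \<in> carrier_mat n n" for X
  proof -
    have "A j * A j \<in> carrier_mat n n" if "j \<in> {1..g}" for j
      using sym_tupleD(1)[OF A that] mult_carrier_mat by blast
    then have "ip X (M * X) = (\<Sum>j=1..g. ip X (A j * A j * X))"
      using X M by (intro sum_ip_mult_eq[symmetric, of _ _ n _ _ n]) (auto simp: M_def)
    also have "\<dots> = (\<Sum>j=1..g. ip (A j * X) (A j * X))"
    proof (rule sum.cong[OF refl])
      fix j assume "j \<in> {1..g}"
      from sym_tupleD[OF A this] X show "ip X (A j * A j * X) = ip (A j * X) (A j * X)"
        by (simp add: ip_mult_left mat_assoc)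
    qed
    finally show ?thesis .
  qed
  obtain Es where Es: "compression g n A n A Es"
    and max: "\<And>Fs. compression g n A n A Fs \<Longrightarrow>
      (\<Sum>E\<leftarrow>Fs. ip E (M * E)) \<le> (\<Sum>E\<leftarrow>Es. ip E (M * E))"
    using compression_max[OF A A M identity_compression[OF A]] by blast
  note E = compression_carrier[OF Es] and V = compression_carrier[OF c1] and W' = compression_carrier[OF c2]
  let ?def = "\<lambda>j W E. ip (B j * (W * E) - W * (A j * E)) (B j * (W * E) - W * (A j * E))"
  \<comment> \<open>Kadison--Schwarz is applied twice: with its defect for the maps W from B to A,
    and with the defect dropped for the maps V from A to B.\<close>
  have step: "(\<Sum>j=1..g. ip (A j * E) (A j * E)) + (\<Sum>j=1..g. \<Sum>W\<leftarrow>Ws. ?def j W E)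
      \<le> (\<Sum>W\<leftarrow>Ws. \<Sum>V\<leftarrow>Vs. ip (V * (W * E)) (M * (V * (W * E))))" if "E \<in> set Es" for E
  proof -
    have "(\<Sum>j=1..g. ip (A j * E) (A j * E)) + (\<Sum>j=1..g. \<Sum>W\<leftarrow>Ws. ?def j W E)
        \<le> (\<Sum>j=1..g. \<Sum>W\<leftarrow>Ws. ip (B j * (W * E)) (B j * (W * E)))"
      unfolding sum.distrib[symmetric] using E[OF that] by (intro sum_mono compression_schwarz[OF B A c2])
    also have "\<dots> \<le> (\<Sum>j=1..g. \<Sum>W\<leftarrow>Ws. \<Sum>V\<leftarrow>Vs. ip (A j * (V * (W * E))) (A j * (V * (W * E))))"
    proof (intro sum_mono sum_list_mono)
      fix j W assume j: "j \<in> {1..g}" and "W \<in> set Ws"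
      then have "W * E \<in> carrier_mat d n" using mult_carrier_mat[OF W' E[OF that]] by blast
      from compression_schwarz[OF A B c1 j this]
      show "ip (B j * (W * E)) (B j * (W * E)) \<le> (\<Sum>V\<leftarrow>Vs. ip (A j * (V * (W * E))) (A j * (V * (W * E))))"
        by (smt (verit) ip_nonneg sum_list_nonneg imageE set_map)
    qed
    also have "\<dots> = (\<Sum>W\<leftarrow>Ws. \<Sum>V\<leftarrow>Vs. \<Sum>j=1..g. ip (A j * (V * (W * E))) (A j * (V * (W * E))))"
      by (simp add: sum_list_sum_swap)
    also have "\<dots> = (\<Sum>W\<leftarrow>Ws. \<Sum>V\<leftarrow>Vs. ip (V * (W * E)) (M * (V * (W * E))))"
    proof (intro sum_list_cong)
      fix W V assume "W \<in> set Ws" "V \<in> set Vs"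
      then have "V * (W * E) \<in> carrier_mat n n" 
        using mult_carrier_mat[OF V mult_carrier_mat[OF W' E[OF that]]] by blast
      then show "(\<Sum>j=1..g. ip (A j * (V * (W * E))) (A j * (V * (W * E))))
          = ip (V * (W * E)) (M * (V * (W * E)))" by (simp add: ipM)
    qed
    finally show ?thesis .
  qed
  let ?Fs = "products Vs (products Ws Es)"
  have "(\<Sum>E\<leftarrow>Es. ip E (M * E)) + (\<Sum>E\<leftarrow>Es. \<Sum>j=1..g. \<Sum>W\<leftarrow>Ws. ?def j W E)
      = (\<Sum>E\<leftarrow>Es. (\<Sum>j=1..g. ip (A j * E) (A j * E)) + (\<Sum>j=1..g. \<Sum>W\<leftarrow>Ws. ?def j W E))"
    unfolding sum_list_addf[symmetric] using E by (intro sum_list_cong) (simp add: ipM)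
  also have "\<dots> \<le> (\<Sum>E\<leftarrow>Es. \<Sum>W\<leftarrow>Ws. \<Sum>V\<leftarrow>Vs. ip (V * (W * E)) (M * (V * (W * E))))"
    using step by (rule sum_list_mono)
  also have "\<dots> = (\<Sum>E\<leftarrow>?Fs. ip E (M * E))" by (simp add: sum_list_products)
  also have "\<dots> \<le> (\<Sum>E\<leftarrow>Es. ip E (M * E))"
    \<comment> \<open>The round trip combined with \<open>Es\<close> is again a compression of A to
      itself, so maximality of \<open>Es\<close> forces the total defect to be at most 0.\<close>
    using compression_compose[OF c1 compression_compose[OF c2 Es]] by (rule max)
  finally have "(\<Sum>E\<leftarrow>Es. \<Sum>j=1..g. \<Sum>W\<leftarrow>Ws. ?def j W E) \<le> 0" by simp
  moreover have nn: "0 \<le> (\<Sum>W\<leftarrow>Ws. ?def j W E)" for j E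
    by (intro sum_list_nonneg) (auto simp: ip_nonneg)
  then have nn': "0 \<le> (\<Sum>j=1..g. \<Sum>W\<leftarrow>Ws. ?def j W E)" for E by (rule sum_nonneg)
  moreover have "0 \<le> (\<Sum>E\<leftarrow>Es. \<Sum>j=1..g. \<Sum>W\<leftarrow>Ws. ?def j W E)"
    using nn' by (intro sum_list_nonneg) auto
  ultimately have "(\<Sum>E\<leftarrow>Es. \<Sum>j=1..g. \<Sum>W\<leftarrow>Ws. ?def j W E) = 0" by linarith
  then have "(\<Sum>j=1..g. \<Sum>W\<leftarrow>Ws. ?def j W E) = 0" if "E \<in> set Es" for E
    using nn' that by (subst (asm) sum_list_nonneg_eq_0_iff) auto
  then have "(\<Sum>W\<leftarrow>Ws. ?def j W E) = 0" if "E \<in> set Es" for E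
    using nn that j by (subst (asm) sum_nonneg_eq_0_iff) auto
  then have zero: "?def j W E = 0" if "E \<in> set Es" for E
    using that W by (subst (asm) sum_list_nonneg_eq_0_iff) (auto simp: ip_nonneg)
  note Wc = W'[OF W] and Aj = sym_tupleD[OF A j] and Bj = sym_tupleD[OF B j]
  have D: "B j * W - W * A j \<in> carrier_mat d n" using Wc Aj Bj by auto
  \<comment> \<open>So far the intertwining relation holds only after multiplication by the Kraus
    operators of \<open>Es\<close>; leastness cancels them.\<close>
  have "B j * W - W * A j = 0\<^sub>m d n"
  proof (rule least_tuple_annihilator[OF least Es D])
    fix F assume F: "F \<in> set Es"
    have "B j * (W * F) - W * (A j * F) = 0\<^sub>m d n"
      using ip_eq_0D[OF zero[OF F]] Wc Aj Bj E[OF F] by simp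
    then show "(B j * W - W * A j) * F = 0\<^sub>m d n"
      using Wc Aj Bj E[OF F] by (simp add: mat_distribs mat_assoc)
  qed
  then show ?thesis by (rule mat_diff_eq_0D) (use Wc Aj Bj in auto)
qed

section \<open>Intertwiners and partial isometries\<close>

text \<open>With g = 0 a compression carries no condition except contractivity. Maximal compressions
  to size 1 therefore solve the Rayleigh quotient problem over mixtures of vectors.\<close>

lemma vector_compression:
  assumes x: "x \<in> carrier_mat n 1" and le: "ip x x \<le> 1"
  shows "compression 0 n A 1 B [x]"
  unfolding compression_def
proof (intro conjI allI ballI)
  show "set [x] \<subseteq> carrier_mat n 1" using x by simp
  fix k and W :: "real mat" assume W: "W \<in> carrier_mat 1 k"
  have "x\<^sup>T * x = ip x x \<cdot>\<^sub>m 1\<^sub>m 1"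
  proof (rule eq_matI)
    fix i j assume "i < dim_row (ip x x \<cdot>\<^sub>m 1\<^sub>m 1)" "j < dim_col (ip x x \<cdot>\<^sub>m 1\<^sub>m 1)"
    then have ij: "i = 0" "j = 0" by auto
    have "(x\<^sup>T * x) $$ (0, 0) = (\<Sum>l<n. x\<^sup>T $$ (0, l) * x $$ (l, 0))"
      using x by (intro mult_mat_entry[of _ 1 n _ 1]) auto
    also have "\<dots> = ip x x" using x by (simp add: ip_entries[OF x])
    finally show "(x\<^sup>T * x) $$ (i, j) = (ip x x \<cdot>\<^sub>m 1\<^sub>m 1) $$ (i, j)" using ij by simp
  qed (use x in auto)
  then have "x\<^sup>T * (x * W) = ip x x \<cdot>\<^sub>m W"
    using mat_assoc[of "x\<^sup>T" x W] x W by (simp add: mat_smult)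
  then have "ip (x * W) (x * W) = ip x x * ip W W"
    using x W by (simp add: ip_mult_left ip_smult_right)
  then show "(\<Sum>V\<leftarrow>[x]. ip (V * W) (V * W)) \<le> ip W W"
    using mult_right_mono[OF le ip_nonneg[of W]] by simp
qed simp

lemma ip_scaled_normalised:
  assumes "0 < ip x x"
  shows "ip ((1 / sqrt (ip x x)) \<cdot>\<^sub>m x) ((1 / sqrt (ip x x)) \<cdot>\<^sub>m x) = 1"
  using assms by (simp add: ip_smult_left ip_smult_right)

text \<open>The largest eigenvalue, as a maximum over the compressions to a single vector.\<close>
lemma gram_eigenvector:
  fixes T :: "real mat"
  assumes T: "T \<in> carrier_mat d n" and nz: "T \<noteq> 0\<^sub>m d n"
  shows "\<exists>l>0. \<exists>e\<in>carrier_mat n 1. e \<noteq> 0\<^sub>m n 1 \<and> T\<^sup>T * (T * e) = l \<cdot>\<^sub>m e"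
proof -
  define M where "M = T\<^sup>T * T"
  have M: "M \<in> carrier_mat n n" using T by (simp add: M_def)
  have Mx: "M * x = T\<^sup>T * (T * x)" if "dim_row x = n" for x
    using T that by (simp add: M_def mat_assoc)
  have ipM: "ip x (M * y) = ip (T * x) (T * y)" if "x \<in> carrier_mat n k" "y \<in> carrier_mat n k" for x y k
    using T that by (simp add: Mx ip_mult_left)
  define B where "B = (\<lambda>j :: nat. 0\<^sub>m 0 0 :: real mat)"
  have st: "sym_tuple 0 n B" "sym_tuple 0 1 B" by (simp_all add: sym_tuple_def)
  have "compression 0 n B 1 B [0\<^sub>m n 1]" by (rule vector_compression) (auto simp: ip_zero_left)
  then obtain Vs where Vs: "compression 0 n B 1 B Vs"
    and max: "\<And>Ws. compression 0 n B 1 B Ws \<Longrightarrow>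
      (\<Sum>W\<leftarrow>Ws. ip W (M * W)) \<le> (\<Sum>V\<leftarrow>Vs. ip V (M * V))"
    using compression_max[OF st M] by blast
  note V = compression_carrier[OF Vs]
  define s where "s = (\<Sum>V\<leftarrow>Vs. ip V (M * V))"
  \<comment> \<open>A normalised vector is a competitor for the maximum s, and both sides are
    homogeneous of degree 2.\<close>
  have le: "ip x (M * x) \<le> s * ip x x" if x: "x \<in> carrier_mat n 1" for x
  proof (cases "ip x x = 0")
    case True
    then have "x = 0\<^sub>m n 1" using ip_eq_0D[of x] x by simp
    then show ?thesis by (simp add: ip_zero_left)
  next
    case False
    then have pos: "0 < ip x x" using ip_nonneg[of x] by simp
    define y where "y = (1 / sqrt (ip x x)) \<cdot>\<^sub>m x"
    have y: "y \<in> carrier_mat n 1" using x by (simp add: y_def)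
    have "ip y y = 1" unfolding y_def using pos by (rule ip_scaled_normalised)
    then have "ip y (M * y) \<le> s"
      using max[OF vector_compression[OF y]] by (simp add: s_def)
    also have "ip y (M * y) = ip x (M * x) / ip x x"
      using pos x M by (simp add: y_def mat_smult ip_smult_left ip_smult_right)
    finally show ?thesis using pos by (simp add: pos_divide_le_eq)
  qed
  obtain i k where ik: "i < d" "k < n" "T $$ (i, k) \<noteq> 0"
  proof (rule ccontr)
    assume "\<not> thesis"
    then have "T = 0\<^sub>m d n" using that T by (intro eq_matI) auto
    then show False using nz by simp
  qed
  define u where "u = mat n 1 (\<lambda>(l, _). if l = k then 1 else (0::real))"
  have u: "u \<in> carrier_mat n 1" by (simp add: u_def)
  have "(T * u) $$ (i, 0) = T $$ (i, k)"
    using mult_mat_entry[OF T u ik(1), of 0] ik by (simp add: u_def if_distrib cong: if_cong)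
  then have "T * u \<noteq> 0\<^sub>m d 1" using ik by auto
  then have "ip (T * u) (T * u) \<noteq> 0" using ip_eq_0D[of "T * u"] T u by auto
  then have "0 < ip u (M * u)" using ipM[OF u u] ip_nonneg[of "T * u"] by simp
  then have "0 < s * ip u u" using le[OF u] by simp
  then have s: "0 < s" using ip_nonneg[of u] by (simp add: zero_less_mult_iff)
  \<comment> \<open>The maximum is attained by a mixture whose squared lengths sum to at most 1. Its
    value s leaves no room for strict inequality, so each of its vectors gives equality in
    \<open>le\<close>.\<close>
  have nn: "0 \<le> s * ip V V - ip V (M * V)" if "V \<in> set Vs" for V using le[OF V[OF that]] by simp
  have "(\<Sum>V\<leftarrow>Vs. s * ip V V - ip V (M * V)) = s * (\<Sum>V\<leftarrow>Vs. ip V V) - s"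
    by (simp add: sum_list_subtractf sum_list_const_mult s_def)
  also have "\<dots> \<le> 0" using compression_trace_le[OF Vs] s by simp
  finally have "(\<Sum>V\<leftarrow>Vs. s * ip V V - ip V (M * V)) = 0"
    using nn by (intro antisym sum_list_nonneg) auto
  then have zero: "s * ip V V - ip V (M * V) = 0" if "V \<in> set Vs" for V
    using nn that by (subst (asm) sum_list_nonneg_eq_0_iff) auto
  have "\<exists>V\<in>set Vs. V \<noteq> 0\<^sub>m n 1"
  proof (rule ccontr)
    assume "\<not> ?thesis"
    then have "s = (\<Sum>V\<leftarrow>Vs. 0)"
      unfolding s_def by (intro sum_list_cong) (auto simp: ip_zero_left)
    then show False using s by simp
  qed
  then obtain e where e: "e \<in> set Vs" "e \<noteq> 0\<^sub>m n 1" by blast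
  note ec = V[OF e(1)]
  have "M * e = s \<cdot>\<^sub>m e"
  proof (rule mat_eq_by_ip)
    fix w :: "real mat" assume "w \<in> carrier_mat (dim_row (M * e)) (dim_col (M * e))"
    then have w: "w \<in> carrier_mat n 1" using M ec by simp
    \<comment> \<open>First variation at e, in direction w, of the nonnegative form with matrix s -
      M, which vanishes at e.\<close>
    have "0 \<le> (2 * (s * ip w e - ip w (M * e))) * t + (s * ip w w - ip w (M * w)) * t\<^sup>2" for t
    proof -
      have x: "e + t \<cdot>\<^sub>m w \<in> carrier_mat n 1" using ec w by simp
      have sym: "ip e (M * w) = ip w (M * e)"
        using ipM[OF ec w] ipM[OF w ec] ip_commute[of "T * e" "T * w"] ec w T by simp
      have "s * ip (e + t \<cdot>\<^sub>m w) (e + t \<cdot>\<^sub>m w) - ip (e + t \<cdot>\<^sub>m w) (M * (e + t \<cdot>\<^sub>m w))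
          = (s * ip e e - ip e (M * e)) + (2 * (s * ip w e - ip w (M * e))) * t + (s * ip w w - ip w (M * w)) * t\<^sup>2"
        using ec w M sym ip_commute[of e w]
        by (simp add: mat_distribs mat_smult ip_add_left ip_add_right ip_smult_left ip_smult_right
            algebra_simps power2_eq_square)
      then show ?thesis using le[OF x] zero[OF e(1)] by simp
    qed
    then have "2 * (s * ip w e - ip w (M * e)) = 0" by (rule linear_coeff_zero)
    then show "ip w (M * e) = ip w (s \<cdot>\<^sub>m e)" using w ec by (simp add: ip_smult_right)
  qed (use M ec in auto)
  then have "T\<^sup>T * (T * e) = s \<cdot>\<^sub>m e" using Mx ec by simp
  then show ?thesis using s ec e(2) by blast
qed

text \<open>The whole eigenspace is needed and not one eigenvector: only its projection commutes
  with every symmetric matrix that commutes with \<open>T\<^sup>T * T\<close>.\<close>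

lemma gram_eigenspace:
  fixes T :: "real mat"
  assumes T: "T \<in> carrier_mat d n" and nz: "T \<noteq> 0\<^sub>m d n"
  shows "\<exists>l s E. 0 < l \<and> 0 < s \<and> E \<in> carrier_mat n s \<and> E\<^sup>T * E = 1\<^sub>m s \<and> T\<^sup>T * (T * E) = l \<cdot>\<^sub>m E \<and>
    (\<forall>A\<in>carrier_mat n n. A\<^sup>T = A \<longrightarrow> A * (T\<^sup>T * T) = T\<^sup>T * T * A \<longrightarrow> A * (E * E\<^sup>T) = E * E\<^sup>T * A)"
proof -
  obtain l e where l: "0 < l" and e: "e \<in> carrier_mat n 1" "e \<noteq> 0\<^sub>m n 1" "T\<^sup>T * (T * e) = l \<cdot>\<^sub>m e"
    using gram_eigenvector[OF assms] by blast
  define D where "D = T\<^sup>T * T - l \<cdot>\<^sub>m 1\<^sub>m n"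
  have D: "D \<in> carrier_mat n n" by (auto simp: D_def intro!: minus_carrier_mat)
  have DX: "D * X = T\<^sup>T * (T * X) - l \<cdot>\<^sub>m X" if "dim_row X = n" for X
    using T that unfolding D_def by (simp add: mat_distribs mat_assoc mat_smult)
  obtain s E where E: "E \<in> carrier_mat n s" and iso: "E\<^sup>T * E = 1\<^sub>m s" and DE: "D * E = 0\<^sub>m n s"
    and proj: "\<And>k X. X \<in> carrier_mat n k \<Longrightarrow> D * X = 0\<^sub>m n k \<Longrightarrow> E * (E\<^sup>T * X) = X"
    using kernel_orthonormal_basis[OF D] by blast
  have "D * e = 0\<^sub>m n 1" using e DX[of e] by simp
  then have Ee: "E * (E\<^sup>T * e) = e" using proj e by blast
  have "0 < s"
  proof (rule ccontr)
    assume "\<not> 0 < s"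
    then have "E \<in> carrier_mat n 0" using E by simp
    then have "E * (E\<^sup>T * e) = 0\<^sub>m n 1" using e by (intro eq_matI) (auto simp: scalar_prod_def)
    then show False using Ee e(2) by simp
  qed
  moreover have "T\<^sup>T * (T * E) = l \<cdot>\<^sub>m E"
    by (rule mat_diff_eq_0D[of _ _ n s]) (use DE DX[of E] E T in auto)
  moreover have "A * (E * E\<^sup>T) = E * E\<^sup>T * A"
    if A: "A \<in> carrier_mat n n" "A\<^sup>T = A" and AT: "A * (T\<^sup>T * T) = T\<^sup>T * T * A" for A
  proof -
    have "D * A = A * D" using A T AT by (simp add: D_def mat_distribs mat_smult)
    then have "D * (A * E) = A * (D * E)"
      using mat_assoc[of D A E] mat_assoc[of A D E] A D E by simp
    then have "D * (A * E) = 0\<^sub>m n s" using A E DE by simp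
    then have 1: "E * (E\<^sup>T * (A * E)) = A * E" using proj[of "A * E" s] A E by simp
    have 2: "A * (E * E\<^sup>T) = E * (E\<^sup>T * (A * (E * E\<^sup>T)))"
    proof -
      have "A * (E * E\<^sup>T) = A * E * E\<^sup>T" using A E by (simp add: mat_assoc)
      also have "\<dots> = E * (E\<^sup>T * (A * E)) * E\<^sup>T" using 1 by simp
      also have "\<dots> = E * (E\<^sup>T * (A * (E * E\<^sup>T)))" using A E by (simp add: mat_assoc)
      finally show ?thesis .
    qed
    \<comment> \<open>A maps the eigenspace into itself by \<open>2\<close>; symmetry of A turns
      this into commutation with the projection.\<close>
    have "(A * (E * E\<^sup>T))\<^sup>T = (E * (E\<^sup>T * (A * (E * E\<^sup>T))))\<^sup>T" using 2 by simp
    then have "E * (E\<^sup>T * A) = E * (E\<^sup>T * (A * (E * E\<^sup>T)))"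
      using A E by (simp add: mat_transpose_mult mat_assoc)
    then show ?thesis using 2 A E by (simp add: mat_assoc)
  qed
  ultimately show ?thesis using l E iso by blast
qed

definition intertwiner :: "nat \<Rightarrow> nat \<Rightarrow> pencil \<Rightarrow> nat \<Rightarrow> pencil \<Rightarrow> real mat \<Rightarrow> bool" where
  "intertwiner g n A d B T \<longleftrightarrow> T \<in> carrier_mat d n \<and> (\<forall>j\<in>{1..g}. B j * T = T * A j)"

lemma intertwinerD:
  assumes "intertwiner g n A d B T"
  shows "T \<in> carrier_mat d n" "dim_row T = d" "dim_col T = n" "j \<in> {1..g} \<Longrightarrow> B j * T = T * A j"
  using assms by (auto simp: intertwiner_def)

text \<open>Symmetry of the coefficients closes intertwiners under transposition, so
  \<open>T\<^sup>T * T\<close> commutes with the tuple A.\<close>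

lemma intertwiner_transpose:
  assumes A: "sym_tuple g n A" and B: "sym_tuple g d B" and T: "intertwiner g n A d B T"
  shows "intertwiner g d B n A (T\<^sup>T)"
  unfolding intertwiner_def
proof (intro conjI ballI)
  fix j assume j: "j \<in> {1..g}"
  have "(B j * T)\<^sup>T = (T * A j)\<^sup>T" using intertwinerD(4)[OF T j] by simp
  then show "A j * T\<^sup>T = T\<^sup>T * B j"
    using sym_tupleD[OF A j] sym_tupleD[OF B j] intertwinerD[OF T] by (simp add: mat_transpose_mult)
qed (use intertwinerD[OF T] in auto)

lemma intertwiner_mult:
  assumes A: "sym_tuple g n A" and B: "sym_tuple g d B" and C: "sym_tuple g m C"
    and T: "intertwiner g n A d B T" and S: "intertwiner g d B m C S"
  shows "intertwiner g n A m C (S * T)"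
  unfolding intertwiner_def
proof (intro conjI ballI)
  show "S * T \<in> carrier_mat m n" using intertwinerD(1)[OF S] intertwinerD(1)[OF T] by simp
  fix j assume j: "j \<in> {1..g}"
  note d = sym_tupleD[OF A j] sym_tupleD[OF B j] sym_tupleD[OF C j] intertwinerD(1-3)[OF T] intertwinerD(1-3)[OF S]
  have "C j * (S * T) = C j * S * T" using d by (simp add: mat_assoc)
  also have "\<dots> = S * (B j * T)" using d intertwinerD(4)[OF S j] by (simp add: mat_assoc)
  also have "\<dots> = S * T * A j" using d intertwinerD(4)[OF T j] by (simp add: mat_assoc)
  finally show "C j * (S * T) = S * T * A j" .
qed

lemma intertwiner_one: "sym_tuple g n A \<Longrightarrow> intertwiner g n A n A (1\<^sub>m n)"
  by (auto simp: intertwiner_def dest: sym_tupleD)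

lemma intertwiner_diff:
  assumes A: "sym_tuple g n A" and B: "sym_tuple g d B"
    and T: "intertwiner g n A d B T" and S: "intertwiner g n A d B S"
  shows "intertwiner g n A d B (S - T)"
  unfolding intertwiner_def
proof (intro conjI ballI)
  show "S - T \<in> carrier_mat d n" using intertwinerD(1)[OF T] by (rule minus_carrier_mat)
  fix j assume j: "j \<in> {1..g}"
  show "B j * (S - T) = (S - T) * A j"
    using sym_tupleD[OF A j] sym_tupleD[OF B j] intertwinerD[OF T] intertwinerD[OF S] j
    by (simp add: mat_distribs)
qed

lemma intertwiner_add_smult:
  assumes A: "sym_tuple g n A" and B: "sym_tuple g d B"
    and T: "intertwiner g n A d B T" and S: "intertwiner g n A d B S"
  shows "intertwiner g n A d B (S + c \<cdot>\<^sub>m T)"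
  unfolding intertwiner_def
proof (intro conjI ballI)
  show "S + c \<cdot>\<^sub>m T \<in> carrier_mat d n" using intertwinerD(1)[OF T] by simp
  fix j assume j: "j \<in> {1..g}"
  show "B j * (S + c \<cdot>\<^sub>m T) = (S + c \<cdot>\<^sub>m T) * A j"
    using sym_tupleD[OF A j] sym_tupleD[OF B j] intertwinerD[OF T] intertwinerD[OF S] j
    by (simp add: mat_distribs mat_smult)
qed

text \<open>On an eigenspace of \<open>T\<^sup>T * T\<close> the matrix T is a multiple of an
  isometry. Its normalisation Y has initial and final spaces orthogonal to those of Z by
  \<open>orth\<close>, so Z + Y is a partial isometry, and it intertwines because the spectral
  projection commutes with A.\<close>

lemma extend_partial_isometry:
  assumes A: "sym_tuple g n A" and B: "sym_tuple g d B"
    and Z: "intertwiner g n A d B Z" and pi: "Z * (Z\<^sup>T * Z) = Z"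
    and T: "intertwiner g n A d B T" and nz: "T \<noteq> 0\<^sub>m d n"
    and orth: "Z\<^sup>T * T = 0\<^sub>m n n" "T * Z\<^sup>T = 0\<^sub>m d d"
  shows "\<exists>Z' s. 0 < s \<and> intertwiner g n A d B Z' \<and> Z' * (Z'\<^sup>T * Z') = Z' \<and>
    ip Z' Z' = ip Z Z + real s"
proof -
  note Zc = intertwinerD(1-3)[OF Z] and Tc = intertwinerD(1-3)[OF T]
  obtain l s E where l: "0 < l" and s: "0 < s" and E: "E \<in> carrier_mat n s"
    and iso: "E\<^sup>T * E = 1\<^sub>m s" and eig: "T\<^sup>T * (T * E) = l \<cdot>\<^sub>m E"
    and commute: "\<forall>A\<in>carrier_mat n n. A\<^sup>T = A \<longrightarrow> A * (T\<^sup>T * T) = T\<^sup>T * T * A \<longrightarrow>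
      A * (E * E\<^sup>T) = E * E\<^sup>T * A"
    using gram_eigenspace[OF Tc(1) nz] by blast
  define P where "P = E * E\<^sup>T"
  have P: "P \<in> carrier_mat n n" "dim_row P = n" "dim_col P = n" using E by (auto simp: P_def)
  have Psym: "P\<^sup>T = P" using E by (simp add: P_def mat_transpose_mult)
  have "E * (E\<^sup>T * E) * E\<^sup>T = P" using E iso by (simp add: P_def)
  then have PP: "P * P = P" using E by (simp add: P_def mat_assoc)
  have GP: "T\<^sup>T * (T * P) = l \<cdot>\<^sub>m P"
  proof -
    have "T\<^sup>T * (T * P) = T\<^sup>T * (T * E) * E\<^sup>T" using Tc E by (simp add: P_def mat_assoc)
    then show ?thesis using E by (simp add: eig P_def mat_smult)
  qed
  have interP: "intertwiner g n A n A P"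
    unfolding intertwiner_def
  proof (intro conjI ballI)
    fix j assume j: "j \<in> {1..g}"
    have "intertwiner g n A n A (T\<^sup>T * T)"
      using intertwiner_mult[OF A B A T intertwiner_transpose[OF A B T]] .
    then show "A j * P = P * A j"
      using commute sym_tupleD(1,2)[OF A j] j unfolding P_def intertwiner_def by blast
  qed (rule P(1))
  \<comment> \<open>l P is \<open>T\<^sup>T * T * P\<close>, so orthogonality of Z and T carries
    over to Z and P.\<close>
  have lPZ: "l \<cdot>\<^sub>m (Z * P) = 0\<^sub>m d n"
  proof -
    have "Z * T\<^sup>T = (T * Z\<^sup>T)\<^sup>T" using Zc Tc by (simp add: mat_transpose_mult)
    then have "Z * T\<^sup>T = 0\<^sub>m d d" using orth by simp
    then have "Z * (T\<^sup>T * (T * P)) = 0\<^sub>m d n"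
      using mat_assoc[of Z "T\<^sup>T" "T * P"] Zc Tc P by simp
    then show ?thesis using GP Zc P by (simp add: mat_smult)
  qed
  have ZP: "Z * P = 0\<^sub>m d n"
  proof (rule eq_matI)
    fix i k assume ik: "i < dim_row (0\<^sub>m d n :: real mat)" "k < dim_col (0\<^sub>m d n :: real mat)"
    then have "(l \<cdot>\<^sub>m (Z * P)) $$ (i, k) = 0" using lPZ by simp
    moreover have "(l \<cdot>\<^sub>m (Z * P)) $$ (i, k) = l * (Z * P) $$ (i, k)"
      using ik Zc P by (intro index_smult_mat(1)) auto
    ultimately show "(Z * P) $$ (i, k) = (0\<^sub>m d n :: real mat) $$ (i, k)" using l ik by simp
  qed (use Zc P in auto)
  define c where "c = 1 / sqrt l"
  have c: "c * (c * l) = 1" using l by (simp add: c_def)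
  define Y where "Y = c \<cdot>\<^sub>m (T * P)"
  have Y: "Y \<in> carrier_mat d n" "dim_row Y = d" "dim_col Y = n" using Tc P by (auto simp: Y_def)
  have YP: "Y * P = Y" using Tc P PP by (simp add: Y_def mat_smult mat_assoc)
  have YY: "Y\<^sup>T * Y = P"
  proof -
    have "Y\<^sup>T * Y = c \<cdot>\<^sub>m (c \<cdot>\<^sub>m (P * (T\<^sup>T * (T * P))))"
      using Tc P Psym by (simp add: Y_def mat_smult mat_transpose_linear mat_transpose_mult mat_assoc)
    also have "\<dots> = (c * (c * l)) \<cdot>\<^sub>m P"
      unfolding GP using P PP by (auto simp: mat_smult intro!: eq_matI)
    also have "\<dots> = P" using c by (auto intro!: eq_matI)
    finally show ?thesis .
  qed
  have ZY: "Z\<^sup>T * Y = 0\<^sub>m n n"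
  proof -
    have "Z\<^sup>T * Y = c \<cdot>\<^sub>m (Z\<^sup>T * T * P)" using Zc Tc P by (simp add: Y_def mat_smult mat_assoc)
    then show ?thesis using P by (simp add: orth)
  qed
  have "(Z\<^sup>T * Y)\<^sup>T = 0\<^sub>m n n" by (simp add: ZY)
  then have YZ: "Y\<^sup>T * Z = 0\<^sub>m n n" using Zc Y by (simp add: mat_transpose_mult)
  have "(Z * P)\<^sup>T * Z = 0\<^sub>m n n" unfolding ZP using Zc by simp
  then have PZZ: "P * (Z\<^sup>T * Z) = 0\<^sub>m n n" using Zc P Psym by (simp add: mat_transpose_mult mat_assoc)
  have YZZ: "Y * (Z\<^sup>T * Z) = 0\<^sub>m d n"
    using mat_assoc[of Y P "Z\<^sup>T * Z"] YP Y P Zc PZZ by simp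
  define Z' where "Z' = Z + Y"
  have Z'c: "Z' \<in> carrier_mat d n" using Zc Y by (simp add: Z'_def)
  have gram: "Z'\<^sup>T * Z' = Z\<^sup>T * Z + P"
    using Zc Y P YY YZ ZY by (simp add: Z'_def mat_transpose_linear mat_distribs)
  have "Z' * (Z'\<^sup>T * Z') = Z'"
    unfolding gram using Zc Y P pi ZP YZZ YP by (simp add: Z'_def mat_distribs)
  moreover have "intertwiner g n A d B Z'"
    unfolding Z'_def Y_def
    using intertwiner_add_smult[OF A B intertwiner_mult[OF A A B interP T] Z] .
  \<comment> \<open>The squared norm of a partial isometry is its rank; it grows by the trace of P,
    the dimension s of the eigenspace.\<close>
  moreover have "ip Z' Z' = ip Z Z + real s"
  proof -
    have gr: "ip X X = ip (1\<^sub>m n) (X\<^sup>T * X)" if "X \<in> carrier_mat k n" for X k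
    proof -
      have "ip (X * 1\<^sub>m n) X = ip (1\<^sub>m n) (X\<^sup>T * X)" using that by (intro ip_mult_left) auto
      then show ?thesis using that by simp
    qed
    have "ip (1\<^sub>m n) P = ip (E\<^sup>T) (E\<^sup>T)" using gr[of "E\<^sup>T" s] E by (simp add: P_def)
    also have "\<dots> = ip (1\<^sub>m s) (E\<^sup>T * E)"
    proof -
      have "ip (E * 1\<^sub>m s) E = ip (1\<^sub>m s) (E\<^sup>T * E)" using E by (intro ip_mult_left) auto
      then show ?thesis using E ip_transpose[of E E] by simp
    qed
    also have "\<dots> = real s" by (simp add: iso ip_one)
    finally have "ip (1\<^sub>m n) P = real s" .
    then show ?thesis using gr[OF Z'c] gr[OF Zc(1)] Zc P by (simp add: gram ip_add_right)
  qed
  ultimately show ?thesis using s by blast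
qed

text \<open>\<open>Z\<^sup>T * Z\<close> is a projection, and n minus the squared norm of Z is the
  squared norm of its complement.\<close>

lemma partial_isometry_norm_le:
  fixes Z :: "real mat"
  assumes Z: "Z \<in> carrier_mat d n" and pi: "Z * (Z\<^sup>T * Z) = Z"
  shows "ip Z Z \<le> real n"
proof -
  define Q where "Q = Z\<^sup>T * Z"
  have Q: "Q \<in> carrier_mat n n" "dim_row Q = n" "dim_col Q = n" using Z by (auto simp: Q_def)
  have "ip (Z * 1\<^sub>m n) Z = ip (1\<^sub>m n) Q" unfolding Q_def using Z by (intro ip_mult_left) auto
  then have 1: "ip (1\<^sub>m n) Q = ip Z Z" using Z by simp
  have "ip Q Q = ip Z (Z * Q)"
    unfolding Q_def using Z ip_mult_left[of Z "Z\<^sup>T" "Z\<^sup>T * Z"] by simp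
  then have 2: "ip Q Q = ip Z Z" using pi by (simp add: Q_def)
  have "0 \<le> ip (1\<^sub>m n - Q) (1\<^sub>m n - Q)" by (rule ip_nonneg)
  also have "\<dots> = real n - ip Z Z"
    using Q 1 2 ip_commute[of "1\<^sub>m n" Q] by (simp add: ip_diff_left ip_diff_right ip_one)
  finally show ?thesis by simp
qed

text \<open>The displayed corner of an intertwiner T is again an intertwiner and is orthogonal to Z
  on both sides; if it were nonzero it would extend Z. Its vanishing says that every intertwiner
  maps the kernel of Z into the range of Z.\<close>

lemma maximal_partial_isometry:
  assumes A: "sym_tuple g n A" and B: "sym_tuple g d B"
  shows "\<exists>Z. intertwiner g n A d B Z \<and> Z * (Z\<^sup>T * Z) = Z \<and>
    (\<forall>T. intertwiner g n A d B T \<longrightarrow>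
      (1\<^sub>m d - Z * Z\<^sup>T) * (T * (1\<^sub>m n - Z\<^sup>T * Z)) = 0\<^sub>m d n)"
proof -
  define P where "P = (\<lambda>r. \<exists>Z. intertwiner g n A d B Z \<and> Z * (Z\<^sup>T * Z) = Z \<and> ip Z Z = real r)"
  have "intertwiner g n A d B (0\<^sub>m d n)"
    using sym_tupleD[OF A] sym_tupleD[OF B] by (auto simp: intertwiner_def)
  then have "P 0" unfolding P_def by (intro exI[of _ "0\<^sub>m d n"]) (simp add: ip_zero_left)
  moreover have "\<forall>r. P r \<longrightarrow> r \<le> n"
  proof (intro allI impI)
    fix r assume "P r"
    then obtain Z where "Z \<in> carrier_mat d n" "Z * (Z\<^sup>T * Z) = Z" "ip Z Z = real r"
      unfolding P_def using intertwinerD(1) by blast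
    then show "r \<le> n" using partial_isometry_norm_le[of Z d n] by simp
  qed
  ultimately obtain r\<^sub>0 where "P r\<^sub>0" and max: "\<And>r. P r \<Longrightarrow> r \<le> r\<^sub>0"
    using GreatestI_nat[of P 0 n] Greatest_le_nat[of P _ n] by blast
  then obtain Z where Z: "intertwiner g n A d B Z" and pi: "Z * (Z\<^sup>T * Z) = Z"
    and r: "ip Z Z = real r\<^sub>0" unfolding P_def by blast
  note Zc = intertwinerD(1-3)[OF Z]
  have pi': "Z\<^sup>T * (Z * Z\<^sup>T) = Z\<^sup>T"
    using arg_cong[OF pi, of transpose_mat] Zc by (simp add: mat_transpose_mult mat_assoc)
  have "(1\<^sub>m d - Z * Z\<^sup>T) * (T * (1\<^sub>m n - Z\<^sup>T * Z)) = 0\<^sub>m d n" if T: "intertwiner g n A d B T" for T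
  proof (rule ccontr)
    let ?T = "(1\<^sub>m d - Z * Z\<^sup>T) * (T * (1\<^sub>m n - Z\<^sup>T * Z))"
    assume nz: "?T \<noteq> 0\<^sub>m d n"
    note Tc = intertwinerD(1-3)[OF T]
    note Zt = intertwiner_transpose[OF A B Z]
    have T': "intertwiner g n A d B ?T"
      using intertwiner_mult[OF A B B
          intertwiner_mult[OF A A B
            intertwiner_diff[OF A A intertwiner_mult[OF A B A Z Zt] intertwiner_one[OF A]] T]
          intertwiner_diff[OF B B intertwiner_mult[OF B A B Zt Z] intertwiner_one[OF B]]] .
    have "Z\<^sup>T * (1\<^sub>m d - Z * Z\<^sup>T) = 0\<^sub>m n d"
      using Zc pi' by (simp add: mat_distribs)
    then have "Z\<^sup>T * ?T = 0\<^sub>m n n"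
      using mat_assoc[of "Z\<^sup>T" "1\<^sub>m d - Z * Z\<^sup>T" "T * (1\<^sub>m n - Z\<^sup>T * Z)"] Zc Tc by simp
    moreover have "(1\<^sub>m n - Z\<^sup>T * Z) * Z\<^sup>T = 0\<^sub>m n d"
      using Zc pi' by (simp add: mat_distribs mat_assoc)
    then have "?T * Z\<^sup>T = 0\<^sub>m d d"
      using Zc Tc by (simp add: mat_assoc)
    ultimately obtain Z' s where "0 < s" "intertwiner g n A d B Z'" "Z' * (Z'\<^sup>T * Z') = Z'"
      "ip Z' Z' = ip Z Z + real s"
      using extend_partial_isometry[OF A B Z pi T' nz] by blast
    then have "P (r\<^sub>0 + s)" unfolding P_def using r by auto
    then show False using max \<open>0 < s\<close> by force
  qed
  then show ?thesis using Z pi by blast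
qed

text \<open>If the maximal partial isometry \<open>Z\<close> were not injective, the operators \<open>Z\<^sup>T * Z\<close> and
  \<open>Z\<^sup>T * W * (1 - Z\<^sup>T * Z)\<close> would compress the least tuple to itself through a proper subspace.\<close>
lemma least_tuple_embeds:
  assumes least: "least_tuple g n A" and B: "sym_tuple g d B"
    and c1: "compression g n A d B Vs" and c2: "compression g d B n A Ws"
  shows "\<exists>Z. intertwiner g n A d B Z \<and> Z\<^sup>T * Z = 1\<^sub>m n"
proof -
  have A: "sym_tuple g n A" using least by (simp add: least_tuple_def)
  note Wc = compression_carrier[OF c2]
  have W: "intertwiner g n A d B W" if "W \<in> set Ws" for W
    using least_tuple_intertwiner[OF least B c1 c2 that] Wc[OF that] by (simp add: intertwiner_def)
  obtain Z where Z: "intertwiner g n A d B Z" and pi: "Z * (Z\<^sup>T * Z) = Z"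
    and max: "\<And>T. intertwiner g n A d B T \<Longrightarrow>
      (1\<^sub>m d - Z * Z\<^sup>T) * (T * (1\<^sub>m n - Z\<^sup>T * Z)) = 0\<^sub>m d n"
    using maximal_partial_isometry[OF A B] by blast
  note Zc = intertwinerD(1-3)[OF Z]
  define Q where "Q = Z\<^sup>T * Z"
  define P where "P = 1\<^sub>m n - Q"
  have Q: "Q \<in> carrier_mat n n" "dim_row Q = n" "dim_col Q = n" using Zc by (auto simp: Q_def)
  have P: "P \<in> carrier_mat n n" "dim_row P = n" "dim_col P = n"
    using Q minus_carrier_mat[OF Q(1)] by (auto simp: P_def)
  have Qsym: "Q\<^sup>T = Q" and QQ: "Q * Q = Q"
    using Zc pi by (auto simp: Q_def mat_transpose_mult mat_assoc)
  have Psym: "P\<^sup>T = P" and PP: "P * P = P"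
    using Q Qsym QQ by (auto simp: P_def mat_transpose_linear mat_distribs)
  have interQ: "intertwiner g n A n A Q"
    unfolding Q_def using intertwiner_mult[OF A B A Z intertwiner_transpose[OF A B Z]] .
  have interP: "intertwiner g n A n A P"
    unfolding P_def using intertwiner_diff[OF A A interQ intertwiner_one[OF A]] .
  have PQ: "P * Q = 0\<^sub>m n n" using Q QQ by (simp add: P_def mat_distribs)
  have "(Z * Q)\<^sup>T = Z\<^sup>T" using pi by (simp add: Q_def)
  then have "Q * Z\<^sup>T = Z\<^sup>T" using Zc Q Qsym by (simp add: mat_transpose_mult)
  then have PZ: "P * Z\<^sup>T = 0\<^sub>m n d" using Q Zc by (simp add: P_def mat_distribs)
  \<comment> \<open>By maximality of Z each W sends the range of P, the kernel of Z, into the range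
    of Z, where \<open>Z * Z\<^sup>T\<close> acts as the identity.\<close>
  have ZZ: "Z * (Z\<^sup>T * (W * (P * X))) = W * (P * X)" if "W \<in> set Ws" "dim_row X = n" for W X
  proof -
    have "(1\<^sub>m d - Z * Z\<^sup>T) * (W * P) = 0\<^sub>m d n"
      using max[OF W[OF that(1)]] by (simp add: P_def Q_def)
    then have "W * P - Z * (Z\<^sup>T * (W * P)) = 0\<^sub>m d n"
      using Wc[OF that(1)] P Zc by (simp add: mat_distribs mat_assoc)
    then have "W * P = Z * (Z\<^sup>T * (W * P))"
      by (rule mat_diff_eq_0D) (use Wc[OF that(1)] P Zc in auto)
    then have "W * P * X = Z * (Z\<^sup>T * (W * P)) * X" by simp
    then show ?thesis using Wc[OF that(1)] P Zc that(2) by (simp add: mat_assoc)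
  qed
  \<comment> \<open>On the range of Q nothing changes; on that of P the path through B is brought
    back by \<open>Z\<^sup>T\<close> without loss, by \<open>ZZ\<close>. Since P and Q commute with
    A, the two contributions add up to A, yet every operator in \<open>Fs\<close> has its range in
    that of Q.\<close>
  define Fs where "Fs = Q # map (\<lambda>W. Z\<^sup>T * (W * P)) Ws"
  have Fs: "compression g n A n A Fs"
    unfolding compression_def
  proof (intro conjI allI ballI)
    have "Z\<^sup>T * (W * P) \<in> carrier_mat n n" if "W \<in> set Ws" for W
      using Zc mult_carrier_mat[OF Wc[OF that] P(1)] by simp
    then show "set Fs \<subseteq> carrier_mat n n" using Q by (auto simp: Fs_def)
  next
    fix k and X :: "real mat" assume X: "X \<in> carrier_mat n k"
    have PX: "P * X \<in> carrier_mat n k" using P X by simp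
    have "(\<Sum>V\<leftarrow>Fs. ip (V * X) (V * X)) = ip (Q * X) (Q * X) + (\<Sum>W\<leftarrow>Ws. ip (W * (P * X)) (W * (P * X)))"
      unfolding Fs_def list.map sum_list.Cons map_map o_def
    proof (intro arg_cong2[of _ _ _ _ "(+)"] refl sum_list_cong)
      fix W assume "W \<in> set Ws"
      then show "ip (Z\<^sup>T * (W * P) * X) (Z\<^sup>T * (W * P) * X) = ip (W * (P * X)) (W * (P * X))"
        using Zc Wc[of W] P X ZZ[of W X]
        by (simp add: mat_assoc ip_mult_left[of _ "Z\<^sup>T"])
    qed
    also have "\<dots> \<le> ip (Q * X) (Q * X) + ip (P * X) (P * X)"
      using compression_contractive[OF c2 PX] by simp
    also have "ip (Q * X) (Q * X) = ip X (Q * X)"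
      using Q Qsym QQ X mat_assoc[of Q Q X] by (simp add: ip_mult_left)
    also have "ip (P * X) (P * X) = ip X (P * X)"
      using P Psym PP X mat_assoc[of P P X] by (simp add: ip_mult_left)
    also have "ip X (Q * X) + ip X (P * X) = ip X X"
      using Q X by (simp add: P_def mat_distribs ip_diff_right)
    finally show "(\<Sum>V\<leftarrow>Fs. ip (V * X) (V * X)) \<le> ip X X" .
  next
    fix j k and U X :: "real mat"
    assume j: "j \<in> {1..g}" and U: "U \<in> carrier_mat n k" and X: "X \<in> carrier_mat n k"
    note Aj = sym_tupleD[OF A j] and Bj = sym_tupleD[OF B j]
    have PX: "P * X \<in> carrier_mat n k" and PU: "P * U \<in> carrier_mat n k" using P X U by auto
    have AZ: "A j * Z\<^sup>T = Z\<^sup>T * B j" using intertwinerD(4)[OF intertwiner_transpose[OF A B Z] j] .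
    have AZ': "A j * (Z\<^sup>T * Y) = Z\<^sup>T * (B j * Y)" if "dim_row Y = d" for Y
      using that AZ Zc Aj Bj mat_assoc[of "A j" "Z\<^sup>T" Y] mat_assoc[of "Z\<^sup>T" "B j" Y] by simp
    have proj: "ip (R * U) (A j * (R * X)) = ip U (A j * (R * X))"
      if R: "intertwiner g n A n A R" "R\<^sup>T = R" "R * R = R" for R
    proof -
      note Rc = intertwinerD(1-3)[OF R(1)]
      have "R * (A j * (R * X)) = R * A j * (R * X)" using Rc Aj X by (simp add: mat_assoc)
      also have "\<dots> = A j * (R * R * X)"
        using intertwinerD(4)[OF R(1) j, symmetric] Rc Aj X by (simp add: mat_assoc)
      finally have "R * (A j * (R * X)) = A j * (R * X)" using R(3) by simp
      then show ?thesis using Rc Aj U X R(2) by (simp add: ip_mult_left)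
    qed
    have "(\<Sum>V\<leftarrow>Fs. ip (V * U) (A j * (V * X)))
        = ip (Q * U) (A j * (Q * X)) + (\<Sum>W\<leftarrow>Ws. ip (W * (P * U)) (B j * (W * (P * X))))"
      unfolding Fs_def list.map sum_list.Cons map_map o_def
    proof (intro arg_cong2[of _ _ _ _ "(+)"] refl sum_list_cong)
      fix W assume W: "W \<in> set Ws"
      have "ip (Z\<^sup>T * (W * P) * U) (A j * (Z\<^sup>T * (W * P) * X))
          = ip (Z\<^sup>T * (W * (P * U))) (Z\<^sup>T * (B j * (W * (P * X))))"
        using Zc Wc[OF W] P X U AZ'[of "W * (P * X)"] by (simp add: mat_assoc)
      also have "\<dots> = ip (Z * (Z\<^sup>T * (W * (P * U)))) (B j * (W * (P * X)))"
        using Zc Wc[OF W] P X U Bj by (subst ip_mult_left[of _ Z]) auto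
      finally show "ip (Z\<^sup>T * (W * P) * U) (A j * (Z\<^sup>T * (W * P) * X))
          = ip (W * (P * U)) (B j * (W * (P * X)))"
        using ZZ[OF W, of U] U by simp
    qed
    also have "(\<Sum>W\<leftarrow>Ws. ip (W * (P * U)) (B j * (W * (P * X)))) = ip (P * U) (A j * (P * X))"
      using c2 j PX PU unfolding compression_def by blast
    also have "\<dots> = ip U (A j * (P * X))" using proj[OF interP Psym PP] .
    also have "ip (Q * U) (A j * (Q * X)) = ip U (A j * (Q * X))" using proj[OF interQ Qsym QQ] .
    also have "ip U (A j * (Q * X)) + ip U (A j * (P * X)) = ip U (A j * X)"
      using Q X U Aj by (simp add: P_def mat_distribs ip_diff_right)
    finally show "(\<Sum>V\<leftarrow>Fs. ip (V * U) (A j * (V * X))) = ip U (A j * X)" .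
  qed
  have "P = 0\<^sub>m n n"
  proof (rule least_tuple_annihilator[OF least Fs P(1)])
    fix F assume "F \<in> set Fs"
    then consider "F = Q" | W where "W \<in> set Ws" "F = Z\<^sup>T * (W * P)" by (auto simp: Fs_def)
    then show "P * F = 0\<^sub>m n n"
    proof cases
      case 1
      then show ?thesis by (simp add: PQ)
    next
      case 2
      then show ?thesis using mat_assoc[of P "Z\<^sup>T" "W * P"] Wc[OF 2(1)] P Zc PZ by simp
    qed
  qed
  then have "1\<^sub>m n = Q" unfolding P_def by (rule mat_diff_eq_0D) (use Q in auto)
  then show ?thesis using Z by (auto simp: Q_def)
qed

section \<open>Free spectrahedra and subpencils\<close>

lemma finsum_mat_entries:
  assumes "finite F" "\<And>j. j \<in> F \<Longrightarrow> f j \<in> carrier_mat p q"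
  shows "finsum (module_mat TYPE(real) p q) f F \<in> carrier_mat p q \<and>
    (\<forall>r<p. \<forall>c<q. finsum (module_mat TYPE(real) p q) f F $$ (r, c) = (\<Sum>j\<in>F. f j $$ (r, c)))"
proof -
  interpret M: abelian_group "module_mat TYPE(real) p q" by (rule abelian_group_mat)
  show ?thesis using assms
  proof (induction F rule: finite_induct)
    case empty
    then show ?case by (simp add: module_mat_simps)
  next
    case (insert x F)
    have f: "f \<in> F \<rightarrow> carrier (module_mat TYPE(real) p q)" "f x \<in> carrier (module_mat TYPE(real) p q)"
      using insert.prems by (auto simp: module_mat_simps)
    have "finsum (module_mat TYPE(real) p q) f (insert x F) = f x + finsum (module_mat TYPE(real) p q) f F"
      using M.finsum_insert[OF insert.hyps f] by (simp add: module_mat_simps)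
    moreover have "finsum (module_mat TYPE(real) p q) f F \<in> carrier_mat p q"
      "\<forall>r<p. \<forall>c<q. finsum (module_mat TYPE(real) p q) f F $$ (r, c) = (\<Sum>j\<in>F. f j $$ (r, c))"
      using insert.IH insert.prems by auto
    ultimately show ?case
      using carrier_matD[of "finsum (module_mat TYPE(real) p q) f F" p q] insert.hyps by simp
  qed
qed

lemma sum_blocks: "(\<Sum>r<d * n. f r) = (\<Sum>i<d. \<Sum>k<n. f (i * n + k))" for f :: "nat \<Rightarrow> real"
proof -
  have block: "sum f {i * n..<i * n + n} = (\<Sum>k<n. f (i * n + k))" for i
    using sum.atLeastLessThan_shift_0[of f "i * n" "i * n + n"] by (simp add: atLeast0LessThan)
  have "(\<Sum>r<d * n. f r) = (\<Sum>i<d. sum f {i * n..<i * n + n})" by (rule sum.nat_group[symmetric])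
  then show ?thesis by (simp only: block)
qed

lemma kron_carrier:
  "A \<in> carrier_mat d d \<Longrightarrow> X \<in> carrier_mat n n \<Longrightarrow> A \<otimes>\<^sub>K X \<in> carrier_mat (d * n) (d * n)"
  by (auto simp: kron_def)

text \<open>Under the indexing \<open>i * n + k\<close> the Kronecker product acts on a d by n
  matrix W as A W \<open>X\<^sup>T\<close>; symmetry of X removes the transpose.\<close>

lemma kron_quadratic:
  assumes A: "A \<in> carrier_mat d d" and X: "X \<in> carrier_mat n n" "X\<^sup>T = X"
  shows "(\<Sum>r<d * n. \<Sum>c<d * n. (A \<otimes>\<^sub>K X) $$ (r, c) * (v r * v c))
    = ip (mat d n (\<lambda>(i, k). v (i * n + k))) (A * (mat d n (\<lambda>(i, k). v (i * n + k)) * X))"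
proof -
  define W where "W = mat d n (\<lambda>(i, k). v (i * n + k))"
  have W: "W \<in> carrier_mat d n" by (simp add: W_def)
  have WX: "W * X \<in> carrier_mat d n" using W X by simp
  have Xsym: "X $$ (p, k) = X $$ (k, p)" if "p < n" "k < n" for p k
    using X that by (metis carrier_matD index_transpose_mat(1))
  have entry: "(A \<otimes>\<^sub>K X) $$ (i * n + k, l * n + p) = A $$ (i, l) * X $$ (k, p)"
    if "i < d" "l < d" "k < n" "p < n" for i l k p
  proof -
    have "i * n + k < d * n" if "i < d" "k < n" for i k
    proof -
      have "i * n + k < Suc i * n" using that by simp
      also have "\<dots> \<le> d * n" using that by (intro mult_le_mono1) simp
      finally show ?thesis .
    qed
    then show ?thesis using A X that by (simp add: kron_def)
  qed
  have "(\<Sum>r<d * n. \<Sum>c<d * n. (A \<otimes>\<^sub>K X) $$ (r, c) * (v r * v c))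
      = (\<Sum>i<d. \<Sum>k<n. \<Sum>l<d. \<Sum>p<n. (A $$ (i, l) * X $$ (k, p)) * (W $$ (i, k) * W $$ (l, p)))"
    unfolding sum_blocks by (intro sum.cong refl) (simp add: entry W_def)
  also have "\<dots> = (\<Sum>i<d. \<Sum>l<d. \<Sum>k<n. \<Sum>p<n. (A $$ (i, l) * X $$ (k, p)) * (W $$ (i, k) * W $$ (l, p)))"
    by (intro sum.cong refl sum.swap)
  also have "\<dots> = (\<Sum>i<d. \<Sum>l<d. A $$ (i, l) * (\<Sum>k<n. W $$ (i, k) * (W * X) $$ (l, k)))"
  proof (intro sum.cong refl)
    fix i l assume il: "i \<in> {..<d}" "l \<in> {..<d}"
    have "(W * X) $$ (l, k) = (\<Sum>p<n. W $$ (l, p) * X $$ (k, p))" if "k < n" for k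
      using mult_mat_entry[OF W X(1)] il that Xsym by simp
    then show "(\<Sum>k<n. \<Sum>p<n. (A $$ (i, l) * X $$ (k, p)) * (W $$ (i, k) * W $$ (l, p)))
        = A $$ (i, l) * (\<Sum>k<n. W $$ (i, k) * (W * X) $$ (l, k))"
      by (simp add: sum_distrib_left algebra_simps del: index_mult_mat(1))
  qed
  also have "\<dots> = ip W (A * (W * X))" by (rule ip_mult_expand[OF W A WX, symmetric])
  finally show ?thesis by (simp add: W_def)
qed

lemma kron_symmetric:
  assumes "A \<in> sym_mats d" "X \<in> sym_mats n" "r < d * n" "c < d * n"
  shows "(A \<otimes>\<^sub>K X) $$ (r, c) = (A \<otimes>\<^sub>K X) $$ (c, r)"
proof -
  have n: "0 < n" using assms(3) by (cases n) auto
  then have *: "r div n < d" "c div n < d" "r mod n < n" "c mod n < n"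
    using assms(3,4) by (auto simp: less_mult_imp_div_less)
  have "A $$ (c div n, r div n) = A $$ (r div n, c div n)"
    using sym_matsD[OF assms(1)] * by (metis index_transpose_mat(1))
  moreover have "X $$ (c mod n, r mod n) = X $$ (r mod n, c mod n)"
    using sym_matsD[OF assms(2)] * by (metis index_transpose_mat(1))
  ultimately show ?thesis using assms sym_matsD[OF assms(1)] sym_matsD[OF assms(2)] by (simp add: kron_def)
qed

lemma scalar_prod_quadratic:
  assumes "v \<in> carrier_vec N" "M \<in> carrier_mat N N"
  shows "v \<bullet> (M *\<^sub>v v) = (\<Sum>r<N. \<Sum>c<N. M $$ (r, c) * (v $ r * (v $ c :: real)))"
  using assms
  by (auto simp: scalar_prod_def atLeast0LessThan sum_distrib_left algebra_simps intro!: sum.cong)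

lemma psd_pencil_eval_iff:
  assumes L: "monic_pencil g d A" and X: "sym_tuple g n X"
  shows "psd (pencil_eval g d A n X) \<longleftrightarrow> lmi g d A n X"
proof -
  have A0: "A 0 = 1\<^sub>m d" and A: "\<And>j. j \<in> {1..g} \<Longrightarrow> A j \<in> sym_mats d"
    using L by (auto simp: monic_pencil_def is_pencil_def)
  have one: "(1\<^sub>m k :: real mat) \<in> sym_mats k" for k by (simp add: sym_mats_def)
  have Xj: "X j \<in> sym_mats n" if "j \<in> {1..g}" for j using X that by (simp add: sym_tuple_def)
  define M where "M = pencil_eval g d A n X"
  have kc: "A j \<otimes>\<^sub>K X j \<in> carrier_mat (d * n) (d * n)" if "j \<in> {1..g}" for j
    using sym_matsD(1)[OF A[OF that]] sym_matsD(1)[OF Xj[OF that]] by (rule kron_carrier)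
  have k0: "1\<^sub>m d \<otimes>\<^sub>K 1\<^sub>m n \<in> carrier_mat (d * n) (d * n)" by (rule kron_carrier) auto
  note fs = finsum_mat_entries[of "{1..g}" "\<lambda>j. A j \<otimes>\<^sub>K X j" "d * n" "d * n", OF _ kc]
  have M: "M \<in> carrier_mat (d * n) (d * n)" using fs by (simp add: M_def pencil_eval_def)
  have Me: "M $$ (r, c) = (1\<^sub>m d \<otimes>\<^sub>K 1\<^sub>m n) $$ (r, c) + (\<Sum>j=1..g. (A j \<otimes>\<^sub>K X j) $$ (r, c))"
    if "r < d * n" "c < d * n" for r c
    using fs that k0 carrier_matD[OF conjunct1[OF fs]] by (simp add: M_def pencil_eval_def A0)
  have "M\<^sup>T = M"
  proof (rule eq_matI)
    fix r c assume "r < dim_row M" "c < dim_col M"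
    then have rc: "r < d * n" "c < d * n" using M by auto
    have "(\<Sum>j=1..g. (A j \<otimes>\<^sub>K X j) $$ (c, r)) = (\<Sum>j=1..g. (A j \<otimes>\<^sub>K X j) $$ (r, c))"
      using A Xj rc by (intro sum.cong refl kron_symmetric) auto
    then show "M\<^sup>T $$ (r, c) = M $$ (r, c)"
      using M rc Me[of r c] Me[of c r] kron_symmetric[OF one one rc] by simp
  qed (use M in auto)
  then have Msym: "M \<in> sym_mats (dim_row M)" using M by (auto simp: sym_mats_def)
  have quad: "(\<Sum>r<d * n. \<Sum>c<d * n. M $$ (r, c) * (v r * v c))
      = ip W W + (\<Sum>j=1..g. ip W (A j * (W * X j)))"
    if W: "W = mat d n (\<lambda>(i, k). v (i * n + k))" for W v
  proof -
    have Wc: "W \<in> carrier_mat d n" using W by simp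
    have "(\<Sum>r<d * n. \<Sum>c<d * n. M $$ (r, c) * (v r * v c))
        = (\<Sum>r<d * n. \<Sum>c<d * n. (1\<^sub>m d \<otimes>\<^sub>K 1\<^sub>m n) $$ (r, c) * (v r * v c))
          + (\<Sum>r<d * n. \<Sum>c<d * n. \<Sum>j=1..g. (A j \<otimes>\<^sub>K X j) $$ (r, c) * (v r * v c))"
      by (simp add: Me sum.distrib distrib_right sum_distrib_right)
    also have "(\<Sum>r<d * n. \<Sum>c<d * n. (1\<^sub>m d \<otimes>\<^sub>K 1\<^sub>m n) $$ (r, c) * (v r * v c)) = ip W W"
      using kron_quadratic[of "1\<^sub>m d" d "1\<^sub>m n" n v] Wc by (simp add: W[symmetric])
    also have "(\<Sum>r<d * n. \<Sum>c<d * n. \<Sum>j=1..g. (A j \<otimes>\<^sub>K X j) $$ (r, c) * (v r * v c))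
        = (\<Sum>r<d * n. \<Sum>j=1..g. \<Sum>c<d * n. (A j \<otimes>\<^sub>K X j) $$ (r, c) * (v r * v c))"
      by (intro sum.cong refl sum.swap)
    also have "\<dots> = (\<Sum>j=1..g. \<Sum>r<d * n. \<Sum>c<d * n. (A j \<otimes>\<^sub>K X j) $$ (r, c) * (v r * v c))"
      by (rule sum.swap)
    also have "\<dots> = (\<Sum>j=1..g. ip W (A j * (W * X j)))"
      unfolding W using sym_matsD[OF A] sym_matsD[OF Xj] by (intro sum.cong refl kron_quadratic) auto
    finally show ?thesis .
  qed
  have dM: "dim_row M = d * n" using M by simp
  show ?thesis
    unfolding psd_def M_def[symmetric] lmi_def
  proof (intro iffI conjI ballI Msym)
    assume "M \<in> sym_mats (dim_row M) \<and> (\<forall>v\<in>carrier_vec (dim_row M). 0 \<le> v \<bullet> (M *\<^sub>v v))"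
    then have pos: "0 \<le> v \<bullet> (M *\<^sub>v v)" if "v \<in> carrier_vec (d * n)" for v
      using that dM by simp
    fix W :: "real mat" assume W: "W \<in> carrier_mat d n"
    define v where "v = vec (d * n) (\<lambda>r. W $$ (r div n, r mod n))"
    have v: "v \<in> carrier_vec (d * n)" by (simp add: v_def)
    have "W = mat d n (\<lambda>(i, k). v $ (i * n + k))"
    proof (rule eq_matI)
      fix i k assume "i < dim_row (mat d n (\<lambda>(i, k). v $ (i * n + k)))"
        "k < dim_col (mat d n (\<lambda>(i, k). v $ (i * n + k)))"
      then have ik: "i < d" "k < n" by auto
      then have "i * n + k < Suc i * n" by simp
      also have "Suc i * n \<le> d * n" using ik by (intro mult_le_mono1) simp
      finally show "W $$ (i, k) = mat d n (\<lambda>(i, k). v $ (i * n + k)) $$ (i, k)"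
        using ik by (simp add: v_def)
    qed (use W in auto)
    from quad[OF this] show "0 \<le> ip W W + (\<Sum>j = 1..g. ip W (A j * (W * X j)))"
      using pos[OF v] scalar_prod_quadratic[OF v M] by simp
  next
    assume pos: "\<forall>W\<in>carrier_mat d n. 0 \<le> ip W W + (\<Sum>j = 1..g. ip W (A j * (W * X j)))"
    fix v :: "real vec" assume "v \<in> carrier_vec (dim_row M)"
    then have v: "v \<in> carrier_vec (d * n)" using dM by simp
    show "0 \<le> v \<bullet> (M *\<^sub>v v)"
      unfolding scalar_prod_quadratic[OF v M] quad[OF refl] using pos by simp
  qed
qed

lemma monic_pencil_sym_tuple: "monic_pencil g d A \<Longrightarrow> sym_tuple g d A"
  by (auto simp: monic_pencil_def is_pencil_def sym_tuple_def)

lemma free_spectrahedron_subset_iff: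
  assumes A: "monic_pencil g d A" and B: "monic_pencil g m B"
  shows "(\<forall>n. free_spectrahedron g d A n \<subseteq> free_spectrahedron g m B n) \<longleftrightarrow> dominates g d A m B"
proof
  assume sub: "\<forall>n. free_spectrahedron g d A n \<subseteq> free_spectrahedron g m B n"
  show "dominates g d A m B"
    unfolding dominates_def
  proof (intro allI impI)
    fix n X assume X: "sym_tuple g n X" and l: "lmi g d A n X"
    \<comment> \<open>Members of a free spectrahedron are extensional functions, while X is
      arbitrary outside {1..g}.\<close>
    define Y where "Y = restrict X {1..g}"
    have Y: "sym_tuple g n Y" "Y \<in> {1..g} \<rightarrow>\<^sub>E sym_mats n" using X by (auto simp: Y_def sym_tuple_def)
    have eq: "lmi g e C n Y = lmi g e C n X" for e C unfolding lmi_def Y_def by simp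
    have "Y \<in> free_spectrahedron g d A n"
      using Y l psd_pencil_eval_iff[OF A Y(1)] eq by (simp add: free_spectrahedron_def)
    then have "Y \<in> free_spectrahedron g m B n" using sub by blast
    then show "lmi g m B n X"
      using psd_pencil_eval_iff[OF B Y(1)] eq by (simp add: free_spectrahedron_def)
  qed
next
  assume dom: "dominates g d A m B"
  show "\<forall>n. free_spectrahedron g d A n \<subseteq> free_spectrahedron g m B n"
  proof (intro allI subsetI)
    fix n X assume X: "X \<in> free_spectrahedron g d A n"
    then have "sym_tuple g n X" by (auto simp: free_spectrahedron_def sym_tuple_def)
    then show "X \<in> free_spectrahedron g m B n"
      using X dom psd_pencil_eval_iff[OF A] psd_pencil_eval_iff[OF B]
      by (auto simp: free_spectrahedron_def dominates_def)
  qed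
qed

lemma free_spectrahedron_eq_iff:
  assumes "monic_pencil g d A" "monic_pencil g m B"
  shows "free_spectrahedron g d A = free_spectrahedron g m B \<longleftrightarrow>
    dominates g d A m B \<and> dominates g m B d A"
  using free_spectrahedron_subset_iff[OF assms] free_spectrahedron_subset_iff[OF assms(2,1)]
  by (auto simp: fun_eq_iff)

section \<open>Subpencils as isometric embeddings\<close>

text \<open>The orthonormal basis V is kept as the datum and the subspace is dropped: it is the
  column space of V, and its invariance follows from A V = V B.\<close>

definition embeds :: "nat \<Rightarrow> nat \<Rightarrow> pencil \<Rightarrow> nat \<Rightarrow> pencil \<Rightarrow> real mat \<Rightarrow> bool" where
  "embeds g m B d A V \<longleftrightarrow> V \<in> carrier_mat d m \<and> V\<^sup>T * V = 1\<^sub>m m \<and>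
    (\<forall>j\<in>{0..g}. B j \<in> carrier_mat m m \<and> A j * V = V * B j)"

text \<open>Turns properness of a subpencil into a comparison of sizes. If V is onto, its left
  inverse \<open>V\<^sup>T\<close> is also a right inverse.\<close>

lemma isometry_range_full_iff:
  fixes V :: "real mat"
  assumes V: "V \<in> carrier_mat d m" and iso: "V\<^sup>T * V = 1\<^sub>m m"
  shows "vec_space.col_space d V = carrier_vec d \<longleftrightarrow> m = d"
proof -
  have cs: "vec_space.col_space d V = {y \<in> carrier_vec d. \<exists>x\<in>carrier_vec m. V *\<^sub>v x = y}"
    using vec_space.col_space_eq[OF V] V by simp
  show ?thesis
  proof
    assume full: "vec_space.col_space d V = carrier_vec d"
    have "V * V\<^sup>T = 1\<^sub>m d"
    proof (rule eq_matI)
      fix i j assume "i < dim_row (1\<^sub>m d :: real mat)" "j < dim_col (1\<^sub>m d :: real mat)"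
      then have ij: "i < d" "j < d" by auto
      have VV: "V * V\<^sup>T \<in> carrier_mat d d" using V by simp
      have "unit_vec d j \<in> vec_space.col_space d V" using full by simp
      then obtain x where x: "x \<in> carrier_vec m" "V *\<^sub>v x = unit_vec d j" unfolding cs by auto
      have "V\<^sup>T *\<^sub>v (V *\<^sub>v x) = x"
        using assoc_mult_mat_vec[of "V\<^sup>T" m d V m x] V x iso by simp
      then have "(V * V\<^sup>T) *\<^sub>v unit_vec d j = unit_vec d j"
        using assoc_mult_mat_vec[of V d m "V\<^sup>T" d "unit_vec d j"] V x by simp
      moreover have "(M *\<^sub>v unit_vec d j) $ i = M $$ (i, j)" if "M \<in> carrier_mat d d" for M :: "real mat"
        using that ij by simp
      from this[OF VV] have "((V * V\<^sup>T) *\<^sub>v unit_vec d j) $ i = (V * V\<^sup>T) $$ (i, j)" .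
      ultimately show "(V * V\<^sup>T) $$ (i, j) = (1\<^sub>m d :: real mat) $$ (i, j)" using ij by simp
    qed (use V in auto)
    then have "d \<le> m" using isometry_square(1)[of "V\<^sup>T" m d] V by simp
    then show "m = d" using isometry_square(1)[OF V iso] by simp
  next
    assume "m = d"
    then have VV: "V * V\<^sup>T = 1\<^sub>m d" by (rule isometry_square(2)[OF V iso])
    have "y \<in> vec_space.col_space d V" if y: "y \<in> carrier_vec d" for y
    proof -
      have "V *\<^sub>v (V\<^sup>T *\<^sub>v y) = y"
        using assoc_mult_mat_vec[of V d m "V\<^sup>T" d y] V VV y by simp
      then show ?thesis unfolding cs using y V
        by (auto intro!: bexI[of _ "V\<^sup>T *\<^sub>v y"] mult_mat_vec_carrier[of _ m d])
    qed
    then show "vec_space.col_space d V = carrier_vec d" using cs by auto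
  qed
qed

lemma embeds_subpencil_on:
  assumes A: "monic_pencil g d A" and V: "embeds g m B d A V"
  shows "subpencil_on g d A (vec_space.col_space d V) m B"
proof -
  interpret vec_space "TYPE(real)" d .
  have Vc: "V \<in> carrier_mat d m" using V by (simp add: embeds_def)
  have cs: "col_space V = {y \<in> carrier_vec d. \<exists>x\<in>carrier_vec m. V *\<^sub>v x = y}"
    using col_space_eq[OF Vc] Vc by simp
  have "subspace class_ring (col_space V) (module_vec TYPE(real) d)"
    unfolding col_space_def using Vc cols_dim[of V] by (intro span_is_subspace) auto
  moreover have "A j *\<^sub>v h \<in> col_space V" if j: "j \<in> {0..g}" and h: "h \<in> col_space V" for j h
  proof -
    have Aj: "A j \<in> carrier_mat d d" using A j by (auto simp: monic_pencil_def is_pencil_def sym_mats_def)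
    have Bj: "B j \<in> carrier_mat m m" "A j * V = V * B j" using V j by (auto simp: embeds_def)
    obtain x where x: "x \<in> carrier_vec m" "V *\<^sub>v x = h" using h unfolding cs by auto
    have "A j *\<^sub>v h = V *\<^sub>v (B j *\<^sub>v x)"
      using x Aj Bj Vc assoc_mult_mat_vec[of "A j" d d V m x] assoc_mult_mat_vec[of V d m "B j" m x]
      by simp
    then show ?thesis unfolding cs using Aj Bj Vc x by auto
  qed
  ultimately show ?thesis using V unfolding subpencil_on_def embeds_def by blast
qed

lemma subpencil_on_iff_embeds:
  assumes "monic_pencil g d A"
  shows "(\<exists>H. subpencil_on g d A H m B) \<longleftrightarrow> (\<exists>V. embeds g m B d A V)"
  using embeds_subpencil_on[OF assms] unfolding subpencil_on_def embeds_def by blast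

lemma proper_subpencil_on_iff_embeds:
  assumes "monic_pencil g d A"
  shows "(\<exists>H. subpencil_on g d A H m B \<and> H \<noteq> carrier_vec d) \<longleftrightarrow> (\<exists>V. embeds g m B d A V) \<and> m < d"
    (is "?L \<longleftrightarrow> ?R")
proof
  assume ?L
  then obtain V where V: "embeds g m B d A V" "vec_space.col_space d V \<noteq> carrier_vec d"
    unfolding subpencil_on_def embeds_def by blast
  then have "m \<noteq> d" "m \<le> d"
    using isometry_range_full_iff[of V d m] isometry_square(1)[of V d m] by (auto simp: embeds_def)
  then show ?R using V(1) by auto
next
  assume ?R
  then obtain V where V: "embeds g m B d A V" "m < d" by blast
  then have "vec_space.col_space d V \<noteq> carrier_vec d"
    using isometry_range_full_iff[of V d m] by (auto simp: embeds_def)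
  then show ?L using embeds_subpencil_on[OF assms V(1)] by blast
qed

lemma embeds_monic:
  assumes A: "monic_pencil g d A" and V: "embeds g m B d A V"
  shows "monic_pencil g m B"
proof -
  have Vc: "V \<in> carrier_mat d m" and iso: "V\<^sup>T * V = 1\<^sub>m m" using V by (auto simp: embeds_def)
  have B: "B j \<in> carrier_mat m m" "B j = V\<^sup>T * (A j * V)" and Aj: "A j \<in> carrier_mat d d" "(A j)\<^sup>T = A j"
    if j: "j \<in> {0..g}" for j
  proof -
    show Bj: "B j \<in> carrier_mat m m" using V j by (auto simp: embeds_def)
    show "A j \<in> carrier_mat d d" "(A j)\<^sup>T = A j"
      using A j by (auto simp: monic_pencil_def is_pencil_def sym_mats_def)
    have "A j * V = V * B j" using V j by (auto simp: embeds_def)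
    then show "B j = V\<^sup>T * (A j * V)" using mat_assoc[of "V\<^sup>T" V "B j"] Vc Bj iso by simp
  qed
  have "(B j)\<^sup>T = B j" if "j \<in> {0..g}" for j
    using B(2)[OF that] Aj[OF that] Vc by (simp add: mat_transpose_mult mat_assoc)
  moreover have "B 0 = 1\<^sub>m m"
    using B(2)[of 0] A Vc iso by (simp add: monic_pencil_def)
  ultimately show ?thesis using B(1) by (auto simp: monic_pencil_def is_pencil_def sym_mats_def)
qed

lemma embeds_trans:
  assumes A: "monic_pencil g d A" and V: "embeds g m B d A V" and W: "embeds g k C m B W"
  shows "embeds g k C d A (V * W)"
proof -
  have Vc: "V \<in> carrier_mat d m" "V\<^sup>T * V = 1\<^sub>m m" and Wc: "W \<in> carrier_mat m k" "W\<^sup>T * W = 1\<^sub>m k"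
    using V W by (auto simp: embeds_def)
  have "(V * W)\<^sup>T * (V * W) = W\<^sup>T * (V\<^sup>T * V * W)"
    using Vc(1) Wc(1) by (simp add: mat_transpose_mult mat_assoc)
  also have "\<dots> = 1\<^sub>m k" using Vc Wc by simp
  finally have "(V * W)\<^sup>T * (V * W) = 1\<^sub>m k" .
  moreover have "A j * (V * W) = V * W * C j" if j: "j \<in> {0..g}" for j
  proof -
    have Aj: "A j \<in> carrier_mat d d" using A j by (auto simp: monic_pencil_def is_pencil_def sym_mats_def)
    have Bj: "B j \<in> carrier_mat m m" "A j * V = V * B j" and Cj: "C j \<in> carrier_mat k k" "B j * W = W * C j"
      using V W j by (auto simp: embeds_def)
    have "A j * (V * W) = A j * V * W" using Aj Vc Wc by (simp add: mat_assoc)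
    also have "\<dots> = V * (B j * W)" using Bj Vc Wc by (simp add: mat_assoc)
    also have "\<dots> = V * W * C j" using Cj Vc Wc by (simp add: mat_assoc)
    finally show ?thesis .
  qed
  ultimately show ?thesis using Vc Wc W by (auto simp: embeds_def)
qed

lemma sigma_minimal_iff:
  assumes "monic_pencil g d A"
  shows "sigma_minimal g d A \<longleftrightarrow>
    (\<forall>m B V. embeds g m B d A V \<longrightarrow> free_spectrahedron g m B = free_spectrahedron g d A \<longrightarrow> d \<le> m)"
  unfolding sigma_minimal_def proper_whole_subpencil_def proper_subpencil_on_iff_embeds[OF assms]
  by (meson leI not_le)

lemma whole_subpencil_iff:
  assumes "monic_pencil g d A"
  shows "whole_subpencil g d A m B \<longleftrightarrow>
    (\<exists>V. embeds g m B d A V) \<and> free_spectrahedron g m B = free_spectrahedron g d A"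
  unfolding whole_subpencil_def subpencil_on_iff_embeds[OF assms] ..

text \<open>In a whole subpencil of least size, a proper whole subpencil would by transitivity be a
  smaller whole subpencil of A. This existence keeps the universally quantified side of the theorem
  from being vacuous.\<close>

lemma sigma_minimal_whole_subpencil_exists:
  assumes A: "monic_pencil g d A"
  shows "\<exists>m B. whole_subpencil g d A m B \<and> sigma_minimal g m B"
proof -
  define P where "P = (\<lambda>m. \<exists>B. whole_subpencil g d A m B)"
  have "embeds g d A d A (1\<^sub>m d)"
    using A by (auto simp: embeds_def monic_pencil_def is_pencil_def sym_mats_def)
  then have "P d" unfolding P_def whole_subpencil_iff[OF A] by blast
  then have "P (LEAST m. P m)" by (rule LeastI)
  then obtain B where B: "whole_subpencil g d A (LEAST m. P m) B" unfolding P_def by blast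
  obtain V where V: "embeds g (LEAST m. P m) B d A V" using B unfolding whole_subpencil_iff[OF A] by blast
  have "sigma_minimal g (LEAST m. P m) B"
    unfolding sigma_minimal_iff[OF embeds_monic[OF A V]]
  proof (intro allI impI)
    fix k C W
    assume "embeds g k C (LEAST m. P m) B W"
      "free_spectrahedron g k C = free_spectrahedron g (LEAST m. P m) B"
    then have "whole_subpencil g d A k C"
      using embeds_trans[OF A V] B unfolding whole_subpencil_iff[OF A] by auto
    then have "P k" unfolding P_def by blast
    then show "(LEAST m. P m) \<le> k" by (rule Least_le)
  qed
  then show ?thesis using B by blast
qed

section \<open>Comparison with a common least tuple\<close>

lemma dominates_trans: "dominates g d A m B \<Longrightarrow> dominates g m B n C \<Longrightarrow> dominates g d A n C"
  unfolding dominates_def by blast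

lemma least_tuple_exists:
  assumes "sym_tuple g d A"
  shows "\<exists>n C. least_tuple g n C \<and> dominates g n C d A \<and> dominates g d A n C"
proof -
  define P where "P = (\<lambda>n. \<exists>C. sym_tuple g n C \<and> dominates g n C d A \<and> dominates g d A n C)"
  have "P d" unfolding P_def using assms by (auto simp: dominates_def)
  then have "P (LEAST n. P n)" by (rule LeastI)
  then obtain C where C: "sym_tuple g (LEAST n. P n) C" "dominates g (LEAST n. P n) C d A"
    "dominates g d A (LEAST n. P n) C" unfolding P_def by blast
  have "(LEAST n. P n) \<le> s"
    if "sym_tuple g s D" "dominates g s D (LEAST n. P n) C" "dominates g (LEAST n. P n) C s D" for s D
  proof -
    have "P s" unfolding P_def using that C dominates_trans by blast
    then show ?thesis by (rule Least_le)
  qed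
  then show ?thesis using C unfolding least_tuple_def by blast
qed

text \<open>The least tuple embeds isometrically into B, so n \<le> m; the embedded copy is a whole
  subpencil, so \<sigma>-minimality gives m \<le> n and the isometry is unitary.\<close>

lemma least_tuple_sigma_minimal:
  assumes least: "least_tuple g n C" and B: "monic_pencil g m B" and min: "sigma_minimal g m B"
    and dom: "dominates g n C m B" "dominates g m B n C"
  shows "n = m \<and> (\<exists>Z. unitary_mat m Z \<and> (\<forall>j\<in>{1..g}. B j = Z * (C j * Z\<^sup>T)))"
proof -
  have C: "sym_tuple g n C" using least by (simp add: least_tuple_def)
  have Bs: "sym_tuple g m B" using B by (rule monic_pencil_sym_tuple)
  obtain Vs Ws where "compression g n C m B Vs" "compression g m B n C Ws"
    using dominates_imp_compression[OF C Bs dom(1)] dominates_imp_compression[OF Bs C dom(2)] by blast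
  then obtain Z where Z: "intertwiner g n C m B Z" and iso: "Z\<^sup>T * Z = 1\<^sub>m n"
    using least_tuple_embeds[OF least Bs] by blast
  note Zc = intertwinerD(1-3)[OF Z]
  \<comment> \<open>A symmetric tuple leaves its entry at 0 open; setting it to the identity yields
    a monic pencil.\<close>
  let ?C = "C(0 := 1\<^sub>m n)"
  have emb: "embeds g n ?C m B Z"
    unfolding embeds_def
  proof (intro conjI ballI)
    fix j assume j: "j \<in> {0..g}"
    show "?C j \<in> carrier_mat n n" using sym_tupleD(1)[OF C, of j] j by auto
    show "B j * Z = Z * ?C j"
      using j intertwinerD(4)[OF Z, of j] B Zc by (cases "j = 0") (auto simp: monic_pencil_def)
  qed (use Zc iso in auto)
  have monic: "monic_pencil g n ?C" using embeds_monic[OF B emb] .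
  have "dominates g n ?C m B" "dominates g m B n ?C"
    using dom unfolding dominates_def lmi_def by auto
  then have "free_spectrahedron g n ?C = free_spectrahedron g m B"
    using free_spectrahedron_eq_iff[OF monic B] by blast
  then have "m \<le> n" using min emb unfolding sigma_minimal_iff[OF B] by blast
  then have nm: "n = m" using isometry_square(1)[OF Zc(1) iso] by simp
  then have ZZ: "Z * Z\<^sup>T = 1\<^sub>m m" using isometry_square(2)[OF Zc(1) iso] by simp
  have "B j = Z * (C j * Z\<^sup>T)" if j: "j \<in> {1..g}" for j
  proof -
    have "B j = B j * (Z * Z\<^sup>T)" using ZZ sym_tupleD[OF Bs j] by simp
    also have "\<dots> = B j * Z * Z\<^sup>T" using sym_tupleD[OF Bs j] Zc by (simp add: mat_assoc)
    also have "\<dots> = Z * (C j * Z\<^sup>T)"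
      using intertwinerD(4)[OF Z j] sym_tupleD[OF C j] Zc by (simp add: mat_assoc)
    finally show ?thesis .
  qed
  then show ?thesis using nm Zc iso ZZ by (auto simp: unitary_mat_def)
qed

lemma sigma_minimal_unitarily_equivalent:
  assumes B: "monic_pencil g m B" "sigma_minimal g m B"
    and C: "monic_pencil g k C" "sigma_minimal g k C"
    and eq: "free_spectrahedron g m B = free_spectrahedron g k C"
  shows "unitarily_equivalent g m B k C"
proof -
  have BC: "dominates g m B k C" "dominates g k C m B" using eq free_spectrahedron_eq_iff[OF B(1) C(1)] by auto
  obtain n D where D: "least_tuple g n D" "dominates g n D m B" "dominates g m B n D"
    using least_tuple_exists[OF monic_pencil_sym_tuple[OF B(1)]] by blast
  obtain Y where nm: "n = m" and Y: "unitary_mat m Y" "\<And>j. j \<in> {1..g} \<Longrightarrow> B j = Y * (D j * Y\<^sup>T)"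
    using least_tuple_sigma_minimal[OF D(1) B D(2,3)] by blast
  obtain Z where nk: "n = k" and Z: "unitary_mat k Z" "\<And>j. j \<in> {1..g} \<Longrightarrow> C j = Z * (D j * Z\<^sup>T)"
    using least_tuple_sigma_minimal[OF D(1) C] D(2,3) BC dominates_trans by blast
  have Yc: "Y \<in> carrier_mat m m" "Y\<^sup>T * Y = 1\<^sub>m m" "Y * Y\<^sup>T = 1\<^sub>m m"
    and Zc: "Z \<in> carrier_mat m m" "Z\<^sup>T * Z = 1\<^sub>m m" "Z * Z\<^sup>T = 1\<^sub>m m"
    using Y(1) Z(1) nm nk by (auto simp: unitary_mat_def)
  \<comment> \<open>From C to the common least tuple D by \<open>Z\<^sup>T\<close>, and on to B by
    Y.\<close>
  define U where "U = Y * Z\<^sup>T"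
  have U: "U \<in> carrier_mat m m" using Yc Zc by (simp add: U_def)
  have YY: "Y\<^sup>T * (Y * X) = X" and ZZ: "Z\<^sup>T * (Z * X) = X" if "dim_row X = m" for X
    using that Yc Zc mat_assoc[of "Y\<^sup>T" Y X] mat_assoc[of "Z\<^sup>T" Z X] by auto
  have unitary: "unitary_mat m U"
    using U Yc Zc unfolding unitary_mat_def U_def
    by (simp add: mat_transpose_mult mat_assoc YY ZZ)
  have "C j = U\<^sup>T * B j * U" if j: "j \<in> {0..g}" for j
  proof (cases "j = 0")
    case True
    have "B 0 = 1\<^sub>m m" "C 0 = 1\<^sub>m m" using B(1) C(1) nm nk by (auto simp: monic_pencil_def)
    then show ?thesis using True unitary U by (simp add: unitary_mat_def)
  next
    case False
    then have j': "j \<in> {1..g}" using j by auto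
    have Dj: "D j \<in> carrier_mat m m" using D(1) j' nm by (auto simp: least_tuple_def dest: sym_tupleD)
    show ?thesis
      using Dj Yc Zc unfolding Y(2)[OF j'] Z(2)[OF j'] U_def
      by (simp add: mat_transpose_mult mat_assoc YY ZZ)
  qed
  then show ?thesis using unitary nm nk unfolding unitarily_equivalent_def by blast
qed

lemma unitarily_equivalent_free_spectrahedron:
  assumes B: "monic_pencil g m B" and C: "monic_pencil g k C" and eq: "unitarily_equivalent g m B k C"
  shows "free_spectrahedron g m B = free_spectrahedron g k C"
proof -
  obtain U where mk: "k = m" and U: "U \<in> carrier_mat m m" "U\<^sup>T * U = 1\<^sub>m m" "U * U\<^sup>T = 1\<^sub>m m"
    and CU: "\<And>j. j \<in> {0..g} \<Longrightarrow> C j = U\<^sup>T * B j * U"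
    using eq by (auto simp: unitarily_equivalent_def unitary_mat_def)
  \<comment> \<open>Conjugation by an orthogonal matrix is a compression with a single Kraus
    operator; it is used for U and for its transpose.\<close>
  have comp: "dominates g m A m D"
    if "sym_tuple g m A" "V \<in> carrier_mat m m" "V\<^sup>T * V = 1\<^sub>m m" "\<And>j. j \<in> {1..g} \<Longrightarrow> D j = V\<^sup>T * (A j * V)"
    for A D and V :: "real mat"
  proof -
    have "dominates g m A m (\<lambda>j. V\<^sup>T * (A j * V))"
      using compression_dominates[OF that(1) isometry_compression[OF that(1-3)]] .
    then show ?thesis unfolding dominates_def lmi_def using that(4) by simp
  qed
  note Bs = monic_pencil_sym_tuple[OF B] and Cs = monic_pencil_sym_tuple[OF C, unfolded mk]
  have "dominates g m B m C"
    using U CU sym_tupleD[OF Bs] by (intro comp[OF Bs U(1,2)]) (simp add: mat_assoc)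
  moreover have "B j = (U\<^sup>T)\<^sup>T * (C j * U\<^sup>T)" if j: "j \<in> {1..g}" for j
  proof -
    note Bj = sym_tupleD[OF Bs j]
    have "U * (C j * U\<^sup>T) = (U * U\<^sup>T) * (B j * (U * U\<^sup>T))"
      using CU[of j] j U(1) Bj by (simp add: mat_assoc)
    then show ?thesis using U Bj by simp
  qed
  then have "dominates g m C m B" using U by (intro comp[OF Cs, of "U\<^sup>T"]) auto
  ultimately show ?thesis using free_spectrahedron_eq_iff[OF B C] mk by simp
qed

theorem theorem1p2:
  fixes g d1 d2 :: nat and A1 A2 :: pencil
  assumes "monic_pencil g d1 A1" and "monic_pencil g d2 A2"
  shows "free_spectrahedron g d1 A1 = free_spectrahedron g d2 A2 \<longleftrightarrow>
    (\<forall>m1 B1 m2 B2.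
       whole_subpencil g d1 A1 m1 B1 \<and> sigma_minimal g m1 B1 \<longrightarrow>
       whole_subpencil g d2 A2 m2 B2 \<and> sigma_minimal g m2 B2 \<longrightarrow>
       unitarily_equivalent g m1 B1 m2 B2)" (is "?L \<longleftrightarrow> ?R")
proof -
  have sub: "monic_pencil g m B \<and> free_spectrahedron g m B = free_spectrahedron g d A"
    if "monic_pencil g d A" "whole_subpencil g d A m B" for d A m B
    using that(2) embeds_monic[OF that(1)] unfolding whole_subpencil_iff[OF that(1)] by blast
  show ?thesis
  proof
    assume L: ?L
    show ?R
    proof (intro allI impI)
      fix m1 B1 m2 B2
      assume 1: "whole_subpencil g d1 A1 m1 B1 \<and> sigma_minimal g m1 B1"
        and 2: "whole_subpencil g d2 A2 m2 B2 \<and> sigma_minimal g m2 B2"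
      show "unitarily_equivalent g m1 B1 m2 B2"
        using sub[OF assms(1), of m1 B1] sub[OF assms(2), of m2 B2] 1 2 L
        by (intro sigma_minimal_unitarily_equivalent) auto
    qed
  next
    assume R: ?R
    \<comment> \<open>One pair is enough: its two members have the free spectrahedra of A1 and A2,
      and equivalence makes these equal.\<close>
    obtain m1 B1 m2 B2 where 1: "whole_subpencil g d1 A1 m1 B1" "sigma_minimal g m1 B1"
      and 2: "whole_subpencil g d2 A2 m2 B2" "sigma_minimal g m2 B2"
      using sigma_minimal_whole_subpencil_exists[OF assms(1)]
        sigma_minimal_whole_subpencil_exists[OF assms(2)] by blast
    then have "unitarily_equivalent g m1 B1 m2 B2" using R by blast
    then show ?L
      using sub[OF assms(1) 1(1)] sub[OF assms(2) 2(1)] unitarily_equivalent_free_spectrahedron by metis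
  qed
qed

end
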